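(* Let $s$ be a $\mathbb C^{p\times q}$-valued Schur multiplier (of the Drury-Arveson space on $\mathbb B_N$) and let $\nu\in\mathbb B_N$. Let $\xi\in\mathbb C^p$ and $\eta\in\mathbb C^q$ with $\eta^*\eta<\xi^*\xi$. Put $c=\begin{pmatrix}\xi\\ \eta\end{pmatrix}$ and $J_{p,q}=\begin{pmatrix}I_p&0\\0&-I_q\end{pmatrix}$, so that $c^*J_{p,q}c=\xi^*\xi-\eta^*\eta$, and let $U=\begin{pmatrix}U_1&U_2\\ U_3&U_4\end{pmatrix}$ be a $p\times p$ unitary matrix, with $U_1$ of size $(p-1)\times(p-1)$, whose last column is $\begin{pmatrix}U_2\\ U_4\end{pmatrix}=\frac{\xi}{\sqrt{\xi^*\xi}}$. Then $\xi^*s(\nu)=\eta^*$ if and only if there exists a (in general not uniquely defined) $\mathbb C^{(p-1+N)\times q}$-valued Schur multiplier $s_\nu$ such that, for all $\lambda\in\mathbb B_N$, $$s(\lambda)=\left(\begin{pmatrix}\frac{\xi b_\nu(\lambda)}{\sqrt{c^*J_{p,q}c}}&\begin{pmatrix}U_1\\ U_3\end{pmatrix}\end{pmatrix}s_\nu(\lambda)+\frac{\xi\eta^*}{c^*J_{p,q}c}\left(I_q+\frac{\eta\eta^*}{c^*J_{p,q}c}\right)^{-1/2}\right)\left(\begin{pmatrix}\frac{\eta b_\nu(\lambda)}{\sqrt{c^*J_{p,q}c}}&0\end{pmatrix}s_\nu(\lambda)+\left(I_q+\frac{\eta\eta^*}{c^*J_{p,q}c}\right)^{1/2}\right)^{-1},$$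 where the $0$ block has size $q\times(p-1)$.
   Context: $N,p,q$ are positive integers. $\mathbb B_N$ is the open unit ball of $\mathbb C^N$ (row vectors), with $\langle\lambda,\mu\rangle=\lambda\mu^*$. Vectors $\xi\in\mathbb C^p$, $\eta\in\mathbb C^q$ are columns. A $\mathbb C^{r\times t}$-valued Schur multiplier is a function $\sigma:\mathbb B_N\to\mathbb C^{r\times t}$ such that the kernel $\frac{I_r-\sigma(\lambda)\sigma(\mu)^*}{1-\langle\lambda,\mu\rangle}$ is positive (semidefinite) on $\mathbb B_N$. For $\nu\in\mathbb B_N$ the Blaschke factor is the $\mathbb C^{1\times N}$-valued function $b_\nu(\lambda)=\frac{(1-\langle\nu,\nu\rangle)^{1/2}}{1-\langle\lambda,\nu\rangle}(\lambda-\nu)(I_N-\nu^*\nu)^{-1/2}$. When $p=1$ the blocks $U_1,U_3$ and the $0$ block are absent. *)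

theory Defs
  imports
    "Jordan_Normal_Form.Schur_Decomposition"
    "Jordan_Normal_Form.Gauss_Jordan_Elimination"
begin

(* The order on complex is the one of HOL-Library.Complex_Order: z \<le> w means
   Re z \<le> Re w and Im z = Im w, so 0 \<le> z says that z is real and nonnegative.
   Row vectors are 1 x n matrices and column vectors are n x 1 matrices. *)

definition scalar_of :: "complex mat \<Rightarrow> complex" where
  "scalar_of A = A $$ (0, 0)"

definition append_cols :: "complex mat \<Rightarrow> complex mat \<Rightarrow> complex mat" where
  "append_cols A B = four_block_mat A B (0\<^sub>m 0 (dim_col A)) (0\<^sub>m 0 (dim_col B))"

definition unitary_mat :: "nat \<Rightarrow> complex mat \<Rightarrow> bool" where
  "unitary_mat n U \<longleftrightarrow> U \<in> carrier_mat n n \<and>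
     mat_adjoint U * U = 1\<^sub>m n \<and> U * mat_adjoint U = 1\<^sub>m n"

(* Over the complex numbers this forces A to be Hermitian. *)
definition pos_semidef :: "complex mat \<Rightarrow> bool" where
  "pos_semidef A \<longleftrightarrow> square_mat A \<and>
     (\<forall>x \<in> carrier_mat (dim_row A) 1. 0 \<le> scalar_of (mat_adjoint x * A * x))"

(* Meaningful for positive semidefinite A, where the positive semidefinite root is unique. *)
definition mat_sqrt :: "complex mat \<Rightarrow> complex mat" where
  "mat_sqrt A = (THE B. B \<in> carrier_mat (dim_row A) (dim_row A) \<and> pos_semidef B \<and> B * B = A)"

(* Meaningful for invertible A only. *)
definition mat_inv :: "complex mat \<Rightarrow> complex mat" where
  "mat_inv A = the (mat_inverse A)"

definition row_inner :: "complex mat \<Rightarrow> complex mat \<Rightarrow> complex" where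
  "row_inner l m = scalar_of (l * mat_adjoint m)"

definition unit_ball :: "nat \<Rightarrow> complex mat set" where
  "unit_ball N = {l \<in> carrier_mat 1 N. row_inner l l < 1}"

definition positive_kernel ::
  "nat \<Rightarrow> 'a set \<Rightarrow> ('a \<Rightarrow> 'a \<Rightarrow> complex mat) \<Rightarrow> bool" where
  "positive_kernel r X K \<longleftrightarrow>
     (\<forall>n (pt :: nat \<Rightarrow> 'a) (x :: nat \<Rightarrow> complex mat).
        (\<forall>i<n. pt i \<in> X \<and> x i \<in> carrier_mat r 1) \<longrightarrow>
        0 \<le> (\<Sum>i<n. \<Sum>j<n. scalar_of (mat_adjoint (x i) * K (pt i) (pt j) * x j)))"

definition schur_multiplier ::
  "nat \<Rightarrow> nat \<Rightarrow> nat \<Rightarrow> (complex mat \<Rightarrow> complex mat) \<Rightarrow> bool" where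
  "schur_multiplier N r t \<sigma> \<longleftrightarrow>
     (\<forall>l \<in> unit_ball N. \<sigma> l \<in> carrier_mat r t) \<and>
     positive_kernel r (unit_ball N)
       (\<lambda>l m. (1 / (1 - row_inner l m)) \<cdot>\<^sub>m (1\<^sub>m r - \<sigma> l * mat_adjoint (\<sigma> m)))"

(* csqrt is the principal square root, here of the positive real 1 - row_inner \<nu> \<nu>. *)
definition blaschke :: "nat \<Rightarrow> complex mat \<Rightarrow> complex mat \<Rightarrow> complex mat" where
  "blaschke N \<nu> l = (csqrt (1 - row_inner \<nu> \<nu>) / (1 - row_inner l \<nu>)) \<cdot>\<^sub>m
     ((l - \<nu>) * mat_inv (mat_sqrt (1\<^sub>m N - mat_adjoint \<nu> * \<nu>)))"

definition signature_mat :: "nat \<Rightarrow> nat \<Rightarrow> complex mat" where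
  "signature_mat p q = four_block_mat (1\<^sub>m p) (0\<^sub>m p q) (0\<^sub>m q p) (- 1\<^sub>m q)"

end

theory Submission
  imports Defs "HOL-Analysis.Function_Topology" "HOL-Analysis.L2_Norm"
begin

text \<open>
  Write \<open>k\<close> for \<open>\<xi>\<^sup>*\<xi> - \<eta>\<^sup>*\<eta>\<close>, \<open>b\<close> for the Blaschke factor, \<open>U\<close> for the first \<open>p - 1\<close> columns of the unitary
  matrix, and \<open>R\<close> for the square root of \<open>I + \<eta> \<eta>\<^sup>* / k\<close>. Once the denominator is cleared, the formula for \<open>s\<close> in
  terms of the parameter \<open>\<sigma>\<close> is the linear equation \<open>A \<sigma> = B\<close>, where
  \<open>A = ((\<xi> - s \<eta>) b / \<surd>k, U)\<close> and \<open>B = s R - \<xi> \<eta>\<^sup>* R\<^sup>-\<^sup>1 / k\<close>. The coefficients form a \<open>J\<close>-unitary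
  matrix function (\<open>gram_identity\<close>):

  \<open>A(\<lambda>) A(\<mu>)\<^sup>* - B(\<lambda>) B(\<mu>)\<^sup>* = I - s(\<lambda>) s(\<mu>)\<^sup>* - (\<xi> - s(\<lambda>) \<eta>) (\<xi> - s(\<mu>) \<eta>)\<^sup>* (1 - b(\<lambda>) b(\<mu>)\<^sup>*) / k\<close>.

  Dividing by \<open>1 - \<langle>\<lambda>, \<mu>\<rangle>\<close> and using
  \<open>1 - b(\<lambda>) b(\<mu>)\<^sup>* = (1 - \<langle>\<nu>, \<nu>\<rangle>) (1 - \<langle>\<lambda>, \<mu>\<rangle>) / ((1 - \<langle>\<lambda>, \<nu>\<rangle>) (1 - \<langle>\<nu>, \<mu>\<rangle>))\<close> (\<open>blaschke_kernel\<close>), the right hand side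
  becomes, if \<open>\<xi>\<^sup>* s(\<nu>) = \<eta>\<^sup>*\<close>, the Schur complement of the kernel of \<open>s\<close> with respect to the point \<open>\<nu>\<close> and the
  vector \<open>\<xi>\<close>. Hence it is a positive kernel (\<open>schur_complement_positive\<close>). A factorisation theorem of Leech type
  for the Drury--Arveson kernel then gives a Schur multiplier \<open>\<sigma>\<close> with \<open>A \<sigma> = B\<close> (\<open>exists_parameter\<close>).

  That theorem is proved as a left tangential interpolation theorem. For finitely many points, a lurking isometry
  argument applies: the positive kernel is a Gram matrix \<open>h h\<^sup>*\<close>, two families of rows have equal Gram matrices and are
  therefore related by a contraction \<open>V\<close> (\<open>equal_gram_imp_contraction\<close>), and the transfer function of \<open>V\<close> is the
  interpolant (\<open>transfer_function\<close>, \<open>tangential_interpolation_finite\<close>). Everything here is finite-dimensional; the passage to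
  all points of the ball is by compactness (\<open>tangential_interpolation\<close>).

  Invertibility of the denominator follows from \<open>A \<sigma> = B\<close> and \<open>k > 0\<close> by linear algebra (\<open>invertible_den\<close>), and the
  converse implication is evaluation at \<open>\<nu>\<close>, where \<open>b\<close> vanishes and \<open>\<xi>\<^sup>* U = 0\<close> (\<open>value_at_zero\<close>).
\<close>

section \<open>Matrix calculus with adjoints\<close>

lemma adjoint_dim [simp]:
  "dim_row (mat_adjoint A) = dim_col A" "dim_col (mat_adjoint A) = dim_row A"
  by (auto simp: mat_adjoint_def)

lemma adjoint_carrier [simp]: "mat_adjoint A \<in> carrier_mat n m \<longleftrightarrow> A \<in> carrier_mat m n"
  unfolding carrier_mat_def mem_Collect_eq adjoint_dim by blast

lemma adjoint_index [simp]:
  fixes A :: "complex mat"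
  assumes "i < dim_col A" "j < dim_row A"
  shows "mat_adjoint A $$ (i, j) = cnj (A $$ (j, i))"
  using assms by (simp add: mat_adjoint_def mat_of_rows_def)

lemma mult_index:
  assumes "i < dim_row A" "j < dim_col B" "dim_col A = dim_row B"
  shows "(A * B) $$ (i, j) = (\<Sum>k<dim_row B. A $$ (i, k) * B $$ (k, j))"
  using assms by (simp add: scalar_prod_def lessThan_atLeast0)

lemma adjoint_adjoint [simp]: "mat_adjoint (mat_adjoint A) = (A :: complex mat)"
  by (rule eq_matI) auto

lemma adjoint_one [simp]: "mat_adjoint (1\<^sub>m n :: complex mat) = 1\<^sub>m n"
  by (rule eq_matI) auto

lemma adjoint_zero [simp]: "mat_adjoint (0\<^sub>m n m :: complex mat) = 0\<^sub>m m n"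
  by (rule eq_matI) auto

lemma adjoint_smult [simp]: "mat_adjoint (c \<cdot>\<^sub>m A) = cnj c \<cdot>\<^sub>m mat_adjoint (A :: complex mat)"
  by (rule eq_matI) auto

lemma adjoint_add [simp]:
  fixes A B :: "complex mat"
  assumes "dim_row A = dim_row B" "dim_col A = dim_col B"
  shows "mat_adjoint (A + B) = mat_adjoint A + mat_adjoint B"
  by (rule eq_matI) (use assms in auto)

lemma adjoint_minus [simp]:
  fixes A B :: "complex mat"
  assumes "dim_row A = dim_row B" "dim_col A = dim_col B"
  shows "mat_adjoint (A - B) = mat_adjoint A - mat_adjoint B"
  by (rule eq_matI) (use assms in auto)

lemma adjoint_mult [simp]:
  fixes A B :: "complex mat"
  assumes "dim_col A = dim_row B"
  shows "mat_adjoint (A * B) = mat_adjoint B * mat_adjoint A"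
proof (rule eq_matI)
  fix i j
  assume "i < dim_row (mat_adjoint B * mat_adjoint A)" "j < dim_col (mat_adjoint B * mat_adjoint A)"
  then have ij: "i < dim_col B" "j < dim_row A" by auto
  have "mat_adjoint (A * B) $$ (i, j) = cnj ((A * B) $$ (j, i))" using ij by (subst adjoint_index) auto
  also have "\<dots> = (\<Sum>k<dim_row B. mat_adjoint B $$ (i, k) * mat_adjoint A $$ (k, j))"
    using ij assms by (subst mult_index) (auto simp: mult.commute intro!: sum.cong)
  also have "\<dots> = (mat_adjoint B * mat_adjoint A) $$ (i, j)"
    using ij assms by (subst mult_index) auto
  finally show "mat_adjoint (A * B) $$ (i, j) = (mat_adjoint B * mat_adjoint A) $$ (i, j)" .
qed auto

text \<open>The ring laws with side conditions on dimensions rather than carriers, so that the simplifier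
  can discharge them.\<close>

lemma mat_mult_assoc:
  fixes A B C :: "'a :: semiring_0 mat"
  assumes "dim_col A = dim_row B" "dim_col B = dim_row C"
  shows "A * B * C = A * (B * C)"
  by (rule assoc_mult_mat[of _ "dim_row A" "dim_row B" _ "dim_row C" _ "dim_col C"]) (use assms in auto)

lemma mat_add_mult:
  fixes A B C :: "'a :: semiring_0 mat"
  assumes "dim_row A = dim_row B" "dim_col A = dim_col B" "dim_col B = dim_row C"
  shows "(A + B) * C = A * C + B * C"
  by (rule add_mult_distrib_mat[of _ "dim_row A" "dim_col A" _ _ "dim_col C"]) (use assms in auto)

lemma mat_mult_add:
  fixes A B C :: "'a :: semiring_0 mat"
  assumes "dim_row B = dim_row C" "dim_col B = dim_col C" "dim_col A = dim_row C"
  shows "A * (B + C) = A * B + A * C"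
  by (rule mult_add_distrib_mat[of _ "dim_row A" "dim_row B" _ "dim_col C"]) (use assms in auto)

lemma mat_minus_mult:
  fixes A B C :: "'a :: ring mat"
  assumes "dim_row A = dim_row B" "dim_col A = dim_col B" "dim_col B = dim_row C"
  shows "(A - B) * C = A * C - B * C"
  by (rule minus_mult_distrib_mat[of _ "dim_row A" "dim_col A" _ _ "dim_col C"]) (use assms in auto)

lemma mat_mult_minus:
  fixes A B C :: "'a :: ring mat"
  assumes "dim_row B = dim_row C" "dim_col B = dim_col C" "dim_col A = dim_row C"
  shows "A * (B - C) = A * B - A * C"
  by (rule mult_minus_distrib_mat[of _ "dim_row A" "dim_row B" _ "dim_col C"]) (use assms in auto)

lemma mat_smult_mult:
  fixes A B :: "'a :: comm_semiring_0 mat"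
  assumes "dim_col A = dim_row B"
  shows "(c \<cdot>\<^sub>m A) * B = c \<cdot>\<^sub>m (A * B)" "A * (c \<cdot>\<^sub>m B) = c \<cdot>\<^sub>m (A * B)"
   apply (rule mult_smult_assoc_mat[of _ "dim_row A" "dim_row B" _ "dim_col B"])
  using assms apply auto[2]
  apply (rule mult_smult_distrib[of _ "dim_row A" "dim_row B" _ "dim_col B"])
  using assms apply auto
  done

lemma mat_one_mult:
  fixes A :: "'a :: semiring_1 mat"
  shows "dim_row A = n \<Longrightarrow> 1\<^sub>m n * A = A" "dim_col A = n \<Longrightarrow> A * 1\<^sub>m n = A"
  using left_mult_one_mat[of A n "dim_col A"] right_mult_one_mat[of A "dim_row A" n] by auto

lemma mat_zero_mult:
  fixes A :: "'a :: semiring_0 mat"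
  shows "dim_row A = n \<Longrightarrow> 0\<^sub>m k n * A = 0\<^sub>m k (dim_col A)"
    "dim_col A = n \<Longrightarrow> A * 0\<^sub>m n k = 0\<^sub>m (dim_row A) k"
  by (rule left_mult_zero_mat, rule carrier_matI, assumption, rule refl)
    (rule right_mult_zero_mat, rule carrier_matI, rule refl, assumption)

lemmas mat_ring = mat_mult_assoc mat_add_mult mat_mult_add mat_minus_mult mat_mult_minus
  mat_smult_mult mat_one_mult mat_zero_mult

lemma mat_add_zero [simp]:
  fixes A :: "'a :: comm_monoid_add mat"
  shows "dim_row A = n \<Longrightarrow> dim_col A = m \<Longrightarrow> A + 0\<^sub>m n m = A"
    "dim_row A = n \<Longrightarrow> dim_col A = m \<Longrightarrow> 0\<^sub>m n m + A = A"
  by (rule eq_matI; simp)+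

lemma mat_smult_smult: "c \<cdot>\<^sub>m (d \<cdot>\<^sub>m A) = (c * d) \<cdot>\<^sub>m (A :: 'a :: semigroup_mult mat)"
  by (rule eq_matI) (auto simp: mult.assoc)

lemma mat_smult_minus:
  fixes A B :: "'a :: ring mat"
  assumes "dim_row A = dim_row B" "dim_col A = dim_col B"
  shows "c \<cdot>\<^sub>m (A - B) = c \<cdot>\<^sub>m A - c \<cdot>\<^sub>m B"
  by (rule eq_matI) (use assms in \<open>auto simp: right_diff_distrib\<close>)

lemma mat_eq_diffI:
  fixes A B C :: "complex mat"
  assumes "A + B = C" "dim_row A = dim_row B" "dim_col A = dim_col B"
  shows "A = C - B"
  unfolding assms(1)[symmetric] by (rule eq_matI) (use assms(2,3) in auto)

lemma scalar_of_simps [simp]: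
  "0 < dim_row B \<Longrightarrow> 0 < dim_col B \<Longrightarrow> scalar_of (A + B) = scalar_of A + scalar_of B"
  "0 < dim_row B \<Longrightarrow> 0 < dim_col B \<Longrightarrow> scalar_of (A - B) = scalar_of A - scalar_of B"
  "0 < dim_row A \<Longrightarrow> 0 < dim_col A \<Longrightarrow> scalar_of (c \<cdot>\<^sub>m A) = c * scalar_of A"
  "0 < dim_row A \<Longrightarrow> 0 < dim_col A \<Longrightarrow> scalar_of (mat_adjoint A) = cnj (scalar_of A)"
  "0 < n \<Longrightarrow> scalar_of (1\<^sub>m n) = 1"
  "0 < n \<Longrightarrow> 0 < m \<Longrightarrow> scalar_of (0\<^sub>m n m) = 0"
  by (auto simp: scalar_of_def)

lemma scalar_of_mult:
  assumes "dim_row A = 1" "dim_col A = 1" "dim_row B = 1" "dim_col B > 0"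
  shows "scalar_of (A * B) = scalar_of A * scalar_of B"
  unfolding scalar_of_def using assms by (subst mult_index) auto

text \<open>A product through a one-dimensional space is a scalar multiple; this is how every inner product
  inside a longer matrix product is evaluated.\<close>

lemma mult_scalar_left:
  assumes "dim_row A = 1" "dim_col A = 1" "dim_row B = 1"
  shows "A * B = scalar_of A \<cdot>\<^sub>m B"
  by (rule eq_matI) (use assms in \<open>auto simp: mult_index scalar_of_def simp del: index_mult_mat(1)\<close>)

lemma mult_scalar_right:
  assumes "dim_row A = 1" "dim_col A = 1" "dim_col B = 1"
  shows "B * A = scalar_of A \<cdot>\<^sub>m B"
  by (rule eq_matI) (use assms in \<open>auto simp: mult_index scalar_of_def simp del: index_mult_mat(1)\<close>)

lemma scalar_gram:
  assumes "dim_row x = 1"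
  shows "scalar_of (x * mat_adjoint x) = complex_of_real (\<Sum>k<dim_col x. (cmod (x $$ (0, k)))\<^sup>2)"
  unfolding scalar_of_def using assms
  by (subst mult_index) (auto simp: complex_norm_square intro!: sum.cong simp del: of_real_power)

lemma scalar_gram_nonneg: "dim_row x = 1 \<Longrightarrow> 0 \<le> scalar_of (x * mat_adjoint x)"
  by (simp add: scalar_gram less_eq_complex_def sum_nonneg)

lemma scalar_gram_eq_0:
  assumes "dim_row x = 1"
  shows "scalar_of (x * mat_adjoint x) = 0 \<longleftrightarrow> x = 0\<^sub>m 1 (dim_col x)"
proof
  assume "scalar_of (x * mat_adjoint x) = 0"
  then have "(\<Sum>k<dim_col x. (cmod (x $$ (0, k)))\<^sup>2) = 0"
    by (simp only: scalar_gram[OF assms] of_real_eq_0_iff)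
  then have "\<And>k. k < dim_col x \<Longrightarrow> x $$ (0, k) = 0"
    by (subst (asm) sum_nonneg_eq_0_iff) auto
  then show "x = 0\<^sub>m 1 (dim_col x)"
    by (intro eq_matI) (auto simp: assms)
next
  assume x: "x = 0\<^sub>m 1 (dim_col x)"
  have "scalar_of (0\<^sub>m 1 k * mat_adjoint (0\<^sub>m 1 k)) = 0" for k
    by (simp add: mat_zero_mult)
  from this[of "dim_col x"] x show "scalar_of (x * mat_adjoint x) = 0" by argo
qed

lemma scalar_gram_col_nonneg: "dim_col x = 1 \<Longrightarrow> 0 \<le> scalar_of (mat_adjoint x * x)"
  using scalar_gram_nonneg[of "mat_adjoint x"] by simp

lemma scalar_gram_col_eq_0:
  assumes "dim_col x = 1"
  shows "scalar_of (mat_adjoint x * x) = 0 \<longleftrightarrow> x = 0\<^sub>m (dim_row x) 1"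
proof -
  have "mat_adjoint x = 0\<^sub>m 1 (dim_row x) \<longleftrightarrow> x = 0\<^sub>m (dim_row x) 1"
  proof
    assume h: "mat_adjoint x = 0\<^sub>m 1 (dim_row x)"
    from arg_cong[OF h, of mat_adjoint] show "x = 0\<^sub>m (dim_row x) 1" by (simp del: One_nat_def)
  next
    assume h: "x = 0\<^sub>m (dim_row x) 1"
    from arg_cong[OF h, of mat_adjoint] show "mat_adjoint x = 0\<^sub>m 1 (dim_row x)"
      by (simp del: One_nat_def)
  qed
  then show ?thesis using scalar_gram_eq_0[of "mat_adjoint x"] assms by simp
qed

lemma mat_inv_eqI:
  assumes "A \<in> carrier_mat n n" "B \<in> carrier_mat n n" "A * B = 1\<^sub>m n"
  shows "mat_inv A = B"
proof -
  have BA: "B * A = 1\<^sub>m n"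
    using mat_mult_left_right_inverse[OF assms] .
  have "A \<in> Units (ring_mat TYPE(complex) n ())"
    unfolding Units_def using assms BA by (auto simp: ring_mat_simps)
  then obtain C where C: "mat_inverse A = Some C"
    using mat_inverse(1)[OF assms(1), where b = "()"] by (cases "mat_inverse A") auto
  from mat_inverse(2)[OF assms(1) this] have C': "C * A = 1\<^sub>m n" "C \<in> carrier_mat n n" by auto
  have "C = C * (A * B)" using C' assms by simp
  also have "\<dots> = C * A * B" using C'(2) assms by (simp add: assoc_mult_mat[of _ n n _ n _ n])
  also have "\<dots> = B" using C'(1) assms(2) by simp
  finally show ?thesis using C by (simp add: mat_inv_def)
qed

lemma injective_imp_inverse:
  fixes A :: "complex mat"
  assumes A: "A \<in> carrier_mat n n"
    and inj: "\<And>x. x \<in> carrier_mat n 1 \<Longrightarrow> A * x = 0\<^sub>m n 1 \<Longrightarrow> x = 0\<^sub>m n 1"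
  obtains B where "B \<in> carrier_mat n n" "A * B = 1\<^sub>m n" "B * A = 1\<^sub>m n"
proof -
  have "det A \<noteq> 0"
  proof
    assume "det A = 0"
    then obtain v where v: "v \<in> carrier_vec n" "v \<noteq> 0\<^sub>v n" "A *\<^sub>v v = 0\<^sub>v n"
      using det_0_iff_vec_prod_zero_field[OF A] by auto
    define x where "x = mat n 1 (\<lambda>(i, j). vec_index v i)"
    have "A * x = 0\<^sub>m n 1"
    proof (rule eq_matI)
      fix i j assume "i < dim_row (0\<^sub>m n 1 :: complex mat)" "j < dim_col (0\<^sub>m n 1 :: complex mat)"
      then have i: "i < n" "j = 0" by auto
      have "(A * x) $$ (i, j) = vec_index (A *\<^sub>v v) i"
        using i A v(1) by (simp add: x_def mult_mat_vec_def scalar_prod_def)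
      then show "(A * x) $$ (i, j) = 0\<^sub>m n 1 $$ (i, j)" using i v(3) by simp
    qed (use A in \<open>auto simp: x_def\<close>)
    then have "x = 0\<^sub>m n 1" using inj[of x] by (simp add: x_def)
    then have "vec_index v i = 0" if "i < n" for i
    proof -
      have "vec_index v i = x $$ (i, 0)" using that by (simp add: x_def)
      also have "x $$ (i, 0) = 0" by (simp only: \<open>x = 0\<^sub>m n 1\<close>) (simp add: that)
      finally show ?thesis .
    qed
    then have "v = 0\<^sub>v n" using v(1) by (intro eq_vecI) auto
    with v(2) show False by simp
  qed
  from det_non_zero_imp_unit[OF A this, where b = "()"]
  obtain B where B: "B \<in> carrier_mat n n" "A * B = 1\<^sub>m n" "B * A = 1\<^sub>m n"
    unfolding Units_def ring_mat_simps by blast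
  then show ?thesis by (rule that)
qed

section \<open>Square roots of rank-one perturbations of the identity\<close>

text \<open>Uniqueness of the positive root, for matrices \<open>C\<close> that are definite and commute with everything that commutes
  with \<open>A = C\<^sup>2\<close>: for another root \<open>B\<close>, \<open>(B + C) (B - C) = 0\<close> and \<open>B + C\<close> is injective.\<close>

lemma mat_sqrt_eqI:
  assumes C: "C \<in> carrier_mat n n" "pos_semidef C" "C * C = A"
    and definite: "\<And>x. x \<in> carrier_mat n 1 \<Longrightarrow> scalar_of (mat_adjoint x * C * x) = 0 \<Longrightarrow> x = 0\<^sub>m n 1"
    and comm: "\<And>B. B \<in> carrier_mat n n \<Longrightarrow> B * A = A * B \<Longrightarrow> B * C = C * B"
  shows "mat_sqrt A = C"
proof -
  have A: "A \<in> carrier_mat n n" using C by auto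
  then have dA: "dim_row A = n" "dim_col A = n" by auto
  have "B = C" if B: "B \<in> carrier_mat n n" "pos_semidef B" "B * B = A" for B
  proof -
    have d: "dim_row B = n" "dim_col B = n" "dim_row C = n" "dim_col C = n" using B C by auto
    have "B * A = A * B" unfolding B(3)[symmetric] by (simp add: mat_ring d)
    from comm[OF B(1) this] have BC: "B * C = C * B" .
    have inj: "x = 0\<^sub>m n 1" if x: "x \<in> carrier_mat n 1" "(B + C) * x = 0\<^sub>m n 1" for x
    proof -
      have dx: "dim_row x = n" "dim_col x = 1" using x by auto
      have "scalar_of (mat_adjoint x * ((B + C) * x)) = 0"
        unfolding x(2) by (simp add: mat_ring dx)
      then have "scalar_of (mat_adjoint x * B * x) + scalar_of (mat_adjoint x * C * x) = 0"
        by (simp add: mat_ring dx d)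
      moreover have "0 \<le> scalar_of (mat_adjoint x * B * x)" "0 \<le> scalar_of (mat_adjoint x * C * x)"
        using B C x by (auto simp: pos_semidef_def)
      ultimately have "scalar_of (mat_adjoint x * C * x) = 0"
        by (simp add: add_nonneg_eq_0_iff)
      with definite x show ?thesis by blast
    qed
    have "B + C \<in> carrier_mat n n" using B C by simp
    from injective_imp_inverse[OF this inj]
    obtain D where D: "D \<in> carrier_mat n n" "D * (B + C) = 1\<^sub>m n" by blast
    have "(B + C) * (B - C) = 0\<^sub>m n n"
      by (rule eq_matI) (simp_all add: mat_ring d BC B(3) C(3) dA del: index_mult_mat(1))
    moreover have "D * (B + C) * (B - C) = D * ((B + C) * (B - C))"
      by (rule mat_mult_assoc) (use D(1) d in simp_all)
    ultimately have "D * (B + C) * (B - C) = 0\<^sub>m n n"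
      using D(1) by (simp add: mat_zero_mult)
    then have "B - C = 0\<^sub>m n n" unfolding D(2) by (simp add: mat_one_mult d)
    then have "(B - C) $$ (i, j) = 0" if "i < n" "j < n" for i j
      using that by simp
    then show ?thesis using d by (intro eq_matI) auto
  qed
  then show ?thesis
    unfolding mat_sqrt_def dA using C by (intro the_equality) blast+
qed

text \<open>Two matrices \<open>1 + a v v\<^sup>*\<close> and \<open>1 + b v v\<^sup>*\<close> multiply to a third one of the same form.\<close>

lemma rank_one_mult:
  assumes v: "v \<in> carrier_mat n 1"
  shows "(1\<^sub>m n + a \<cdot>\<^sub>m (v * mat_adjoint v)) * (1\<^sub>m n + b \<cdot>\<^sub>m (v * mat_adjoint v)) =
    1\<^sub>m n + (a + b + a * b * scalar_of (mat_adjoint v * v)) \<cdot>\<^sub>m (v * mat_adjoint v)"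
proof -
  have d: "dim_row v = n" "dim_col v = 1" using v by auto
  have "v * (mat_adjoint v * (v * mat_adjoint v)) = scalar_of (mat_adjoint v * v) \<cdot>\<^sub>m (v * mat_adjoint v)"
  proof -
    have "v * (mat_adjoint v * (v * mat_adjoint v)) = v * ((mat_adjoint v * v) * mat_adjoint v)"
      by (simp add: mat_ring d)
    also have "(mat_adjoint v * v) * mat_adjoint v = scalar_of (mat_adjoint v * v) \<cdot>\<^sub>m mat_adjoint v"
      by (rule mult_scalar_left) (simp_all add: d)
    finally show ?thesis by (simp add: mat_ring d)
  qed
  then show ?thesis
    by (intro eq_matI) (auto simp: mat_ring d algebra_simps)
qed

text \<open>The coefficient \<open>\<gamma>\<close> is chosen such that \<open>1 + \<gamma> v\<^sup>*v\<close> is the root of \<open>1 + t v\<^sup>*v\<close>.\<close>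

lemma rank_one_root:
  fixes t :: real
  assumes v: "v \<in> carrier_mat n 1" and m: "m = Re (scalar_of (mat_adjoint v * v))"
    and pos: "1 + t * m > 0"
  defines "\<gamma> \<equiv> t / (1 + sqrt (1 + t * m))"
  shows "(1\<^sub>m n + complex_of_real \<gamma> \<cdot>\<^sub>m (v * mat_adjoint v)) * (1\<^sub>m n + complex_of_real \<gamma> \<cdot>\<^sub>m (v * mat_adjoint v)) =
      1\<^sub>m n + complex_of_real t \<cdot>\<^sub>m (v * mat_adjoint v)"
    and "1 + \<gamma> * m > 0"
proof -
  define r where "r = sqrt (1 + t * m)"
  have r: "r > 0" "r * r = 1 + t * m" using pos by (auto simp: r_def)
  have "\<gamma> * m = r - 1"
    unfolding \<gamma>_def r_def[symmetric] using r by (simp add: field_simps)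
  then show "1 + \<gamma> * m > 0" using r by simp
  have g: "\<gamma> * (1 + r) = t" unfolding \<gamma>_def r_def[symmetric] using r by simp
  have "\<gamma> + \<gamma> + \<gamma> * \<gamma> * m = \<gamma> * (2 + \<gamma> * m)" by (simp add: algebra_simps)
  also have "\<dots> = t" unfolding \<open>\<gamma> * m = r - 1\<close> using g by (simp add: algebra_simps)
  finally have e: "\<gamma> + \<gamma> + \<gamma> * \<gamma> * m = t" .
  have "scalar_of (mat_adjoint v * v) = complex_of_real m"
    using scalar_gram_col_nonneg[of v] v m by (auto simp: complex_eq_iff less_eq_complex_def)
  then have "complex_of_real \<gamma> + complex_of_real \<gamma> + complex_of_real \<gamma> * complex_of_real \<gamma> * scalar_of (mat_adjoint v * v) = complex_of_real t"
    unfolding e[symmetric] by simp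
  then show "(1\<^sub>m n + complex_of_real \<gamma> \<cdot>\<^sub>m (v * mat_adjoint v)) * (1\<^sub>m n + complex_of_real \<gamma> \<cdot>\<^sub>m (v * mat_adjoint v)) =
      1\<^sub>m n + complex_of_real t \<cdot>\<^sub>m (v * mat_adjoint v)"
    by (simp add: rank_one_mult[OF v])
qed

lemma rank_one_inverse:
  fixes t :: real
  assumes v: "v \<in> carrier_mat n 1" and m: "m = Re (scalar_of (mat_adjoint v * v))"
    and pos: "1 + t * m > 0"
  shows "(1\<^sub>m n + complex_of_real t \<cdot>\<^sub>m (v * mat_adjoint v)) *
    (1\<^sub>m n + complex_of_real (- t / (1 + t * m)) \<cdot>\<^sub>m (v * mat_adjoint v)) = 1\<^sub>m n"
proof -
  have e: "t + (- t / (1 + t * m)) + t * (- t / (1 + t * m)) * m = 0"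
    using pos by (simp add: field_simps)
  have "scalar_of (mat_adjoint v * v) = complex_of_real m"
    using scalar_gram_col_nonneg[of v] v m by (auto simp: complex_eq_iff less_eq_complex_def)
  then have "complex_of_real t + complex_of_real (- t / (1 + t * m)) +
      complex_of_real t * complex_of_real (- t / (1 + t * m)) * scalar_of (mat_adjoint v * v) = 0"
    using arg_cong[OF e, of complex_of_real] by simp
  then show ?thesis
    unfolding rank_one_mult[OF v] using v by (auto intro!: eq_matI)
qed

text \<open>The case \<open>t = 0\<close> is excluded because commuting with \<open>A\<close> must imply commuting with \<open>v v\<^sup>*\<close>.\<close>

lemma mat_sqrt_rank_one:
  fixes t :: real
  assumes v: "v \<in> carrier_mat n 1" and m: "m = Re (scalar_of (mat_adjoint v * v))"
    and pos: "1 + t * m > 0" and t: "t \<noteq> 0"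
    and A: "A = 1\<^sub>m n + complex_of_real t \<cdot>\<^sub>m (v * mat_adjoint v)"
  shows "mat_sqrt A \<in> carrier_mat n n" "mat_adjoint (mat_sqrt A) = mat_sqrt A"
    "mat_sqrt A * mat_sqrt A = A"
    "mat_inv (mat_sqrt A) \<in> carrier_mat n n"
    "mat_adjoint (mat_inv (mat_sqrt A)) = mat_inv (mat_sqrt A)"
    "mat_sqrt A * mat_inv (mat_sqrt A) = 1\<^sub>m n"
    "mat_inv (mat_sqrt A) * mat_sqrt A = 1\<^sub>m n"
proof -
  define P where "P a = 1\<^sub>m n + complex_of_real a \<cdot>\<^sub>m (v * mat_adjoint v)" for a
  have dv: "dim_row v = n" "dim_col v = 1" using v by auto
  have P: "P a \<in> carrier_mat n n" "dim_row (P a) = n" "dim_col (P a) = n"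
    "mat_adjoint (P a) = P a" for a
    using v by (auto simp: P_def dv)
  define g where "g = t / (1 + sqrt (1 + t * m))"
  \<comment> \<open>\<open>P g\<close> is the root; it is positive definite because it is in turn the square of the invertible Hermitian \<open>P e\<close>.\<close>
  define e where "e = g / (1 + sqrt (1 + g * m))"
  have g: "P g * P g = P t" "1 + g * m > 0"
    using rank_one_root[OF v m pos] by (simp_all add: P_def g_def)
  have e: "P e * P e = P g" "1 + e * m > 0"
    using rank_one_root[OF v m g(2)] by (simp_all add: P_def e_def)
  obtain g' where g': "P g * P g' = 1\<^sub>m n" 
    using rank_one_inverse[OF v m g(2), folded P_def] by (rule that)
  obtain e' where e': "P e * P e' = 1\<^sub>m n" 
    using rank_one_inverse[OF v m e(2), folded P_def] by (rule that)
  have e'': "P e' * P e = 1\<^sub>m n"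
    by (rule mat_mult_left_right_inverse[OF P(1) P(1) e'])
  have quad: "scalar_of (mat_adjoint x * P g * x) = scalar_of (mat_adjoint (P e * x) * (P e * x))"
    if "x \<in> carrier_mat n 1" for x
    using that by (simp add: e(1)[symmetric] mat_ring P)
  have "sqrt (1 + t * m) \<ge> 0" using pos by simp
  then have "g \<noteq> 0" unfolding g_def using t by (simp add: add_nonneg_eq_0_iff)
  have sq: "mat_sqrt A = P g"
  proof (rule mat_sqrt_eqI[OF P(1)])
    show "pos_semidef (P g)"
      unfolding pos_semidef_def
    proof (intro conjI ballI)
      show "square_mat (P g)" by (simp add: P)
      fix x :: "complex mat" assume "x \<in> carrier_mat (dim_row (P g)) 1"
      then have x: "x \<in> carrier_mat n 1" by (simp only: P(2))
      then have "dim_col (P e * x) = 1" by simp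
      then show "0 \<le> scalar_of (mat_adjoint x * P g * x)"
        unfolding quad[OF x] by (rule scalar_gram_col_nonneg)
    qed
    show "P g * P g = A" using g A by (simp add: P_def)
    show "x = 0\<^sub>m n 1" if x: "x \<in> carrier_mat n 1" "scalar_of (mat_adjoint x * P g * x) = 0" for x
    proof -
      have "P e * x = 0\<^sub>m n 1"
        using x quad[OF x(1)] scalar_gram_col_eq_0[of "P e * x"] P by auto
      then have "P e' * P e * x = 0\<^sub>m n 1" using x P by (simp add: mat_ring)
      then show ?thesis using e'' x by (simp add: mat_ring)
    qed
    show "B * P g = P g * B" if B: "B \<in> carrier_mat n n" "B * A = A * B" for B
    proof -
      let ?V = "v * mat_adjoint v"
      have dB: "dim_row B = n" "dim_col B = n" using B by auto
      have "B + complex_of_real t \<cdot>\<^sub>m (B * ?V) = B + complex_of_real t \<cdot>\<^sub>m (?V * B)"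
        using B(2) by (simp add: A mat_ring dB dv)
      moreover have "X = Y" if "B + complex_of_real t \<cdot>\<^sub>m X = B + complex_of_real t \<cdot>\<^sub>m Y"
        "X \<in> carrier_mat n n" "Y \<in> carrier_mat n n" for X Y
      proof (rule eq_matI)
        fix i j assume "i < dim_row Y" "j < dim_col Y"
        then have ij: "i < n" "j < n" using that(3) by auto
        have "(B + complex_of_real t \<cdot>\<^sub>m X) $$ (i, j) = (B + complex_of_real t \<cdot>\<^sub>m Y) $$ (i, j)"
          by (simp only: that(1))
        then show "X $$ (i, j) = Y $$ (i, j)" using ij t that(2,3) by simp
      qed (use that in auto)
      ultimately have "B * ?V = ?V * B" using B(1) v by simp
      then show ?thesis by (simp add: P_def mat_ring dB dv)
    qed
  qed
  have inv: "mat_inv (P g) = P g'" by (rule mat_inv_eqI[OF P(1) P(1) g'])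
  show "mat_sqrt A \<in> carrier_mat n n" "mat_adjoint (mat_sqrt A) = mat_sqrt A"
    "mat_inv (mat_sqrt A) \<in> carrier_mat n n" "mat_adjoint (mat_inv (mat_sqrt A)) = mat_inv (mat_sqrt A)"
    "mat_sqrt A * mat_inv (mat_sqrt A) = 1\<^sub>m n"
    unfolding sq inv using P g' by auto
  show "mat_sqrt A * mat_sqrt A = A" unfolding sq g(1) by (simp add: A P_def)
  show "mat_inv (mat_sqrt A) * mat_sqrt A = 1\<^sub>m n"
    unfolding sq inv by (rule mat_mult_left_right_inverse[OF P(1) P(1) g'])
qed

lemma mat_inv_sqrt_rank_one_square:
  fixes t :: real
  assumes v: "v \<in> carrier_mat n 1" and m: "m = Re (scalar_of (mat_adjoint v * v))"
    and pos: "1 + t * m > 0" and t: "t \<noteq> 0"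
    and A: "A = 1\<^sub>m n + complex_of_real t \<cdot>\<^sub>m (v * mat_adjoint v)"
  shows "mat_inv (mat_sqrt A) * mat_inv (mat_sqrt A) =
    1\<^sub>m n + complex_of_real (- t / (1 + t * m)) \<cdot>\<^sub>m (v * mat_adjoint v)" (is "?Ri * ?Ri = ?X")
proof -
  note R = mat_sqrt_rank_one[OF assms]
  have X: "?X \<in> carrier_mat n n" using v by auto
  have d: "dim_row (mat_sqrt A) = n" "dim_col (mat_sqrt A) = n" "dim_row ?Ri = n" "dim_col ?Ri = n"
    "dim_row ?X = n" "dim_col ?X = n"
    using R(1,4) X by auto
  define S where "S = mat_sqrt A"
  define Q where "Q = mat_inv S"
  define X where "X = ?X"
  have dX: "dim_row X = n" "dim_col X = n" "dim_row S = n" "dim_col S = n" "dim_row Q = n" "dim_col Q = n"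
    using d unfolding X_def S_def Q_def by blast+
  have SX: "S * S * X = 1\<^sub>m n"
    unfolding S_def R(3) X_def by (simp only: A rank_one_inverse[OF v m pos])
  have QS: "Q * S = 1\<^sub>m n" using R(7) by (simp only: Q_def S_def)
  have "Q * Q = Q * Q * (S * S * X)"
    unfolding SX by (simp add: mat_one_mult dX)
  also have "\<dots> = Q * ((Q * S) * (S * X))"
    by (simp add: mat_mult_assoc dX)
  also have "\<dots> = Q * (S * X)" unfolding QS by (simp add: mat_one_mult dX)
  also have "\<dots> = (Q * S) * X" by (simp add: mat_mult_assoc dX)
  also have "\<dots> = X" unfolding QS by (simp add: mat_one_mult dX)
  finally show ?thesis by (simp only: Q_def S_def X_def)
qed

section \<open>Factorisation of positive semidefinite matrices\<close>

lemma adjoint_four_block: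
  fixes A B C D :: "complex mat"
  assumes "A \<in> carrier_mat r1 c1" "B \<in> carrier_mat r1 c2" "C \<in> carrier_mat r2 c1" "D \<in> carrier_mat r2 c2"
  shows "mat_adjoint (four_block_mat A B C D) =
    four_block_mat (mat_adjoint A) (mat_adjoint C) (mat_adjoint B) (mat_adjoint D)"
  by (rule eq_matI) (use assms in auto)

lemma block_quadratic_form:
  fixes a t v x K :: "complex mat"
  assumes c: "a \<in> carrier_mat 1 1" "v \<in> carrier_mat n 1" "K \<in> carrier_mat n n"
    "t \<in> carrier_mat 1 1" "x \<in> carrier_mat n 1"
  defines "z \<equiv> four_block_mat t (0\<^sub>m 1 0) x (0\<^sub>m n 0)"
  shows "z \<in> carrier_mat (Suc n) 1"
    and "scalar_of (mat_adjoint z * four_block_mat a (mat_adjoint v) v K * z) =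
      cnj (scalar_of t) * scalar_of a * scalar_of t + cnj (scalar_of t) * scalar_of (mat_adjoint v * x)
      + scalar_of (mat_adjoint x * v) * scalar_of t + scalar_of (mat_adjoint x * K * x)"
proof -
  have d: "dim_row a = 1" "dim_col a = 1" "dim_row v = n" "dim_col v = 1" "dim_row K = n" "dim_col K = n"
    "dim_row t = 1" "dim_col t = 1" "dim_row x = n" "dim_col x = 1" using c by auto
  show "z \<in> carrier_mat (Suc n) 1" unfolding z_def by (rule carrier_matI) (simp_all add: d)
  have adj: "mat_adjoint z = four_block_mat (mat_adjoint t) (mat_adjoint x) (0\<^sub>m 0 1) (0\<^sub>m 0 n)"
    unfolding z_def by (subst adjoint_four_block[OF c(4) zero_carrier_mat c(5) zero_carrier_mat]) simp
  have c': "mat_adjoint v \<in> carrier_mat 1 n" "mat_adjoint t \<in> carrier_mat 1 1" "mat_adjoint x \<in> carrier_mat 1 n"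
    using c by simp_all
  have *: "mat_adjoint z * four_block_mat a (mat_adjoint v) v K =
    four_block_mat (mat_adjoint t * a + mat_adjoint x * v) (mat_adjoint t * mat_adjoint v + mat_adjoint x * K)
      (0\<^sub>m 0 1 * a + 0\<^sub>m 0 n * v) (0\<^sub>m 0 1 * mat_adjoint v + 0\<^sub>m 0 n * K)"
    unfolding adj
    by (rule mult_four_block_mat[OF c'(2,3) zero_carrier_mat zero_carrier_mat c(1) c'(1) c(2,3)])
  define p where "p = mat_adjoint t * a + mat_adjoint x * v"
  define r where "r = mat_adjoint t * mat_adjoint v + mat_adjoint x * K"
  have dp: "p \<in> carrier_mat 1 1" "r \<in> carrier_mat 1 n"
    using d by (auto simp: p_def r_def intro!: carrier_matI)
  have *: "scalar_of (mat_adjoint z * four_block_mat a (mat_adjoint v) v K * z) = scalar_of (p * t + r * x)"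
    unfolding * p_def[symmetric] r_def[symmetric] unfolding z_def
    by (subst mult_four_block_mat[OF dp _ _ c(4) zero_carrier_mat c(5) zero_carrier_mat, where ?nr2.0 = 0])
      (use d dp in \<open>simp_all add: scalar_of_def\<close>)
  have "scalar_of (p * t + r * x) = scalar_of (mat_adjoint t * a * t) + scalar_of (mat_adjoint x * v * t)
      + (scalar_of (mat_adjoint t * (mat_adjoint v * x)) + scalar_of (mat_adjoint x * K * x))"
    unfolding p_def r_def by (simp add: mat_ring d)
  also have "scalar_of (mat_adjoint t * a * t) = cnj (scalar_of t) * scalar_of a * scalar_of t"
    by (simp add: scalar_of_mult d)
  also have "scalar_of (mat_adjoint x * v * t) = scalar_of (mat_adjoint x * v) * scalar_of t"
    by (simp add: scalar_of_mult d)
  also have "scalar_of (mat_adjoint t * (mat_adjoint v * x)) = cnj (scalar_of t) * scalar_of (mat_adjoint v * x)"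
    by (simp add: scalar_of_mult d)
  finally show "scalar_of (mat_adjoint z * four_block_mat a (mat_adjoint v) v K * z) =
      cnj (scalar_of t) * scalar_of a * scalar_of t + cnj (scalar_of t) * scalar_of (mat_adjoint v * x)
      + scalar_of (mat_adjoint x * v) * scalar_of t + scalar_of (mat_adjoint x * K * x)"
    unfolding * by (simp add: algebra_simps)
qed

text \<open>Diagonal matrices with real entries.\<close>

definition real_diag :: "nat \<Rightarrow> (nat \<Rightarrow> real) \<Rightarrow> complex mat" where
  "real_diag n d = mat n n (\<lambda>(i, j). if i = j then complex_of_real (d i) else 0)"

lemma real_diag_simps [simp]:
  "dim_row (real_diag n d) = n" "dim_col (real_diag n d) = n" "real_diag n d \<in> carrier_mat n n"
  "mat_adjoint (real_diag n d) = real_diag n d"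
  by (auto simp: real_diag_def intro!: eq_matI)

lemma real_diag_mult: "real_diag n d * real_diag n e = real_diag n (\<lambda>i. d i * e i)"
proof (rule eq_matI)
  fix i j assume "i < dim_row (real_diag n (\<lambda>i. d i * e i))" "j < dim_col (real_diag n (\<lambda>i. d i * e i))"
  then have ij: "i < n" "j < n" by auto
  have "(real_diag n d * real_diag n e) $$ (i, j) =
      (\<Sum>k<n. if k = i then complex_of_real (d i) * (if i = j then complex_of_real (e i) else 0) else 0)"
    using ij by (subst mult_index) (auto simp: real_diag_def simp del: sum.delta sum.delta' intro!: sum.cong)
  also have "\<dots> = real_diag n (\<lambda>i. d i * e i) $$ (i, j)" using ij by (simp add: real_diag_def)
  finally show "(real_diag n d * real_diag n e) $$ (i, j) = real_diag n (\<lambda>i. d i * e i) $$ (i, j)" .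
qed auto

lemma pos_semidef_D:
  "pos_semidef A \<Longrightarrow> A \<in> carrier_mat n n \<Longrightarrow> x \<in> carrier_mat n 1 \<Longrightarrow>
    0 \<le> scalar_of (mat_adjoint x * A * x)"
  unfolding pos_semidef_def by auto

text \<open>The \<open>LDL\<^sup>*\<close> decomposition, by Schur complements. If the corner entry \<open>\<alpha>\<close> vanishes, so does the
  rest \<open>v\<close> of its column, and \<open>\<alpha> \<cdot> (v / \<alpha>) = v\<close> holds in both cases since \<open>v / 0 = 0\<close>.\<close>

lemma ldl_decomposition:
  assumes "H \<in> carrier_mat n n" "mat_adjoint H = H" "pos_semidef H"
  shows "\<exists>S T d. S \<in> carrier_mat n n \<and> T \<in> carrier_mat n n \<and> T * S = 1\<^sub>m n \<and> (\<forall>i. 0 \<le> d i) \<and>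
    H = S * real_diag n d * mat_adjoint S"
  using assms
proof (induction n arbitrary: H)
  case 0
  show ?case
    by (rule exI[of _ "1\<^sub>m 0"], rule exI[of _ "1\<^sub>m 0"], rule exI[of _ "\<lambda>_. 0"])
      (use 0(1) in \<open>auto intro!: eq_matI\<close>)
next
  case (Suc n)
  have dH: "dim_row H = Suc n" "dim_col H = Suc n" using Suc.prems(1) by auto
  have herm: "cnj (H $$ (j, i)) = H $$ (i, j)" if "i < Suc n" "j < Suc n" for i j
    using that Suc.prems(2) adjoint_index[of i H j] dH by simp
  define a where "a = mat 1 1 (\<lambda>_. H $$ (0, 0))"
  define v where "v = mat n 1 (\<lambda>(i, _). H $$ (Suc i, 0))"
  define K where "K = mat n n (\<lambda>(i, j). H $$ (Suc i, Suc j))"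
  have c: "a \<in> carrier_mat 1 1" "v \<in> carrier_mat n 1" "K \<in> carrier_mat n n"
    by (auto simp: a_def v_def K_def)
  have d: "dim_row a = 1" "dim_col a = 1" "dim_row v = n" "dim_col v = 1" "dim_row K = n" "dim_col K = n"
    using c by auto
  have H: "H = four_block_mat a (mat_adjoint v) v K"
    by (rule eq_matI) (auto simp: d dH a_def v_def K_def herm)
  have Kh: "mat_adjoint K = K"
    by (rule eq_matI) (auto simp: K_def herm)
  have quad: "0 \<le> cnj (scalar_of t) * scalar_of a * scalar_of t + cnj (scalar_of t) * scalar_of (mat_adjoint v * x)
      + scalar_of (mat_adjoint x * v) * scalar_of t + scalar_of (mat_adjoint x * K * x)"
    if "t \<in> carrier_mat 1 1" "x \<in> carrier_mat n 1" for t x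
    using pos_semidef_D[OF Suc.prems(3,1)] block_quadratic_form[OF c that] unfolding H by metis
  have quad: "0 \<le> cnj t * scalar_of a * t + cnj t * scalar_of (mat_adjoint v * x)
      + scalar_of (mat_adjoint x * v) * t + scalar_of (mat_adjoint x * K * x)"
    if "x \<in> carrier_mat n 1" for t x
    using quad[of "t \<cdot>\<^sub>m 1\<^sub>m 1" x] that by simp
  define \<alpha> where "\<alpha> = Re (scalar_of a)"
  have a0: "0 \<le> scalar_of a"
    using quad[of "0\<^sub>m n 1" 1] by (simp add: mat_ring d)
  then have \<alpha>: "0 \<le> \<alpha>" "scalar_of a = complex_of_real \<alpha>"
    by (auto simp: \<alpha>_def less_eq_complex_def complex_eq_iff)
  have v0: "v = 0\<^sub>m n 1" if "\<alpha> = 0"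
  proof (rule ccontr)
    assume nz: "v \<noteq> 0\<^sub>m n 1"
    define m where "m = Re (scalar_of (mat_adjoint v * v))"
    have m: "scalar_of (mat_adjoint v * v) = complex_of_real m" "m \<ge> 0" "m \<noteq> 0"
      using scalar_gram_col_nonneg[of v] scalar_gram_col_eq_0[of v] nz d
      by (auto simp: m_def less_eq_complex_def complex_eq_iff)
    define \<beta> where "\<beta> = Re (scalar_of (mat_adjoint v * K * v))"
    have "0 \<le> Re (cnj (complex_of_real s) * scalar_of (mat_adjoint v * v)
      + scalar_of (mat_adjoint v * v) * complex_of_real s + scalar_of (mat_adjoint v * K * v))" for s
      using quad[OF c(2), of "complex_of_real s"] \<alpha>(2) that unfolding less_eq_complex_def by simp
    then have "0 \<le> 2 * s * m + \<beta>" for s by (simp add: m(1) \<beta>_def mult.assoc)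
    \<comment> \<open>An affine function of \<open>s\<close> that is bounded below has slope zero; at this \<open>s\<close> it would be \<open>-1\<close>.\<close>
    from this[of "- (\<beta> + 1) / (2 * m)"] m(3) show False by (simp add: field_simps)
  qed
  define w where "w = (1 / complex_of_real \<alpha>) \<cdot>\<^sub>m v"
  have w: "w \<in> carrier_mat n 1" "dim_row w = n" "dim_col w = 1" using c by (auto simp: w_def d)
  have vw: "v = complex_of_real \<alpha> \<cdot>\<^sub>m w"
    using v0 by (cases "\<alpha> = 0") (auto simp: w_def intro!: eq_matI)
  define K' where "K' = K - complex_of_real \<alpha> \<cdot>\<^sub>m (w * mat_adjoint w)"
  have K': "K' \<in> carrier_mat n n" "mat_adjoint K' = K'"
    by (rule carrier_matI) (simp_all add: K'_def d w(2,3) Kh)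
  have "pos_semidef K'"
    unfolding pos_semidef_def
  proof (intro conjI ballI)
    show "square_mat K'" using K'(1) by simp
    fix x :: "complex mat" assume "x \<in> carrier_mat (dim_row K') 1"
    then have x: "x \<in> carrier_mat n 1" "dim_row x = n" "dim_col x = 1" using K'(1) by auto
    define \<omega> where "\<omega> = scalar_of (mat_adjoint w * x)"
    have "scalar_of (mat_adjoint (mat_adjoint w * x)) = cnj \<omega>"
      unfolding \<omega>_def by (subst scalar_of_simps) (simp_all add: w x)
    then have o: "scalar_of (mat_adjoint x * w) = cnj \<omega>" by (simp add: w x)
    have "0 \<le> cnj (- \<omega>) * complex_of_real \<alpha> * (- \<omega>) + cnj (- \<omega>) * (complex_of_real \<alpha> * \<omega>)
      + complex_of_real \<alpha> * cnj \<omega> * (- \<omega>) + scalar_of (mat_adjoint x * K * x)"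
      using quad[OF x(1), of "- \<omega>"] unfolding \<alpha>(2) vw
      by (simp add: mat_ring w x \<omega>_def[symmetric] o)
    also have "\<dots> = scalar_of (mat_adjoint x * K * x) - complex_of_real \<alpha> * (cnj \<omega> * \<omega>)"
      by (simp add: algebra_simps)
    also have "cnj \<omega> * \<omega> = scalar_of ((mat_adjoint x * w) * (mat_adjoint w * x))"
      by (subst scalar_of_mult) (simp_all add: w x o \<omega>_def)
    also have "scalar_of (mat_adjoint x * K * x) - complex_of_real \<alpha> * \<dots> = scalar_of (mat_adjoint x * K' * x)"
      unfolding K'_def by (simp add: mat_ring w x d)
    finally show "0 \<le> scalar_of (mat_adjoint x * K' * x)" .
  qed
  from Suc.IH[OF K' this] obtain S T e where
    ST: "S \<in> carrier_mat n n" "T \<in> carrier_mat n n" "T * S = 1\<^sub>m n" "\<forall>i. 0 \<le> e i"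
    and K'': "K' = S * real_diag n e * mat_adjoint S" by blast
  have dS: "dim_row S = n" "dim_col S = n" "dim_row T = n" "dim_col T = n" using ST by auto
  define S2 where "S2 = four_block_mat (1\<^sub>m 1) (0\<^sub>m 1 n) w S"
  define T2 where "T2 = four_block_mat (1\<^sub>m 1) (0\<^sub>m 1 n) (- (T * w)) T"
  define e2 where "e2 i = (case i of 0 \<Rightarrow> \<alpha> | Suc i \<Rightarrow> e i)" for i
  have D2: "real_diag (Suc n) e2 = four_block_mat (complex_of_real \<alpha> \<cdot>\<^sub>m 1\<^sub>m 1) (0\<^sub>m 1 n) (0\<^sub>m n 1) (real_diag n e)"
    by (rule eq_matI) (auto simp: real_diag_def e2_def split: nat.splits)
  have Tw: "T * w \<in> carrier_mat n 1" "- (T * w) \<in> carrier_mat n 1" using ST w by auto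
  have "T2 * S2 = four_block_mat (1\<^sub>m 1 * 1\<^sub>m 1 + 0\<^sub>m 1 n * w) (1\<^sub>m 1 * 0\<^sub>m 1 n + 0\<^sub>m 1 n * S)
      (- (T * w) * 1\<^sub>m 1 + T * w) (- (T * w) * 0\<^sub>m 1 n + T * S)"
    unfolding T2_def S2_def
    by (rule mult_four_block_mat[OF one_carrier_mat zero_carrier_mat Tw(2) ST(2)
      one_carrier_mat zero_carrier_mat w(1) ST(1)])
  also have "\<dots> = four_block_mat (1\<^sub>m 1) (0\<^sub>m 1 n) (0\<^sub>m n 1) (1\<^sub>m n)"
    using Tw ST(3) w dS by (intro cong_four_block_mat) (auto simp: mat_ring)
  also have "\<dots> = 1\<^sub>m (Suc n)" by (rule eq_matI) auto
  finally have TS: "T2 * S2 = 1\<^sub>m (Suc n)" .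
  have Sadj: "mat_adjoint S2 = four_block_mat (1\<^sub>m 1) (mat_adjoint w) (0\<^sub>m n 1) (mat_adjoint S)"
    unfolding S2_def by (subst adjoint_four_block[OF one_carrier_mat zero_carrier_mat w(1) ST(1)]) simp
  have "S2 * real_diag (Suc n) e2 = four_block_mat
      (1\<^sub>m 1 * (complex_of_real \<alpha> \<cdot>\<^sub>m 1\<^sub>m 1) + 0\<^sub>m 1 n * 0\<^sub>m n 1) (1\<^sub>m 1 * 0\<^sub>m 1 n + 0\<^sub>m 1 n * real_diag n e)
      (w * (complex_of_real \<alpha> \<cdot>\<^sub>m 1\<^sub>m 1) + S * 0\<^sub>m n 1) (w * 0\<^sub>m 1 n + S * real_diag n e)"
    unfolding D2 S2_def
    by (rule mult_four_block_mat[OF one_carrier_mat zero_carrier_mat w(1) ST(1) _ zero_carrier_mat zero_carrier_mat])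
      simp_all
  also have "\<dots> = four_block_mat (complex_of_real \<alpha> \<cdot>\<^sub>m 1\<^sub>m 1) (0\<^sub>m 1 n) v (S * real_diag n e)"
    by (intro cong_four_block_mat) (auto simp: mat_ring w dS vw)
  finally have "S2 * real_diag (Suc n) e2 * mat_adjoint S2 = four_block_mat
      (complex_of_real \<alpha> \<cdot>\<^sub>m 1\<^sub>m 1) (0\<^sub>m 1 n) v (S * real_diag n e)
      * four_block_mat (1\<^sub>m 1) (mat_adjoint w) (0\<^sub>m n 1) (mat_adjoint S)"
    unfolding Sadj by simp
  also have "\<dots> = four_block_mat
      ((complex_of_real \<alpha> \<cdot>\<^sub>m 1\<^sub>m 1) * 1\<^sub>m 1 + 0\<^sub>m 1 n * 0\<^sub>m n 1)
      ((complex_of_real \<alpha> \<cdot>\<^sub>m 1\<^sub>m 1) * mat_adjoint w + 0\<^sub>m 1 n * mat_adjoint S)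
      (v * 1\<^sub>m 1 + (S * real_diag n e) * 0\<^sub>m n 1)
      (v * mat_adjoint w + S * real_diag n e * mat_adjoint S)"
    by (rule mult_four_block_mat[where ?nr1.0 = 1 and ?n1.0 = 1 and ?n2.0 = n and ?nr2.0 = n and ?nc1.0 = 1 and ?nc2.0 = n])
      (use c w ST in auto)
  also have "\<dots> = four_block_mat a (mat_adjoint v) v K"
  proof (rule cong_four_block_mat)
    show "(complex_of_real \<alpha> \<cdot>\<^sub>m 1\<^sub>m 1) * 1\<^sub>m 1 + 0\<^sub>m 1 n * 0\<^sub>m n 1 = a"
      using \<alpha>(2) by (intro eq_matI) (auto simp: d mat_ring scalar_of_def)
    show "(complex_of_real \<alpha> \<cdot>\<^sub>m 1\<^sub>m 1) * mat_adjoint w + 0\<^sub>m 1 n * mat_adjoint S = mat_adjoint v"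
      by (simp add: vw mat_ring w dS)
    show "v * 1\<^sub>m 1 + S * real_diag n e * 0\<^sub>m n 1 = v"
      using c by (simp add: mat_ring d dS)
    have "v * mat_adjoint w + K' = K"
      unfolding K'_def vw by (rule eq_matI) (auto simp: w d mat_ring simp del: index_mult_mat(1))
    then show "v * mat_adjoint w + S * real_diag n e * mat_adjoint S = K" unfolding K'' .
  qed
  finally have "H = S2 * real_diag (Suc n) e2 * mat_adjoint S2" unfolding H by simp
  moreover have "S2 \<in> carrier_mat (Suc n) (Suc n)" "T2 \<in> carrier_mat (Suc n) (Suc n)"
    by (auto simp: S2_def T2_def dS intro!: carrier_matI)
  moreover have "\<forall>i. 0 \<le> e2 i" using ST(4) \<alpha>(1) by (auto simp: e2_def split: nat.splits)
  ultimately show ?case using TS by blast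
qed

text \<open>The Gram factor \<open>h\<close> and a reflexive generalised inverse \<open>\<Gamma>\<close>, both read off from the \<open>LDL\<^sup>*\<close>
  decomposition. Zero pivots need no case distinction, since \<open>inverse 0 = 0\<close>.\<close>

lemma pos_semidef_factor:
  assumes "H \<in> carrier_mat n n" "mat_adjoint H = H" "pos_semidef H"
  obtains h \<Gamma> where "h \<in> carrier_mat n n" "\<Gamma> \<in> carrier_mat n n" "H = h * mat_adjoint h"
    "mat_adjoint \<Gamma> = \<Gamma>" "H * \<Gamma> * H = H" "\<Gamma> * H * \<Gamma> = \<Gamma>"
proof -
  obtain S T d where ST: "S \<in> carrier_mat n n" "T \<in> carrier_mat n n" "T * S = 1\<^sub>m n" "\<forall>i. 0 \<le> d i"
    and H: "H = S * real_diag n d * mat_adjoint S"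
    using ldl_decomposition[OF assms] by blast
  have dS: "dim_row S = n" "dim_col S = n" "dim_row T = n" "dim_col T = n" using ST by auto
  have TS: "T * (S * X) = X" if "dim_row X = n" for X
  proof -
    have "T * (S * X) = (T * S) * X" by (simp add: mat_mult_assoc dS that)
    then show ?thesis by (simp add: ST(3) mat_ring that)
  qed
  have "mat_adjoint (T * S) = 1\<^sub>m n" by (simp only: ST(3) adjoint_one)
  then have ST': "mat_adjoint S * mat_adjoint T = 1\<^sub>m n" by (simp add: dS)
  have TSa: "mat_adjoint S * (mat_adjoint T * X) = X" if "dim_row X = n" for X
  proof -
    have "mat_adjoint S * (mat_adjoint T * X) = (mat_adjoint S * mat_adjoint T) * X"
      by (simp add: mat_mult_assoc dS that)
    then show ?thesis by (simp add: ST' mat_ring that)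
  qed
  have dd: "real_diag n f * (real_diag n g * X) = real_diag n (\<lambda>i. f i * g i) * X" if "dim_row X = n" for f g X
    by (simp add: mat_mult_assoc[symmetric] real_diag_mult that)
  define h where "h = S * real_diag n (\<lambda>i. sqrt (d i))"
  define \<Gamma> where "\<Gamma> = mat_adjoint T * (real_diag n (\<lambda>i. inverse (d i)) * T)"
  have eq: "(\<lambda>i. \<bar>d i\<bar>) = d" "(\<lambda>i. sqrt (d i) * sqrt (d i)) = d" "(\<lambda>i. d i * inverse (d i) * d i) = d"
    "(\<lambda>i. inverse (d i) * d i * inverse (d i)) = (\<lambda>i. inverse (d i))"
    using ST(4) by (auto simp: fun_eq_iff field_simps)
  show ?thesis
  proof
    show "h \<in> carrier_mat n n" "\<Gamma> \<in> carrier_mat n n" "mat_adjoint \<Gamma> = \<Gamma>"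
      by (auto simp: h_def \<Gamma>_def dS mat_ring intro!: carrier_matI)
    show "H = h * mat_adjoint h"
      by (simp add: H h_def mat_ring dS dd eq)
    show "H * \<Gamma> * H = H" "\<Gamma> * H * \<Gamma> = \<Gamma>"
      by (simp_all add: H \<Gamma>_def mat_ring dS dd TS TSa eq)
  qed
qed

lemma gram_eq_0_imp:
  fixes X :: "complex mat"
  assumes "X * mat_adjoint X = 0\<^sub>m (dim_row X) (dim_row X)"
  shows "X = 0\<^sub>m (dim_row X) (dim_col X)"
proof (rule eq_matI)
  fix i j assume "i < dim_row (0\<^sub>m (dim_row X) (dim_col X) :: complex mat)" "j < dim_col (0\<^sub>m (dim_row X) (dim_col X) :: complex mat)"
  then have ij: "i < dim_row X" "j < dim_col X" by auto
  have "(X * mat_adjoint X) $$ (i, i) = 0" unfolding assms using ij by simp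
  then have "complex_of_real (\<Sum>k<dim_col X. (cmod (X $$ (i, k)))\<^sup>2) = 0"
    using ij by (subst (asm) mult_index) (auto simp: complex_norm_square simp del: of_real_power)
  then have "(\<Sum>k<dim_col X. (cmod (X $$ (i, k)))\<^sup>2) = 0" by (simp only: of_real_eq_0_iff)
  then have "X $$ (i, j) = 0" using ij by (subst (asm) sum_nonneg_eq_0_iff) auto
  then show "X $$ (i, j) = 0\<^sub>m (dim_row X) (dim_col X) $$ (i, j)" using ij by simp
qed auto

lemma gram_pos_semidef: "pos_semidef (M * mat_adjoint M)"
  unfolding pos_semidef_def
proof (intro conjI ballI)
  show "square_mat (M * mat_adjoint M)" by simp
  fix x :: "complex mat" assume "x \<in> carrier_mat (dim_row (M * mat_adjoint M)) 1"
  then have x: "dim_row x = dim_row M" "dim_col x = 1" by auto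
  have "mat_adjoint x * (M * mat_adjoint M) * x = (mat_adjoint x * M) * mat_adjoint (mat_adjoint x * M)"
    using x by (simp add: mat_ring)
  moreover have "0 \<le> scalar_of ((mat_adjoint x * M) * mat_adjoint (mat_adjoint x * M))"
    by (rule scalar_gram_nonneg) (simp add: x)
  ultimately show "0 \<le> scalar_of (mat_adjoint x * (M * mat_adjoint M) * x)" by simp
qed

text \<open>If \<open>M\<close> and \<open>L\<close> have the same Gram matrix \<open>H\<close>, then \<open>L = M V\<close> for a partial isometry \<open>V\<close>, namely
  \<open>V = M\<^sup>* \<Gamma> L\<close> with a generalised inverse \<open>\<Gamma>\<close> of \<open>H\<close>; the defect \<open>1 - V V\<^sup>*\<close> is a projection, hence
  of the form \<open>E E\<^sup>*\<close>.\<close>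

lemma equal_gram_imp_contraction:
  fixes M L :: "complex mat"
  assumes M: "M \<in> carrier_mat n m" and L: "L \<in> carrier_mat n l"
    and gram: "M * mat_adjoint M = L * mat_adjoint L"
  obtains V E where "V \<in> carrier_mat m l" "E \<in> carrier_mat m m" "M * V = L"
    "1\<^sub>m m - V * mat_adjoint V = E * mat_adjoint E"
proof -
  have d: "dim_row M = n" "dim_col M = m" "dim_row L = n" "dim_col L = l" using M L by auto
  define H where "H = M * mat_adjoint M"
  have H: "H \<in> carrier_mat n n" "mat_adjoint H = H" "pos_semidef H"
    unfolding H_def using gram_pos_semidef[of M] by (auto simp: d intro!: carrier_matI)
  obtain \<Gamma> where G: "\<Gamma> \<in> carrier_mat n n" "mat_adjoint \<Gamma> = \<Gamma>" "H * \<Gamma> * H = H" "\<Gamma> * H * \<Gamma> = \<Gamma>"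
    using pos_semidef_factor[OF H] by metis
  have dG: "dim_row \<Gamma> = n" "dim_col \<Gamma> = n" "dim_row H = n" "dim_col H = n" using G(1) H(1) by auto
  define V where "V = mat_adjoint M * (\<Gamma> * L)"
  define E where "E = 1\<^sub>m m - mat_adjoint M * (\<Gamma> * M)"
  define X where "X = (H * \<Gamma> - 1\<^sub>m n) * L"
  have LH: "L * mat_adjoint L = H" by (simp add: H_def gram)
  have "X * mat_adjoint X = ((H * \<Gamma> - 1\<^sub>m n) * (L * mat_adjoint L)) * (\<Gamma> * H - 1\<^sub>m n)"
    by (simp add: X_def mat_ring d dG G(2) H(2))
  also have "\<dots> = ((H * \<Gamma> - 1\<^sub>m n) * H) * (\<Gamma> * H - 1\<^sub>m n)" unfolding LH ..
  also have "(H * \<Gamma> - 1\<^sub>m n) * H = H * \<Gamma> * H - H" by (simp add: mat_ring dG)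
  also have "\<dots> = 0\<^sub>m n n" unfolding G(3) using H(1) by simp
  finally have "X * mat_adjoint X = 0\<^sub>m n n" by (simp add: mat_ring dG)
  moreover have dX: "dim_row X = n" "dim_col X = l" by (auto simp: X_def d dG)
  ultimately have "X = 0\<^sub>m n l" using gram_eq_0_imp[of X] by simp
  then have "(H * (\<Gamma> * L) - L) $$ (i, j) = 0" if "i < n" "j < l" for i j
    using that by (simp add: X_def mat_ring d dG del: index_minus_mat index_mult_mat(1))
  then have HGL: "H * (\<Gamma> * L) = L"
    by (intro eq_matI) (auto simp: d dG simp del: index_mult_mat(1))
  have "M * V = H * (\<Gamma> * L)" by (simp add: V_def H_def mat_ring d dG)
  then have MV: "M * V = L" unfolding HGL .
  have "\<Gamma> * (L * (mat_adjoint L * (\<Gamma> * M))) = \<Gamma> * (L * mat_adjoint L) * \<Gamma> * M"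
    by (simp add: mat_ring d dG)
  also have "\<dots> = \<Gamma> * M" unfolding gram[symmetric] H_def[symmetric] G(4) ..
  finally have VV: "V * mat_adjoint V = mat_adjoint M * (\<Gamma> * M)"
    by (simp add: V_def mat_ring d dG G(2))
  have "\<Gamma> * (M * (mat_adjoint M * (\<Gamma> * M))) = \<Gamma> * (M * mat_adjoint M) * \<Gamma> * M"
    by (simp add: mat_ring d dG)
  also have "\<dots> = \<Gamma> * M" unfolding H_def[symmetric] G(4) ..
  finally have "E * mat_adjoint E = 1\<^sub>m m - V * mat_adjoint V"
    unfolding VV by (intro eq_matI) (auto simp: E_def mat_ring d dG G(2) simp del: index_mult_mat(1))
  moreover have "V \<in> carrier_mat m l" "E \<in> carrier_mat m m"
    by (auto simp: V_def E_def d dG intro!: carrier_matI)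
  ultimately show ?thesis using that MV by simp
qed

section \<open>The Drury--Arveson kernel\<close>

lemma row_inner_sum:
  assumes "l \<in> carrier_mat 1 N" "m \<in> carrier_mat 1 N"
  shows "row_inner l m = (\<Sum>k<N. l $$ (0, k) * cnj (m $$ (0, k)))"
  unfolding row_inner_def scalar_of_def using assms by (subst mult_index) auto

lemma row_inner_cnj:
  assumes "l \<in> carrier_mat 1 N" "m \<in> carrier_mat 1 N"
  shows "cnj (row_inner l m) = row_inner m l"
  unfolding row_inner_sum[OF assms] row_inner_sum[OF assms(2,1)] by (simp add: mult.commute)

lemma unit_ballD:
  assumes "l \<in> unit_ball N"
  shows "l \<in> carrier_mat 1 N" "dim_row l = 1" "dim_col l = N"
  using assms by (auto simp: unit_ball_def)

lemma unit_ball_norm: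
  assumes "l \<in> unit_ball N"
  shows "L2_set (\<lambda>k. cmod (l $$ (0, k))) {..<N} < 1"
proof -
  have l: "l \<in> carrier_mat 1 N" "row_inner l l < 1" using assms by (auto simp: unit_ball_def)
  have "row_inner l l = complex_of_real (\<Sum>k<N. (cmod (l $$ (0, k)))\<^sup>2)"
    unfolding row_inner_def using l by (subst scalar_gram) auto
  then have "(\<Sum>k<N. (cmod (l $$ (0, k)))\<^sup>2) < 1" using l(2) by (simp add: less_complex_def)
  then show ?thesis by (simp add: L2_set_def)
qed

lemma cmod_row_inner_less_1:
  assumes "l \<in> unit_ball N" "m \<in> unit_ball N"
  shows "cmod (row_inner l m) < 1"
proof -
  let ?a = "\<lambda>k. cmod (l $$ (0, k))" and ?b = "\<lambda>k. cmod (m $$ (0, k))"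
  have "cmod (row_inner l m) \<le> (\<Sum>k<N. \<bar>?a k\<bar> * \<bar>?b k\<bar>)"
    unfolding row_inner_sum[OF unit_ballD(1)[OF assms(1)] unit_ballD(1)[OF assms(2)]]
    by (rule order_trans[OF norm_sum]) (simp add: norm_mult)
  also have "\<dots> \<le> L2_set ?a {..<N} * L2_set ?b {..<N}" by (rule L2_set_mult_ineq)
  also have "\<dots> < 1 * 1"
    using unit_ball_norm[OF assms(1)] unit_ball_norm[OF assms(2)]
    by (intro mult_strict_mono') (auto simp: L2_set_nonneg)
  finally show ?thesis by simp
qed

lemma one_minus_row_inner:
  assumes "l \<in> unit_ball N" "m \<in> unit_ball N"
  shows "1 - row_inner l m \<noteq> 0"
  using cmod_row_inner_less_1[OF assms] by auto

lemma row_inner_self: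
  assumes "l \<in> unit_ball N"
  obtains n where "row_inner l l = complex_of_real n" "n < 1"
proof
  show "row_inner l l = complex_of_real (Re (row_inner l l))"
    using scalar_gram_nonneg[of l] unit_ballD(2)[OF assms] by (auto simp: row_inner_def less_eq_complex_def complex_eq_iff)
  show "Re (row_inner l l) < 1" using assms by (auto simp: unit_ball_def less_complex_def)
qed

text \<open>The step multiplies by one more factor \<open>\<langle>\<lambda>\<^sub>i, \<lambda>\<^sub>j\<rangle> = (\<Sum>k. \<lambda>\<^sub>i\<^sub>k cnj \<lambda>\<^sub>j\<^sub>k)\<close>, whose parts are absorbed into \<open>z\<close>.\<close>

lemma row_inner_power_positive:
  assumes l: "\<And>i. i < n \<Longrightarrow> l i \<in> carrier_mat 1 N"
  shows "0 \<le> (\<Sum>i<n. \<Sum>j<n. row_inner (l i) (l j) ^ m * (z i * cnj (z j)))"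
proof (induction m arbitrary: z)
  case 0
  have "(\<Sum>i<n. \<Sum>j<n. z i * cnj (z j)) = (\<Sum>i<n. z i) * cnj (\<Sum>i<n. z i)"
    by (simp add: sum_product)
  also have "\<dots> = complex_of_real ((cmod (\<Sum>i<n. z i))\<^sup>2)" by (simp only: complex_norm_square)
  also have "0 \<le> \<dots>" by (simp add: less_eq_complex_def)
  finally show ?case by simp
next
  case (Suc m)
  have "row_inner (l i) (l j) ^ Suc m * (z i * cnj (z j)) =
      (\<Sum>k<N. row_inner (l i) (l j) ^ m * ((z i * l i $$ (0, k)) * cnj (z j * l j $$ (0, k))))"
    if "i < n" "j < n" for i j
  proof -
    have "row_inner (l i) (l j) ^ Suc m * (z i * cnj (z j)) =
        row_inner (l i) (l j) ^ m * (z i * cnj (z j)) * row_inner (l i) (l j)" by simp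
    also have "\<dots> = row_inner (l i) (l j) ^ m * (z i * cnj (z j)) * (\<Sum>k<N. l i $$ (0, k) * cnj (l j $$ (0, k)))"
      by (subst (2) row_inner_sum[OF l[OF that(1)] l[OF that(2)]]) simp
    finally show ?thesis by (simp add: sum_distrib_left mult_ac)
  qed
  then have "(\<Sum>i<n. \<Sum>j<n. row_inner (l i) (l j) ^ Suc m * (z i * cnj (z j))) =
      (\<Sum>i<n. \<Sum>j<n. \<Sum>k<N. row_inner (l i) (l j) ^ m * ((z i * l i $$ (0, k)) * cnj (z j * l j $$ (0, k))))"
    by (intro sum.cong) auto
  also have "\<dots> = (\<Sum>i<n. \<Sum>k<N. \<Sum>j<n. row_inner (l i) (l j) ^ m * ((z i * l i $$ (0, k)) * cnj (z j * l j $$ (0, k))))"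
    by (intro sum.cong refl sum.swap)
  also have "\<dots> = (\<Sum>k<N. \<Sum>i<n. \<Sum>j<n. row_inner (l i) (l j) ^ m * ((z i * l i $$ (0, k)) * cnj (z j * l j $$ (0, k))))"
    by (rule sum.swap)
  also have "0 \<le> \<dots>" by (intro sum_nonneg Suc.IH)
  finally show ?case .
qed

lemma row_inner_power_gram_positive:
  assumes l: "\<And>i. i < n \<Longrightarrow> l i \<in> carrier_mat 1 N"
    and Y: "\<And>i. i < n \<Longrightarrow> Y i \<in> carrier_mat 1 k"
  shows "0 \<le> (\<Sum>i<n. \<Sum>j<n. row_inner (l i) (l j) ^ m * scalar_of (Y i * mat_adjoint (Y j)))"
proof -
  have "scalar_of (Y i * mat_adjoint (Y j)) = (\<Sum>c<k. Y i $$ (0, c) * cnj (Y j $$ (0, c)))"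
    if "i < n" "j < n" for i j
    using row_inner_sum[OF Y[OF that(1)] Y[OF that(2)]] by (simp add: row_inner_def)
  then have "(\<Sum>i<n. \<Sum>j<n. row_inner (l i) (l j) ^ m * scalar_of (Y i * mat_adjoint (Y j))) =
      (\<Sum>i<n. \<Sum>j<n. \<Sum>c<k. row_inner (l i) (l j) ^ m * (Y i $$ (0, c) * cnj (Y j $$ (0, c))))"
    by (intro sum.cong refl) (simp add: sum_distrib_left)
  also have "\<dots> = (\<Sum>i<n. \<Sum>c<k. \<Sum>j<n. row_inner (l i) (l j) ^ m * (Y i $$ (0, c) * cnj (Y j $$ (0, c))))"
    by (intro sum.cong refl sum.swap)
  also have "\<dots> = (\<Sum>c<k. \<Sum>i<n. \<Sum>j<n. row_inner (l i) (l j) ^ m * (Y i $$ (0, c) * cnj (Y j $$ (0, c))))"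
    by (rule sum.swap)
  also have "0 \<le> \<dots>" by (intro sum_nonneg row_inner_power_positive[OF l])
  finally show ?thesis .
qed

lemma sums_nonneg_complex:
  fixes f :: "nat \<Rightarrow> complex"
  assumes "f sums s" "\<And>m. 0 \<le> f m"
  shows "0 \<le> s"
proof -
  have "(\<lambda>m. Re (f m)) sums Re s" "(\<lambda>m. Im (f m)) sums Im s"
    using assms(1) by (auto simp: sums_complex_iff)
  moreover have "0 \<le> Re (f m)" "Im (f m) = 0" for m using assms(2)[of m] by (auto simp: less_eq_complex_def)
  ultimately have "0 \<le> Re s" "Im s = 0"
    using sums_le[OF _ sums_zero, of "\<lambda>m. Re (f m)"] sums_unique2[OF _ sums_zero] by auto
  then show ?thesis by (simp add: less_eq_complex_def)
qed

text \<open>The kernel \<open>1 / (1 - \<langle>\<lambda>, \<mu>\<rangle>)\<close> times a Gram kernel is positive, being the sum over \<open>m\<close>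
  of the positive kernels \<open>\<langle>\<lambda>, \<mu>\<rangle>\<^sup>m\<close> times the Gram kernel.\<close>

lemma drury_arveson_gram_positive:
  assumes l: "\<And>i. i < n \<Longrightarrow> l i \<in> unit_ball N"
    and Y: "\<And>i. i < n \<Longrightarrow> Y i \<in> carrier_mat 1 k"
  shows "0 \<le> (\<Sum>i<n. \<Sum>j<n. 1 / (1 - row_inner (l i) (l j)) * scalar_of (Y i * mat_adjoint (Y j)))"
proof (rule sums_nonneg_complex)
  show "(\<lambda>m. \<Sum>i<n. \<Sum>j<n. row_inner (l i) (l j) ^ m * scalar_of (Y i * mat_adjoint (Y j))) sums
    (\<Sum>i<n. \<Sum>j<n. 1 / (1 - row_inner (l i) (l j)) * scalar_of (Y i * mat_adjoint (Y j)))"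
    by (intro sums_sum sums_mult2 geometric_sums cmod_row_inner_less_1[of _ N] l) auto
  show "0 \<le> (\<Sum>i<n. \<Sum>j<n. row_inner (l i) (l j) ^ m * scalar_of (Y i * mat_adjoint (Y j)))" for m
    by (rule row_inner_power_gram_positive[OF unit_ballD(1)[OF l] Y])
qed

section \<open>Block rows\<close>

lemma append_cols_dim [simp]:
  "dim_row (append_cols A B) = dim_row A" "dim_col (append_cols A B) = dim_col A + dim_col B"
  by (auto simp: append_cols_def)

lemma append_cols_index:
  assumes "i < dim_row A" "j < dim_col A + dim_col B" "dim_row A = dim_row B"
  shows "append_cols A B $$ (i, j) = (if j < dim_col A then A $$ (i, j) else B $$ (i, j - dim_col A))"
  using assms by (simp add: append_cols_def)

lemma mult_append_cols:
  fixes A B C :: "complex mat"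
  assumes "dim_col C = dim_row A" "dim_row A = dim_row B"
  shows "C * append_cols A B = append_cols (C * A) (C * B)"
proof (rule eq_matI)
  fix i j assume "i < dim_row (append_cols (C * A) (C * B))" "j < dim_col (append_cols (C * A) (C * B))"
  then have ij: "i < dim_row C" "j < dim_col A + dim_col B" by auto
  show "(C * append_cols A B) $$ (i, j) = append_cols (C * A) (C * B) $$ (i, j)"
    using ij assms
    by (subst mult_index) (auto simp: append_cols_index mult_index simp del: index_mult_mat(1))
qed (use assms in auto)

lemma append_cols_mult_rows:
  fixes A B C D :: "complex mat"
  assumes "A \<in> carrier_mat r a" "B \<in> carrier_mat r b" "C \<in> carrier_mat a t" "D \<in> carrier_mat b t"
  shows "append_cols A B * (C @\<^sub>r D) = A * C + B * D"
proof -
  have d: "dim_col A = a" "dim_col B = b" "dim_row C = a" "dim_row D = b" using assms by auto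
  have "append_cols A B * (C @\<^sub>r D) = four_block_mat (A * C + B * D) (A * 0\<^sub>m a 0 + B * 0\<^sub>m b 0)
      (0\<^sub>m 0 a * C + 0\<^sub>m 0 b * D) (0\<^sub>m 0 a * 0\<^sub>m a 0 + 0\<^sub>m 0 b * 0\<^sub>m b 0)"
    unfolding append_cols_def append_rows_def d
    by (rule mult_four_block_mat[OF assms(1,2) zero_carrier_mat zero_carrier_mat assms(3)
      zero_carrier_mat assms(4) zero_carrier_mat])
  also have "\<dots> = A * C + B * D"
    by (rule eq_matI) (use assms in auto)
  finally show ?thesis .
qed

lemma append_cols_mult_block:
  fixes A B C D E F :: "complex mat"
  assumes "A \<in> carrier_mat r a" "B \<in> carrier_mat r b" "C \<in> carrier_mat a t" "D \<in> carrier_mat b t"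
    "E \<in> carrier_mat a u" "F \<in> carrier_mat b u"
  shows "append_cols A B * four_block_mat C E D F = append_cols (A * C + B * D) (A * E + B * F)"
proof -
  have d: "dim_col A = a" "dim_col B = b" using assms by auto
  have "append_cols A B * four_block_mat C E D F = four_block_mat (A * C + B * D) (A * E + B * F)
      (0\<^sub>m 0 a * C + 0\<^sub>m 0 b * D) (0\<^sub>m 0 a * E + 0\<^sub>m 0 b * F)"
    unfolding append_cols_def d
    by (rule mult_four_block_mat[OF assms(1,2) zero_carrier_mat zero_carrier_mat assms(3,5,4,6)])
  also have "\<dots> = append_cols (A * C + B * D) (A * E + B * F)"
    unfolding append_cols_def by (rule cong_four_block_mat) (use assms in auto)
  finally show ?thesis .
qed

lemma append_cols_gram:
  fixes A B C D :: "complex mat"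
  assumes "A \<in> carrier_mat r a" "B \<in> carrier_mat r b" "C \<in> carrier_mat t a" "D \<in> carrier_mat t b"
  shows "append_cols A B * mat_adjoint (append_cols C D) = A * mat_adjoint C + B * mat_adjoint D"
proof -
  have d: "dim_col C = a" "dim_col D = b" using assms by auto
  have "mat_adjoint (append_cols C D) = mat_adjoint C @\<^sub>r mat_adjoint D"
    unfolding append_cols_def append_rows_def
    by (subst adjoint_four_block[OF assms(3,4), of _ 0]) (use d in simp_all)
  then show ?thesis
    using append_cols_mult_rows[OF assms(1,2), of "mat_adjoint C" t "mat_adjoint D"] assms(3,4) by simp
qed

lemma append_cols_inject:
  fixes A B C D :: "complex mat"
  assumes "A \<in> carrier_mat r a" "B \<in> carrier_mat r b" "C \<in> carrier_mat r a" "D \<in> carrier_mat r b"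
    and eq: "append_cols A B = append_cols C D"
  shows "A = C" "B = D"
proof -
  have d: "dim_row A = r" "dim_col A = a" "dim_row B = r" "dim_col B = b"
    "dim_row C = r" "dim_col C = a" "dim_row D = r" "dim_col D = b" using assms by auto
  have *: "append_cols A B $$ (i, j) = append_cols C D $$ (i, j)" for i j by (simp only: eq)
  show "A = C"
  proof (rule eq_matI)
    fix i j assume "i < dim_row C" "j < dim_col C"
    with *[of i j] show "A $$ (i, j) = C $$ (i, j)" by (simp add: append_cols_index d)
  qed (simp_all add: d)
  show "B = D"
  proof (rule eq_matI)
    fix i j assume "i < dim_row D" "j < dim_col D"
    with *[of i "a + j"] show "B $$ (i, j) = D $$ (i, j)" by (simp add: append_cols_index d)
  qed (simp_all add: d)
qed

text \<open>The \<open>i\<close>-th standard basis row vector, which selects the \<open>i\<close>-th row of a matrix.\<close>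

definition unit_row :: "nat \<Rightarrow> nat \<Rightarrow> complex mat" where
  "unit_row n i = mat 1 n (\<lambda>(a, b). if b = i then 1 else 0)"

lemma unit_row_dim [simp]: "dim_row (unit_row n i) = 1" "dim_col (unit_row n i) = n"
  "unit_row n i \<in> carrier_mat 1 n"
  by (auto simp: unit_row_def)

lemma unit_row_mult:
  assumes "dim_row M = n" "i < n" "j < dim_col M"
  shows "(unit_row n i * M) $$ (0, j) = M $$ (i, j)"
proof -
  have "(unit_row n i * M) $$ (0, j) = (\<Sum>k<n. if k = i then M $$ (k, j) else 0)"
    using assms by (subst mult_index) (auto simp: unit_row_def simp del: sum.delta sum.delta' intro!: sum.cong)
  then show ?thesis using assms by simp
qed

lemma gram_index:
  assumes "dim_row M = n" "dim_row L = n" "dim_col M = dim_col L" "i < n" "j < n"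
  shows "(M * mat_adjoint L) $$ (i, j) = scalar_of ((unit_row n i * M) * mat_adjoint (unit_row n j * L))"
proof -
  let ?A = "unit_row n i * M" and ?B = "unit_row n j * L"
  have "(M * mat_adjoint L) $$ (i, j) = (\<Sum>k<dim_col L. M $$ (i, k) * cnj (L $$ (j, k)))"
    using assms by (subst mult_index) auto
  also have "\<dots> = (\<Sum>k<dim_col L. ?A $$ (0, k) * mat_adjoint ?B $$ (k, 0))"
    using assms by (intro sum.cong refl) (simp add: unit_row_mult del: index_mult_mat(1) adjoint_mult)
  also have "\<dots> = scalar_of (?A * mat_adjoint ?B)"
    unfolding scalar_of_def using assms by (subst mult_index[where B = "mat_adjoint ?B"]) (simp_all del: index_mult_mat(1) adjoint_mult)
  finally show ?thesis .
qed

lemma unit_row_eqI: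
  assumes "A \<in> carrier_mat n m" "B \<in> carrier_mat n m"
    and "\<And>i. i < n \<Longrightarrow> unit_row n i * A = unit_row n i * B"
  shows "A = B"
proof (rule eq_matI)
  fix i j assume "i < dim_row B" "j < dim_col B"
  then have ij: "i < n" "j < m" using assms by auto
  show "A $$ (i, j) = B $$ (i, j)"
    using unit_row_mult[of A n i j] unit_row_mult[of B n i j] ij assms by simp
qed (use assms in auto)

section \<open>Tangential interpolation at finitely many points\<close>

text \<open>The row operator \<open>Z(\<lambda>) = (\<lambda>\<^sub>0 I\<^sub>n, \<dots>, \<lambda>\<^sub>N\<^sub>-\<^sub>1 I\<^sub>n)\<close>; column \<open>k n + j\<close> is column \<open>j\<close> of its
  \<open>k\<close>-th block.\<close>

definition row_op :: "nat \<Rightarrow> nat \<Rightarrow> complex mat \<Rightarrow> complex mat" where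
  "row_op N n l = mat n (N * n) (\<lambda>(i, c). if c mod n = i then l $$ (0, c div n) else 0)"

lemma row_op_dim [simp]: "dim_row (row_op N n l) = n" "dim_col (row_op N n l) = N * n"
  "row_op N n l \<in> carrier_mat n (N * n)"
  by (auto simp: row_op_def)

lemma sum_div_mod:
  fixes f :: "nat \<Rightarrow> nat \<Rightarrow> 'a :: comm_monoid_add"
  shows "(\<Sum>c<N * n. f (c div n) (c mod n)) = (\<Sum>k<N. \<Sum>r<n. f k r)"
proof -
  have b: "k * n + r < N * n" if "k < N" "r < n" for k r
  proof -
    have "k * n + r < Suc k * n" using that by simp
    also have "\<dots> \<le> N * n" using that by (intro mult_le_mono1) simp
    finally show ?thesis .
  qed
  have "(\<Sum>c<N * n. f (c div n) (c mod n)) = (\<Sum>(k, r)\<in>{..<N} \<times> {..<n}. f k r)"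
    by (rule sum.reindex_bij_witness[of _ "\<lambda>(k, r). k * n + r" "\<lambda>c. (c div n, c mod n)"])
      (auto simp: b less_mult_imp_div_less intro!: mod_less_divisor gr0I)
  then show ?thesis by (simp add: sum.cartesian_product)
qed

lemma row_op_gram:
  assumes "l \<in> carrier_mat 1 N" "m \<in> carrier_mat 1 N"
  shows "row_op N n l * mat_adjoint (row_op N n m) = row_inner l m \<cdot>\<^sub>m 1\<^sub>m n"
proof (rule eq_matI)
  fix i j assume "i < dim_row (row_inner l m \<cdot>\<^sub>m 1\<^sub>m n)" "j < dim_col (row_inner l m \<cdot>\<^sub>m 1\<^sub>m n)"
  then have ij: "i < n" "j < n" by auto
  have "(row_op N n l * mat_adjoint (row_op N n m)) $$ (i, j) =
      (\<Sum>c<N * n. (if c mod n = i then l $$ (0, c div n) else 0) * cnj (if c mod n = j then m $$ (0, c div n) else 0))"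
    using ij by (subst mult_index) (auto simp: row_op_def intro!: sum.cong)
  also have "\<dots> = (\<Sum>k<N. \<Sum>r<n. (if r = i then l $$ (0, k) else 0) * cnj (if r = j then m $$ (0, k) else 0))"
    by (rule sum_div_mod)
  also have "\<dots> = (\<Sum>k<N. \<Sum>r<n. if r = i then (if i = j then l $$ (0, k) * cnj (m $$ (0, k)) else 0) else 0)"
    by (intro sum.cong) auto
  also have "\<dots> = (\<Sum>k<N. if i = j then l $$ (0, k) * cnj (m $$ (0, k)) else 0)" using ij by simp
  also have "\<dots> = (row_inner l m \<cdot>\<^sub>m 1\<^sub>m n) $$ (i, j)" using ij by (simp add: row_inner_sum[OF assms])
  finally show "(row_op N n l * mat_adjoint (row_op N n m)) $$ (i, j) = (row_inner l m \<cdot>\<^sub>m 1\<^sub>m n) $$ (i, j)" .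
qed auto

text \<open>A contractive colligation \<open>V = (a, b; c, e)\<close> has a transfer function
  \<open>\<sigma>(\<lambda>) = a + b (I - Z(\<lambda>) e)\<^sup>-\<^sup>1 Z(\<lambda>) c\<close> that is a Schur multiplier. With \<open>F = b (I - Z e)\<^sup>-\<^sup>1\<close> one has
  \<open>(I, F Z) V = (\<sigma>, F)\<close>, and the defect \<open>I - V V\<^sup>* = E E\<^sup>*\<close> gives
  \<open>I - \<sigma>(\<lambda>) \<sigma>(\<mu>)\<^sup>* = (1 - \<langle>\<lambda>, \<mu>\<rangle>) F(\<lambda>) F(\<mu>)\<^sup>* + P(\<lambda>) E E\<^sup>* P(\<mu>)\<^sup>*\<close> for \<open>P = (I, F Z)\<close>. The second property of
  \<open>F\<close> solves the state equation of the colligation.\<close>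

lemma transfer_function:
  assumes abce: "a \<in> carrier_mat m q" "b \<in> carrier_mat m n" "c \<in> carrier_mat (N * n) q" "e \<in> carrier_mat (N * n) n"
    and E: "E \<in> carrier_mat (m + N * n) (m + N * n)"
    and defect: "1\<^sub>m (m + N * n) - four_block_mat a b c e * mat_adjoint (four_block_mat a b c e) = E * mat_adjoint E"
  obtains F \<sigma> where "\<forall>l \<in> unit_ball N. F l \<in> carrier_mat m n"
    "\<forall>l \<in> unit_ball N. \<forall>\<chi> \<in> carrier_mat 1 n. \<forall>\<alpha> \<in> carrier_mat 1 m.
      \<alpha> * b + \<chi> * row_op N n l * e = \<chi> \<longrightarrow> \<chi> = \<alpha> * F l"
    "\<forall>l. \<sigma> l = a + F l * row_op N n l * c"
    "schur_multiplier N m q \<sigma>"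
proof -
  define V where "V = four_block_mat a b c e"
  have V: "V \<in> carrier_mat (m + N * n) (q + n)" unfolding V_def using abce by simp
  have d: "dim_row a = m" "dim_col a = q" "dim_row b = m" "dim_col b = n" "dim_row c = N * n" "dim_col c = q"
    "dim_row e = N * n" "dim_col e = n" "dim_row E = m + N * n" "dim_col E = m + N * n"
    "dim_row V = m + N * n" "dim_col V = q + n"
    using abce E V by auto
  have VV: "X * mat_adjoint Y - (X * V) * mat_adjoint (Y * V) = (X * E) * mat_adjoint (Y * E)"
    if "dim_col X = m + N * n" "dim_col Y = m + N * n" for X Y
  proof -
    have "(X * E) * mat_adjoint (Y * E) = X * (E * mat_adjoint E) * mat_adjoint Y"
      using that by (simp add: mat_ring d)
    also have "\<dots> = X * mat_adjoint Y - (X * V) * mat_adjoint (Y * V)"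
      unfolding defect[symmetric] V_def[symmetric] using that by (simp add: mat_ring d)
    finally show ?thesis ..
  qed
  have inv: "\<exists>R \<in> carrier_mat n n. (1\<^sub>m n - row_op N n l * e) * R = 1\<^sub>m n \<and> R * (1\<^sub>m n - row_op N n l * e) = 1\<^sub>m n"
    if l: "l \<in> unit_ball N" for l
  proof -
    let ?Z = "row_op N n l"
    let ?W = "1\<^sub>m n - ?Z * e"
    have W: "?W \<in> carrier_mat n n" by (rule carrier_matI) (simp_all add: d)
    have inj: "x = 0\<^sub>m n 1" if x: "x \<in> carrier_mat n 1" "mat_adjoint ?W * x = 0\<^sub>m n 1" for x
    proof -
      define y where "y = mat_adjoint x"
      have dy: "dim_row y = 1" "dim_col y = n" "dim_row x = n" "dim_col x = 1" using x by (auto simp: y_def)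
      have "mat_adjoint (mat_adjoint ?W * x) = 0\<^sub>m 1 n" unfolding x(2) by simp
      then have "y - y * ?Z * e = 0\<^sub>m 1 n" by (simp add: y_def d mat_ring dy)
      then have "(y - y * ?Z * e) $$ (i, j) = 0" if "i < 1" "j < n" for i j using that by simp
      then have yW: "y * ?Z * e = y"
        by (intro eq_matI) (auto simp: dy d simp del: index_mult_mat(1))
      \<comment> \<open>If \<open>y = y Z e\<close>, then contractivity of \<open>V\<close> at the row \<open>(0, y Z)\<close> gives \<open>y y\<^sup>* \<le> \<langle>l, l\<rangle> y y\<^sup>*\<close>, so \<open>y = 0\<close>.\<close>
      define w where "w = append_cols (0\<^sub>m 1 m) (y * ?Z)"
      have dw: "dim_row w = 1" "dim_col w = m + N * n" by (auto simp: w_def)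
      have "w * V = append_cols (0\<^sub>m 1 m * a + y * ?Z * c) (0\<^sub>m 1 m * b + y * ?Z * e)"
        unfolding w_def V_def
        by (rule append_cols_mult_block[where r = 1]) (use abce in \<open>auto intro!: carrier_matI simp: dy\<close>)
      then have wV: "w * V = append_cols (y * ?Z * c) y" unfolding yW by (simp add: mat_ring d dy)
      have "w * mat_adjoint w = 0\<^sub>m 1 m * mat_adjoint (0\<^sub>m 1 m) + (y * ?Z) * mat_adjoint (y * ?Z)"
        unfolding w_def by (rule append_cols_gram[where r = 1]) (auto intro!: carrier_matI simp: dy)
      also have "\<dots> = y * (?Z * mat_adjoint ?Z) * mat_adjoint y" by (simp add: mat_ring dy)
      also have "\<dots> = row_inner l l \<cdot>\<^sub>m (y * mat_adjoint y)"
        unfolding row_op_gram[OF unit_ballD(1)[OF l] unit_ballD(1)[OF l]] by (simp add: mat_ring dy)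
      finally have ww: "w * mat_adjoint w = row_inner l l \<cdot>\<^sub>m (y * mat_adjoint y)" .
      have wVV: "(w * V) * mat_adjoint (w * V) = (y * ?Z * c) * mat_adjoint (y * ?Z * c) + y * mat_adjoint y"
        unfolding wV by (rule append_cols_gram[where r = 1]) (auto intro!: carrier_matI simp: dy d)
      have "w * mat_adjoint w - (w * V) * mat_adjoint (w * V) = (w * E) * mat_adjoint (w * E)"
        by (rule VV) (simp_all add: dw)
      then have "scalar_of (w * mat_adjoint w - (w * V) * mat_adjoint (w * V)) = scalar_of ((w * E) * mat_adjoint (w * E))"
        by simp
      then have eq: "row_inner l l * scalar_of (y * mat_adjoint y) -
          (scalar_of ((y * ?Z * c) * mat_adjoint (y * ?Z * c)) + scalar_of (y * mat_adjoint y)) =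
          scalar_of ((w * E) * mat_adjoint (w * E))"
        unfolding ww wVV by (simp add: dy d dw)
      have nn: "0 \<le> scalar_of ((y * ?Z * c) * mat_adjoint (y * ?Z * c))"
        "0 \<le> scalar_of ((w * E) * mat_adjoint (w * E))" "0 \<le> scalar_of (y * mat_adjoint y)"
        by (rule scalar_gram_nonneg; simp add: dy dw)+
      define Y where "Y = Re (scalar_of (y * mat_adjoint y))"
      have Y: "scalar_of (y * mat_adjoint y) = complex_of_real Y" "0 \<le> Y"
        using nn(3) by (auto simp: Y_def less_eq_complex_def complex_eq_iff)
      have L: "Re (row_inner l l) < 1" using l by (auto simp: unit_ball_def less_complex_def)
      have "0 \<le> Re (row_inner l l) * Y - Y"
        using eq nn(1,2) unfolding Y(1) by (auto simp: less_eq_complex_def complex_eq_iff)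
      then have "(1 - Re (row_inner l l)) * Y \<le> 0" by (simp add: algebra_simps)
      then have "Y = 0" using Y(2) L by (simp add: mult_le_0_iff)
      then have "scalar_of (y * mat_adjoint y) = 0" using Y by simp
      then have "y = 0\<^sub>m 1 n" using scalar_gram_eq_0[of y] dy by simp
      then have "mat_adjoint y = 0\<^sub>m n 1" by (simp only: adjoint_zero)
      then show ?thesis by (simp add: y_def)
    qed
    have W': "mat_adjoint ?W \<in> carrier_mat n n" using W by (simp only: adjoint_carrier)
    from injective_imp_inverse[OF W' inj] obtain R where
      R: "R \<in> carrier_mat n n" "mat_adjoint ?W * R = 1\<^sub>m n" "R * mat_adjoint ?W = 1\<^sub>m n" by blast
    have dR: "dim_row R = n" "dim_col R = n" using R by auto
    have "mat_adjoint (mat_adjoint ?W * R) = 1\<^sub>m n" "mat_adjoint (R * mat_adjoint ?W) = 1\<^sub>m n"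
      by (simp_all only: R adjoint_one)
    moreover have "mat_adjoint (mat_adjoint ?W * R) = mat_adjoint R * ?W"
      by (subst adjoint_mult) (simp_all add: dR d del: adjoint_minus)
    moreover have "mat_adjoint (R * mat_adjoint ?W) = ?W * mat_adjoint R"
      by (subst adjoint_mult) (simp_all add: dR d del: adjoint_minus)
    ultimately show ?thesis using R(1) by (intro bexI[of _ "mat_adjoint R"]) auto
  qed
  define R where "R l = (SOME R. R \<in> carrier_mat n n \<and> (1\<^sub>m n - row_op N n l * e) * R = 1\<^sub>m n \<and>
    R * (1\<^sub>m n - row_op N n l * e) = 1\<^sub>m n)" for l
  have R: "R l \<in> carrier_mat n n" "(1\<^sub>m n - row_op N n l * e) * R l = 1\<^sub>m n"
    "R l * (1\<^sub>m n - row_op N n l * e) = 1\<^sub>m n" if "l \<in> unit_ball N" for l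
  proof -
    have "\<exists>R. R \<in> carrier_mat n n \<and> (1\<^sub>m n - row_op N n l * e) * R = 1\<^sub>m n \<and>
      R * (1\<^sub>m n - row_op N n l * e) = 1\<^sub>m n" using inv[OF that] by blast
    from someI_ex[OF this, folded R_def]
    show "R l \<in> carrier_mat n n" "(1\<^sub>m n - row_op N n l * e) * R l = 1\<^sub>m n"
      "R l * (1\<^sub>m n - row_op N n l * e) = 1\<^sub>m n" by auto
  qed
  have dR: "dim_row (R l) = n" "dim_col (R l) = n" if "l \<in> unit_ball N" for l using R(1)[OF that] by auto
  define F where "F l = b * R l" for l
  define \<sigma> where "\<sigma> l = a + F l * row_op N n l * c" for l
  have F: "F l \<in> carrier_mat m n" if "l \<in> unit_ball N" for l
    unfolding F_def using abce(2) R(1)[OF that] by simp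
  have dF: "dim_row (F l) = m" "dim_col (F l) = n" if "l \<in> unit_ball N" for l using F[OF that] by auto
  have solve: "\<chi> = \<alpha> * F l" if l: "l \<in> unit_ball N" and c: "\<chi> \<in> carrier_mat 1 n" "\<alpha> \<in> carrier_mat 1 m"
    and eq: "\<alpha> * b + \<chi> * row_op N n l * e = \<chi>" for l \<chi> \<alpha>
  proof -
    have dc: "dim_row \<chi> = 1" "dim_col \<chi> = n" "dim_row \<alpha> = 1" "dim_col \<alpha> = m" using c by auto
    have "\<alpha> * b = \<chi> - \<chi> * row_op N n l * e"
      by (rule mat_eq_diffI[OF eq]) (simp_all add: dc d)
    also have "\<dots> = \<chi> * (1\<^sub>m n - row_op N n l * e)" by (simp add: mat_ring dc d)
    finally have "\<alpha> * b * R l = \<chi> * (1\<^sub>m n - row_op N n l * e) * R l" by simp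
    also have "\<dots> = \<chi> * ((1\<^sub>m n - row_op N n l * e) * R l)"
      by (rule mat_mult_assoc) (simp_all add: dc d dR[OF l])
    also have "\<dots> = \<chi>" unfolding R(2)[OF l] by (simp add: mat_ring dc)
    also have "\<alpha> * b * R l = \<alpha> * F l" unfolding F_def by (rule mat_mult_assoc) (simp_all add: dc d dR[OF l])
    finally show ?thesis ..
  qed
  have fix_F: "b + F l * row_op N n l * e = F l" if l: "l \<in> unit_ball N" for l
  proof -
    have "F l * (1\<^sub>m n - row_op N n l * e) = b * (R l * (1\<^sub>m n - row_op N n l * e))"
      unfolding F_def by (rule mat_mult_assoc) (simp_all add: d dR[OF l])
    also have "\<dots> = b" unfolding R(3)[OF l] by (simp add: mat_ring d)
    finally have "b = F l - F l * row_op N n l * e" by (simp add: mat_ring d dF[OF l])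
    then have "b $$ (i, j) = (F l - F l * row_op N n l * e) $$ (i, j)" for i j by simp
    then show ?thesis by (intro eq_matI) (auto simp: d dF[OF l] simp del: index_mult_mat(1))
  qed
  have \<sigma>: "\<sigma> l \<in> carrier_mat m q" if "l \<in> unit_ball N" for l
    unfolding \<sigma>_def by (rule carrier_matI) (simp_all add: d dF[OF that])
  have d\<sigma>: "dim_row (\<sigma> l) = m" "dim_col (\<sigma> l) = q" if "l \<in> unit_ball N" for l using \<sigma>[OF that] by auto
  define P where "P l = append_cols (1\<^sub>m m) (F l * row_op N n l)" for l
  have dP: "dim_row (P l) = m" "dim_col (P l) = m + N * n" for l by (auto simp: P_def)
  have PV: "P l * V = append_cols (\<sigma> l) (F l)" if l: "l \<in> unit_ball N" for l
  proof -
    have "P l * V = append_cols (1\<^sub>m m * a + F l * row_op N n l * c) (1\<^sub>m m * b + F l * row_op N n l * e)"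
      unfolding P_def V_def
      by (rule append_cols_mult_block[where r = m]) (use abce F[OF l] in \<open>auto intro!: carrier_matI simp: dF[OF l]\<close>)
    then show ?thesis using fix_F[OF l] by (simp add: mat_ring d \<sigma>_def)
  qed
  have kernel: "(1 / (1 - row_inner l k)) \<cdot>\<^sub>m (1\<^sub>m m - \<sigma> l * mat_adjoint (\<sigma> k)) =
      F l * mat_adjoint (F k) + (1 / (1 - row_inner l k)) \<cdot>\<^sub>m ((P l * E) * mat_adjoint (P k * E))"
    if l: "l \<in> unit_ball N" and k: "k \<in> unit_ball N" for l k
  proof -
    have "P l * mat_adjoint (P k) = 1\<^sub>m m * mat_adjoint (1\<^sub>m m) + (F l * row_op N n l) * mat_adjoint (F k * row_op N n k)"
      unfolding P_def by (rule append_cols_gram[where r = m and t = m]) (auto intro!: carrier_matI simp: dF[OF l] dF[OF k])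
    also have "(F l * row_op N n l) * mat_adjoint (F k * row_op N n k) =
        F l * (row_op N n l * mat_adjoint (row_op N n k)) * mat_adjoint (F k)"
      by (simp add: mat_ring dF[OF l] dF[OF k])
    also have "\<dots> = row_inner l k \<cdot>\<^sub>m (F l * mat_adjoint (F k))"
      unfolding row_op_gram[OF unit_ballD(1)[OF l] unit_ballD(1)[OF k]]
      by (simp add: mat_ring dF[OF l] dF[OF k])
    finally have PP: "P l * mat_adjoint (P k) = 1\<^sub>m m + row_inner l k \<cdot>\<^sub>m (F l * mat_adjoint (F k))"
      by (simp add: mat_ring)
    have PVP: "(P l * V) * mat_adjoint (P k * V) = \<sigma> l * mat_adjoint (\<sigma> k) + F l * mat_adjoint (F k)"
      unfolding PV[OF l] PV[OF k] by (rule append_cols_gram[OF \<sigma>[OF l] F[OF l] \<sigma>[OF k] F[OF k]])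
    have PE: "P l * mat_adjoint (P k) - (P l * V) * mat_adjoint (P k * V) = (P l * E) * mat_adjoint (P k * E)"
      by (rule VV) (simp_all add: dP)
    show ?thesis
      unfolding PE[symmetric] PVP PP using one_minus_row_inner[OF l k]
      by (intro eq_matI) (auto simp: d\<sigma>[OF l] d\<sigma>[OF k] dF[OF l] dF[OF k] field_simps simp del: index_mult_mat(1))
  qed
  have "schur_multiplier N m q \<sigma>"
    unfolding schur_multiplier_def positive_kernel_def
  proof (intro conjI ballI allI impI)
    show "\<sigma> l \<in> carrier_mat m q" if "l \<in> unit_ball N" for l by (rule \<sigma>[OF that])
    fix r :: nat and pt x :: "nat \<Rightarrow> complex mat"
    assume "\<forall>i<r. pt i \<in> unit_ball N \<and> x i \<in> carrier_mat m 1"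
    then have pt: "\<And>i. i < r \<Longrightarrow> pt i \<in> unit_ball N" and x: "\<And>i. i < r \<Longrightarrow> x i \<in> carrier_mat m 1" by auto
    have dx: "dim_row (x i) = m" "dim_col (x i) = 1" if "i < r" for i using x[OF that] by auto
    have "(\<Sum>i<r. \<Sum>j<r. scalar_of (mat_adjoint (x i) * ((1 / (1 - row_inner (pt i) (pt j))) \<cdot>\<^sub>m
        (1\<^sub>m m - \<sigma> (pt i) * mat_adjoint (\<sigma> (pt j)))) * x j)) =
      (\<Sum>i<r. \<Sum>j<r. row_inner (pt i) (pt j) ^ 0 * scalar_of ((mat_adjoint (x i) * F (pt i)) * mat_adjoint (mat_adjoint (x j) * F (pt j)))
        + 1 / (1 - row_inner (pt i) (pt j)) * scalar_of ((mat_adjoint (x i) * P (pt i) * E) * mat_adjoint (mat_adjoint (x j) * P (pt j) * E)))"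
      by (intro sum.cong refl)
        (simp add: kernel pt mat_ring dx dF dP d)
    also have "\<dots> = (\<Sum>i<r. \<Sum>j<r. row_inner (pt i) (pt j) ^ 0 * scalar_of ((mat_adjoint (x i) * F (pt i)) * mat_adjoint (mat_adjoint (x j) * F (pt j))))
        + (\<Sum>i<r. \<Sum>j<r. 1 / (1 - row_inner (pt i) (pt j)) * scalar_of ((mat_adjoint (x i) * P (pt i) * E) * mat_adjoint (mat_adjoint (x j) * P (pt j) * E)))"
      by (simp only: sum.distrib)
    also have "0 \<le> \<dots>"
    proof (rule add_nonneg_nonneg)
      show "0 \<le> (\<Sum>i<r. \<Sum>j<r. row_inner (pt i) (pt j) ^ 0 * scalar_of ((mat_adjoint (x i) * F (pt i)) * mat_adjoint (mat_adjoint (x j) * F (pt j))))"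
        by (rule row_inner_power_gram_positive[OF unit_ballD(1)[OF pt], where k = n])
          (auto intro!: carrier_matI simp: dx pt dF)
      show "0 \<le> (\<Sum>i<r. \<Sum>j<r. 1 / (1 - row_inner (pt i) (pt j)) * scalar_of ((mat_adjoint (x i) * P (pt i) * E) * mat_adjoint (mat_adjoint (x j) * P (pt j) * E)))"
        by (rule drury_arveson_gram_positive[OF pt, where k = "m + N * n"])
          (auto intro!: carrier_matI simp: dx d)
    qed
    finally show "0 \<le> (\<Sum>i<r. \<Sum>j<r. scalar_of (mat_adjoint (x i) * ((1 / (1 - row_inner (pt i) (pt j))) \<cdot>\<^sub>m
        (1\<^sub>m m - \<sigma> (pt i) * mat_adjoint (\<sigma> (pt j)))) * x j))" .
  qed
  then show ?thesis
    by (intro that[of F \<sigma>] ballI allI impI) (simp_all add: F solve \<sigma>_def)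
qed

text \<open>The lurking isometry argument. With \<open>h h\<^sup>*\<close> the given positive matrix and \<open>\<chi>\<^sub>i\<close> the rows of \<open>h\<close>, the rows
  \<open>(\<alpha>\<^sub>i, \<chi>\<^sub>i Z(\<lambda>\<^sub>i))\<close> and \<open>(\<beta>\<^sub>i, \<chi>\<^sub>i)\<close> have the same Gram matrix. A contraction \<open>V\<close> mapping the former to the latter
  yields \<open>\<alpha>\<^sub>i a + \<chi>\<^sub>i Z c = \<beta>\<^sub>i\<close> and \<open>\<alpha>\<^sub>i b + \<chi>\<^sub>i Z e = \<chi>\<^sub>i\<close>, whence \<open>\<alpha>\<^sub>i \<sigma>(\<lambda>\<^sub>i) = \<beta>\<^sub>i\<close> for the transfer function.\<close>

lemma tangential_interpolation_finite:
  fixes l \<alpha> \<beta> :: "nat \<Rightarrow> complex mat"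
  assumes l: "\<And>i. i < n \<Longrightarrow> l i \<in> unit_ball N"
    and \<alpha>: "\<And>i. i < n \<Longrightarrow> \<alpha> i \<in> carrier_mat 1 m" and \<beta>: "\<And>i. i < n \<Longrightarrow> \<beta> i \<in> carrier_mat 1 q"
    and pos: "\<And>z. 0 \<le> (\<Sum>i<n. \<Sum>j<n. z i * cnj (z j) *
      ((scalar_of (\<alpha> i * mat_adjoint (\<alpha> j)) - scalar_of (\<beta> i * mat_adjoint (\<beta> j))) /
        (1 - row_inner (l i) (l j))))"
  obtains \<sigma> where "schur_multiplier N m q \<sigma>" "\<And>i. i < n \<Longrightarrow> \<alpha> i * \<sigma> (l i) = \<beta> i"
proof -
  define k where "k i j = (scalar_of (\<alpha> i * mat_adjoint (\<alpha> j)) - scalar_of (\<beta> i * mat_adjoint (\<beta> j))) /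
        (1 - row_inner (l i) (l j))" for i j
  have k_cnj: "cnj (k i j) = k j i" if "i < n" "j < n" for i j
    using row_inner_cnj[OF unit_ballD(1)[OF l[OF that(1)]] unit_ballD(1)[OF l[OF that(2)]]]
      row_inner_cnj[OF \<alpha>[OF that(1)] \<alpha>[OF that(2)]] row_inner_cnj[OF \<beta>[OF that(1)] \<beta>[OF that(2)]]
    unfolding k_def by (simp add: row_inner_def)
  define H where "H = mat n n (\<lambda>(i, j). k i j)"
  have H: "H \<in> carrier_mat n n" "dim_row H = n" "dim_col H = n" by (auto simp: H_def)
  have H_adj: "mat_adjoint H = H" by (rule eq_matI) (auto simp: H_def k_cnj)
  have H_pos: "pos_semidef H"
    unfolding pos_semidef_def
  proof (intro conjI ballI)
    show "square_mat H" using H by simp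
    fix x :: "complex mat" assume "x \<in> carrier_mat (dim_row H) 1"
    then have dx: "dim_row x = n" "dim_col x = 1" using H by auto
    have "scalar_of (mat_adjoint x * H * x) = (\<Sum>j<n. (\<Sum>i<n. cnj (x $$ (i, 0)) * k i j) * x $$ (j, 0))"
      unfolding scalar_of_def using dx H
      by (simp add: mult_index H_def del: index_mult_mat(1))
    also have "\<dots> = (\<Sum>j<n. \<Sum>i<n. cnj (x $$ (i, 0)) * cnj (cnj (x $$ (j, 0))) * k i j)"
      unfolding sum_distrib_right by (intro sum.cong refl) (simp add: mult_ac)
    also have "\<dots> = (\<Sum>i<n. \<Sum>j<n. cnj (x $$ (i, 0)) * cnj (cnj (x $$ (j, 0))) * k i j)"
      by (rule sum.swap)
    also have "0 \<le> \<dots>" using pos[of "\<lambda>i. cnj (x $$ (i, 0))"] unfolding k_def .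
    finally show "0 \<le> scalar_of (mat_adjoint x * H * x)" .
  qed
  obtain h where h: "h \<in> carrier_mat n n" "H = h * mat_adjoint h"
    using pos_semidef_factor[OF H(1) H_adj H_pos] by metis
  have dh: "dim_row h = n" "dim_col h = n" using h by auto
  define A where "A = mat n m (\<lambda>(i, c). \<alpha> i $$ (0, c))"
  define B where "B = mat n q (\<lambda>(i, c). \<beta> i $$ (0, c))"
  define \<chi> where "\<chi> i = unit_row n i * h" for i
  define Z where "Z = mat n (N * n) (\<lambda>(i, c). (\<chi> i * row_op N n (l i)) $$ (0, c))"
  have dims: "dim_row A = n" "dim_col A = m" "dim_row B = n" "dim_col B = q" "dim_row Z = n" "dim_col Z = N * n"
    "\<And>i. dim_row (\<chi> i) = 1" "\<And>i. dim_col (\<chi> i) = n"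
    by (auto simp: A_def B_def Z_def \<chi>_def dh)
  have ABZ: "A \<in> carrier_mat n m" "B \<in> carrier_mat n q" "Z \<in> carrier_mat n (N * n)"
    by (auto simp: A_def B_def Z_def)
  have rows: "unit_row n i * A = \<alpha> i" "unit_row n i * B = \<beta> i" "unit_row n i * Z = \<chi> i * row_op N n (l i)"
    if i: "i < n" for i
  proof -
    have d: "dim_row (\<alpha> i) = 1" "dim_col (\<alpha> i) = m" "dim_row (\<beta> i) = 1" "dim_col (\<beta> i) = q"
      using \<alpha>[OF i] \<beta>[OF i] by auto
    show "unit_row n i * A = \<alpha> i"
      by (rule eq_matI) (use i in \<open>simp_all add: unit_row_mult dims d del: index_mult_mat(1)\<close>, simp add: A_def)
    show "unit_row n i * B = \<beta> i"
      by (rule eq_matI) (use i in \<open>simp_all add: unit_row_mult dims d del: index_mult_mat(1)\<close>, simp add: B_def)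
    show "unit_row n i * Z = \<chi> i * row_op N n (l i)"
      by (rule eq_matI) (use i in \<open>simp_all add: unit_row_mult dims d del: index_mult_mat(1)\<close>,
        simp add: Z_def dims del: index_mult_mat(1))
  qed
  define M where "M = append_cols A Z"
  define L where "L = append_cols B h"
  have M: "M \<in> carrier_mat n (m + N * n)" and L: "L \<in> carrier_mat n (q + n)"
    unfolding M_def L_def by (auto intro!: carrier_matI simp: dims dh)
  have "M * mat_adjoint M = L * mat_adjoint L"
  proof (rule eq_matI)
    fix i j assume "i < dim_row (L * mat_adjoint L)" "j < dim_col (L * mat_adjoint L)"
    then have ij: "i < n" "j < n" by (auto simp: L_def dims)
    have uM: "unit_row n i * M = append_cols (\<alpha> i) (\<chi> i * row_op N n (l i))"
      and uL: "unit_row n i * L = append_cols (\<beta> i) (\<chi> i)" if "i < n" for i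
      unfolding M_def L_def using rows[OF that]
      by (simp_all add: mult_append_cols dims dh \<chi>_def[symmetric])
    have \<chi>: "\<chi> i \<in> carrier_mat 1 n" "\<chi> i * row_op N n (l i) \<in> carrier_mat 1 (N * n)" for i
      by (rule carrier_matI; simp add: dims)+
    have "(M * mat_adjoint M) $$ (i, j) = scalar_of ((unit_row n i * M) * mat_adjoint (unit_row n j * M))"
      by (rule gram_index) (use M ij in auto)
    also have "(unit_row n i * M) * mat_adjoint (unit_row n j * M) = \<alpha> i * mat_adjoint (\<alpha> j) +
        (\<chi> i * row_op N n (l i)) * mat_adjoint (\<chi> j * row_op N n (l j))"
      unfolding uM[OF ij(1)] uM[OF ij(2)] by (rule append_cols_gram[OF \<alpha>[OF ij(1)] \<chi>(2) \<alpha>[OF ij(2)] \<chi>(2)])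
    also have "(\<chi> i * row_op N n (l i)) * mat_adjoint (\<chi> j * row_op N n (l j)) =
        \<chi> i * (row_op N n (l i) * mat_adjoint (row_op N n (l j))) * mat_adjoint (\<chi> j)"
      by (simp add: mat_ring dims)
    also have "\<dots> = row_inner (l i) (l j) \<cdot>\<^sub>m (\<chi> i * mat_adjoint (\<chi> j))"
      unfolding row_op_gram[OF unit_ballD(1)[OF l[OF ij(1)]] unit_ballD(1)[OF l[OF ij(2)]]]
      by (simp add: mat_ring dims)
    finally have MM: "(M * mat_adjoint M) $$ (i, j) = scalar_of (\<alpha> i * mat_adjoint (\<alpha> j)) +
        row_inner (l i) (l j) * scalar_of (\<chi> i * mat_adjoint (\<chi> j))"
      using \<alpha>[OF ij(1)] \<alpha>[OF ij(2)] by (simp add: dims)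
    have "(L * mat_adjoint L) $$ (i, j) = scalar_of ((unit_row n i * L) * mat_adjoint (unit_row n j * L))"
      by (rule gram_index) (use L ij in auto)
    also have "(unit_row n i * L) * mat_adjoint (unit_row n j * L) = \<beta> i * mat_adjoint (\<beta> j) + \<chi> i * mat_adjoint (\<chi> j)"
      unfolding uL[OF ij(1)] uL[OF ij(2)] by (rule append_cols_gram[OF \<beta>[OF ij(1)] \<chi>(1) \<beta>[OF ij(2)] \<chi>(1)])
    finally have "(L * mat_adjoint L) $$ (i, j) = scalar_of (\<beta> i * mat_adjoint (\<beta> j) + \<chi> i * mat_adjoint (\<chi> j))" .
    then have LL: "(L * mat_adjoint L) $$ (i, j) = scalar_of (\<beta> i * mat_adjoint (\<beta> j)) + scalar_of (\<chi> i * mat_adjoint (\<chi> j))"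
      by (simp add: dims)
    have "scalar_of (\<chi> i * mat_adjoint (\<chi> j)) = H $$ (i, j)"
      unfolding \<chi>_def h(2) using gram_index[of h n h i j] ij dh by simp
    also have "\<dots> = k i j" using ij by (simp add: H_def)
    finally have kk: "scalar_of (\<chi> i * mat_adjoint (\<chi> j)) = k i j" .
    have "(1 - row_inner (l i) (l j)) * k i j = scalar_of (\<alpha> i * mat_adjoint (\<alpha> j)) - scalar_of (\<beta> i * mat_adjoint (\<beta> j))"
      unfolding k_def using one_minus_row_inner[OF l[OF ij(1)] l[OF ij(2)]] by simp
    then show "(M * mat_adjoint M) $$ (i, j) = (L * mat_adjoint L) $$ (i, j)"
      unfolding MM LL kk by (simp add: algebra_simps)
  qed (use M L in auto)
  from equal_gram_imp_contraction[OF M L this] obtain V E where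
    V: "V \<in> carrier_mat (m + N * n) (q + n)" and E: "E \<in> carrier_mat (m + N * n) (m + N * n)"
    and MV: "M * V = L" and defect: "1\<^sub>m (m + N * n) - V * mat_adjoint V = E * mat_adjoint E" .
  obtain a b c e where sp: "split_block V m q = (a, b, c, e)" by (metis prod_cases4)
  have abce: "a \<in> carrier_mat m q" "b \<in> carrier_mat m n" "c \<in> carrier_mat (N * n) q" "e \<in> carrier_mat (N * n) n"
    and V_eq: "V = four_block_mat a b c e"
    using split_block[OF sp, of "N * n" n] V by auto
  from transfer_function[OF abce E defect[unfolded V_eq]] obtain F \<sigma> where
    F: "\<forall>l \<in> unit_ball N. F l \<in> carrier_mat m n"
      "\<forall>l \<in> unit_ball N. \<forall>\<chi> \<in> carrier_mat 1 n. \<forall>\<alpha> \<in> carrier_mat 1 m.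
        \<alpha> * b + \<chi> * row_op N n l * e = \<chi> \<longrightarrow> \<chi> = \<alpha> * F l"
    and \<sigma>: "\<forall>l. \<sigma> l = a + F l * row_op N n l * c" and schur: "schur_multiplier N m q \<sigma>" .
  have "\<alpha> i * \<sigma> (l i) = \<beta> i" if i: "i < n" for i
  proof -
    have d: "dim_row (\<alpha> i) = 1" "dim_col (\<alpha> i) = m" "dim_row a = m" "dim_col a = q" "dim_row b = m" "dim_col b = n"
      "dim_row c = N * n" "dim_col c = q" "dim_row e = N * n" "dim_col e = n"
      "dim_row (F (l i)) = m" "dim_col (F (l i)) = n"
      using \<alpha>[OF i] abce F(1) l[OF i] by auto
    have \<chi>: "\<chi> i \<in> carrier_mat 1 n" by (rule carrier_matI) (simp_all add: dims)
    have "append_cols (\<alpha> i) (\<chi> i * row_op N n (l i)) * V = unit_row n i * M * V"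
      unfolding M_def using rows[OF i] by (simp add: mult_append_cols dims)
    also have "\<dots> = unit_row n i * L" unfolding MV[symmetric] using M V by (simp add: mat_mult_assoc)
    also have "\<dots> = append_cols (\<beta> i) (\<chi> i)"
      unfolding L_def using rows[OF i] by (simp add: mult_append_cols dims dh \<chi>_def)
    also have "append_cols (\<alpha> i) (\<chi> i * row_op N n (l i)) * V =
        append_cols (\<alpha> i * a + \<chi> i * row_op N n (l i) * c) (\<alpha> i * b + \<chi> i * row_op N n (l i) * e)"
      unfolding V_eq by (rule append_cols_mult_block[OF \<alpha>[OF i] _ abce(1,3,2,4)]) (use \<chi> in simp)
    finally have eq: "append_cols (\<alpha> i * a + \<chi> i * row_op N n (l i) * c) (\<alpha> i * b + \<chi> i * row_op N n (l i) * e)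
      = append_cols (\<beta> i) (\<chi> i)" .
    have "\<alpha> i * a + \<chi> i * row_op N n (l i) * c = \<beta> i" "\<alpha> i * b + \<chi> i * row_op N n (l i) * e = \<chi> i"
      by (rule append_cols_inject[OF _ _ \<beta>[OF i] \<chi> eq]; rule carrier_matI; simp add: d dims)+
    moreover from this(2) have "\<chi> i = \<alpha> i * F (l i)" using F(2) l[OF i] \<chi> \<alpha>[OF i] by blast
    ultimately show ?thesis by (simp add: \<sigma> mat_ring d)
  qed
  from that[OF schur this] show ?thesis .
qed

section \<open>Tangential interpolation on arbitrary sets\<close>

lemma schur_multiplier_cong:
  assumes "\<And>l. l \<in> unit_ball N \<Longrightarrow> \<sigma> l = \<tau> l"
  shows "schur_multiplier N m q \<sigma> \<longleftrightarrow> schur_multiplier N m q \<tau>"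
proof -
  have "schur_multiplier N m q \<tau>" if "schur_multiplier N m q \<sigma>" "\<And>l. l \<in> unit_ball N \<Longrightarrow> \<sigma> l = \<tau> l" for \<sigma> \<tau>
    unfolding schur_multiplier_def positive_kernel_def
  proof (intro conjI ballI allI impI)
    fix l assume "l \<in> unit_ball N"
    then show "\<tau> l \<in> carrier_mat m q" using that by (auto simp: schur_multiplier_def)
  next
    fix n :: nat and pt x :: "nat \<Rightarrow> complex mat"
    assume *: "\<forall>i<n. pt i \<in> unit_ball N \<and> x i \<in> carrier_mat m 1"
    then have "0 \<le> (\<Sum>i<n. \<Sum>j<n. scalar_of (mat_adjoint (x i) * ((1 / (1 - row_inner (pt i) (pt j))) \<cdot>\<^sub>m
        (1\<^sub>m m - \<sigma> (pt i) * mat_adjoint (\<sigma> (pt j)))) * x j))"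
      using that(1) unfolding schur_multiplier_def positive_kernel_def by blast
    also have "\<dots> = (\<Sum>i<n. \<Sum>j<n. scalar_of (mat_adjoint (x i) * ((1 / (1 - row_inner (pt i) (pt j))) \<cdot>\<^sub>m
        (1\<^sub>m m - \<tau> (pt i) * mat_adjoint (\<tau> (pt j)))) * x j))"
      using * that(2) by (intro sum.cong refl) simp
    finally show "0 \<le> \<dots>" .
  qed
  then show ?thesis using assms by metis
qed

text \<open>The kernel of a Schur multiplier, evaluated at vectors.\<close>

lemma schur_kernel_expand:
  assumes "x \<in> carrier_mat m 1" "y \<in> carrier_mat m 1" "A \<in> carrier_mat m q" "B \<in> carrier_mat m q"
  shows "scalar_of (mat_adjoint x * (c \<cdot>\<^sub>m (1\<^sub>m m - A * mat_adjoint B)) * y) =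
    c * (scalar_of (mat_adjoint x * y) -
      (\<Sum>b<q. (\<Sum>a<m. cnj (x $$ (a, 0)) * A $$ (a, b)) * cnj (\<Sum>a<m. cnj (y $$ (a, 0)) * B $$ (a, b))))"
proof -
  have d: "dim_row x = m" "dim_col x = 1" "dim_row y = m" "dim_col y = 1"
    "dim_row A = m" "dim_col A = q" "dim_row B = m" "dim_col B = q" using assms by auto
  have "scalar_of (mat_adjoint x * (c \<cdot>\<^sub>m (1\<^sub>m m - A * mat_adjoint B)) * y) =
      c * (scalar_of (mat_adjoint x * y) - row_inner (mat_adjoint x * A) (mat_adjoint y * B))"
    by (simp add: mat_ring d row_inner_def)
  also have "row_inner (mat_adjoint x * A) (mat_adjoint y * B) =
      (\<Sum>b<q. (mat_adjoint x * A) $$ (0, b) * cnj ((mat_adjoint y * B) $$ (0, b)))"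
    by (rule row_inner_sum) (auto intro!: carrier_matI simp: d)
  also have "\<dots> = (\<Sum>b<q. (\<Sum>a<m. cnj (x $$ (a, 0)) * A $$ (a, b)) * cnj (\<Sum>a<m. cnj (y $$ (a, 0)) * B $$ (a, b)))"
    by (intro sum.cong refl) (simp add: mult_index d del: index_mult_mat(1))
  finally show ?thesis .
qed

text \<open>Positivity of the kernel at a single point and a standard basis vector bounds the norm of each row.\<close>

lemma schur_multiplier_entry_bound:
  assumes schur: "schur_multiplier N m q \<sigma>" and l: "l \<in> unit_ball N" and ab: "a < m" "b < q"
  shows "cmod (\<sigma> l $$ (a, b)) \<le> 1"
proof -
  define x where "x = mat_adjoint (unit_row m a)"
  have x: "x \<in> carrier_mat m 1" unfolding x_def adjoint_carrier by (rule unit_row_dim)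
  have \<sigma>: "\<sigma> l \<in> carrier_mat m q" using schur l by (auto simp: schur_multiplier_def)
  have xi: "cnj (x $$ (i, 0)) = (if i = a then 1 else 0)" if "i < m" for i
    using that by (simp add: x_def unit_row_def)
  have xA: "(\<Sum>i<m. cnj (x $$ (i, 0)) * \<sigma> l $$ (i, b)) = \<sigma> l $$ (a, b)" for b
  proof -
    have "(\<Sum>i<m. cnj (x $$ (i, 0)) * \<sigma> l $$ (i, b)) = (\<Sum>i<m. if i = a then \<sigma> l $$ (i, b) else 0)"
      by (intro sum.cong refl) (simp add: xi)
    then show ?thesis using ab by simp
  qed
  have xx: "scalar_of (mat_adjoint x * x) = 1"
  proof -
    have "scalar_of (mat_adjoint x * x) = (unit_row m a * mat_adjoint (unit_row m a)) $$ (0, 0)"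
      by (simp add: x_def scalar_of_def)
    also have "\<dots> = 1" using ab by (subst unit_row_mult) (simp_all, simp add: unit_row_def)
    finally show ?thesis .
  qed
  have "0 \<le> (\<Sum>i<1::nat. \<Sum>j<1::nat. scalar_of (mat_adjoint x * ((1 / (1 - row_inner l l)) \<cdot>\<^sub>m
      (1\<^sub>m m - \<sigma> l * mat_adjoint (\<sigma> l))) * x))"
    by (rule schur[unfolded schur_multiplier_def positive_kernel_def, THEN conjunct2, rule_format,
      of 1 "\<lambda>_. l" "\<lambda>_. x"]) (use l x in simp)
  then have "0 \<le> scalar_of (mat_adjoint x * ((1 / (1 - row_inner l l)) \<cdot>\<^sub>m
      (1\<^sub>m m - \<sigma> l * mat_adjoint (\<sigma> l))) * x)" by simp
  then have "0 \<le> 1 / (1 - row_inner l l) * (1 - (\<Sum>b<q. \<sigma> l $$ (a, b) * cnj (\<sigma> l $$ (a, b))))"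
    unfolding schur_kernel_expand[OF x x \<sigma> \<sigma>] xA xx .
  moreover have "\<dots> = complex_of_real (1 / (1 - Re (row_inner l l)) * (1 - (\<Sum>b<q. (cmod (\<sigma> l $$ (a, b)))\<^sup>2)))"
  proof -
    have "row_inner l l = complex_of_real (Re (row_inner l l))"
      using scalar_gram_nonneg[of l] unit_ballD(2)[OF l] by (auto simp: row_inner_def less_eq_complex_def complex_eq_iff)
    then show ?thesis by (simp add: complex_norm_square del: of_real_power)
  qed
  ultimately have "0 \<le> 1 / (1 - Re (row_inner l l)) * (1 - (\<Sum>b<q. (cmod (\<sigma> l $$ (a, b)))\<^sup>2))"
    by (simp add: less_eq_complex_def)
  moreover have "Re (row_inner l l) < 1" using l by (auto simp: unit_ball_def less_complex_def)
  ultimately have "(\<Sum>b<q. (cmod (\<sigma> l $$ (a, b)))\<^sup>2) \<le> 1"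
    by (simp add: zero_le_divide_iff)
  moreover have "(cmod (\<sigma> l $$ (a, b)))\<^sup>2 \<le> (\<Sum>b<q. (cmod (\<sigma> l $$ (a, b)))\<^sup>2)"
    using ab by (intro member_le_sum) auto
  ultimately have "(cmod (\<sigma> l $$ (a, b)))\<^sup>2 \<le> 1\<^sup>2" by simp
  then show ?thesis by (rule power2_le_imp_le) simp
qed

lemma compact_unit_disc: "compact {z. cmod z \<le> 1}"
proof -
  have "compact ((\<lambda>(x, y). complex_of_real x + \<i> * complex_of_real y) ` ({-1..1} \<times> {-1..1}))"
    unfolding case_prod_unfold
    by (intro compact_continuous_image compact_Times compact_Icc continuous_intros)
  then have "compact ((\<lambda>(x, y). complex_of_real x + \<i> * complex_of_real y) ` ({-1..1} \<times> {-1..1}) \<inter> {z. cmod z \<le> 1})"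
    by (intro compact_Int_closed closed_Collect_le continuous_intros)
  also have "(\<lambda>(x, y). complex_of_real x + \<i> * complex_of_real y) ` ({-1..1} \<times> {-1..1}) \<inter> {z. cmod z \<le> 1} = {z. cmod z \<le> 1}"
  proof -
    have "z \<in> (\<lambda>(x, y). complex_of_real x + \<i> * complex_of_real y) ` ({-1..1} \<times> {-1..1})" if "cmod z \<le> 1" for z
    proof (rule image_eqI)
      show "z = (\<lambda>(x, y). complex_of_real x + \<i> * complex_of_real y) (Re z, Im z)" by (simp add: complex_eq_iff)
      show "(Re z, Im z) \<in> {-1..1} \<times> {-1..1}"
        using that abs_Re_le_cmod[of z] abs_Im_le_cmod[of z] by (auto simp: abs_le_iff)
    qed
    then show ?thesis by blast
  qed
  finally show ?thesis .
qed

lemma compact_unit_polydisc: "compact {\<phi> :: 'a \<Rightarrow> complex. \<forall>x. cmod (\<phi> x) \<le> 1}"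
proof -
  have "compactin (product_topology (\<lambda>_. euclidean) UNIV) (PiE (UNIV :: 'a set) (\<lambda>_. {z. cmod z \<le> 1}))"
    by (subst compactin_PiE) (simp add: compact_unit_disc)
  then have "compact (PiE (UNIV :: 'a set) (\<lambda>_. {z. cmod z \<le> 1}))"
    by (simp add: euclidean_product_topology)
  also have "PiE (UNIV :: 'a set) (\<lambda>_. {z. cmod z \<le> 1}) = {\<phi>. \<forall>x. cmod (\<phi> x) \<le> 1}"
    by (auto simp: PiE_iff)
  finally show ?thesis .
qed

lemma closed_nonneg_complex:
  fixes f :: "'a :: topological_space \<Rightarrow> complex"
  assumes "continuous_on UNIV f"
  shows "closed {x. 0 \<le> f x}"
proof -
  have "{x. 0 \<le> f x} = {x. 0 \<le> Re (f x)} \<inter> {x. Im (f x) = 0}"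
    by (auto simp: less_eq_complex_def)
  also have "closed \<dots>"
    by (intro closed_Int closed_Collect_le closed_Collect_eq continuous_intros assms)
  finally show ?thesis .
qed

text \<open>Each interpolation condition and each instance of positivity involves finitely many entries and is
  closed for pointwise convergence; Tychonoff's theorem passes from finite sets of conditions to all.\<close>

lemma tangential_interpolation:
  fixes I :: "'i set" and l \<alpha> \<beta> :: "'i \<Rightarrow> complex mat"
  assumes l: "\<And>i. i \<in> I \<Longrightarrow> l i \<in> unit_ball N"
    and \<alpha>: "\<And>i. i \<in> I \<Longrightarrow> \<alpha> i \<in> carrier_mat 1 m" and \<beta>: "\<And>i. i \<in> I \<Longrightarrow> \<beta> i \<in> carrier_mat 1 q"
    and pos: "\<And>n f z. (\<And>k :: nat. k < n \<Longrightarrow> f k \<in> I) \<Longrightarrow> 0 \<le> (\<Sum>i<n. \<Sum>j<n. z i * cnj (z j) *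
      ((scalar_of (\<alpha> (f i) * mat_adjoint (\<alpha> (f j))) - scalar_of (\<beta> (f i) * mat_adjoint (\<beta> (f j)))) /
        (1 - row_inner (l (f i)) (l (f j)))))"
  obtains \<sigma> where "schur_multiplier N m q \<sigma>" "\<And>i. i \<in> I \<Longrightarrow> \<alpha> i * \<sigma> (l i) = \<beta> i"
proof -
  \<comment> \<open>Matrix-valued functions are encoded by their entries, as points of a product of unit discs.\<close>
  define mk where "mk \<phi> l = mat m q (\<lambda>(a, b). \<phi> (l, a, b))" for \<phi> :: "complex mat \<times> nat \<times> nat \<Rightarrow> complex" and l
  have mk: "mk \<phi> l \<in> carrier_mat m q" "dim_row (mk \<phi> l) = m" "dim_col (mk \<phi> l) = q" for \<phi> l by (auto simp: mk_def)
  define S where "S = {\<phi>. \<forall>x. cmod (\<phi> x) \<le> 1} \<inter> {\<phi>. schur_multiplier N m q (mk \<phi>)}"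
  define C where "C i = {\<phi>. \<forall>b<q. (\<Sum>a<m. \<alpha> i $$ (0, a) * \<phi> (l i, a, b)) = \<beta> i $$ (0, b)}" for i
  have C: "\<phi> \<in> C i \<longleftrightarrow> \<alpha> i * mk \<phi> (l i) = \<beta> i" if i: "i \<in> I" for \<phi> i
  proof -
    have d: "dim_row (\<alpha> i) = 1" "dim_col (\<alpha> i) = m" "dim_row (\<beta> i) = 1" "dim_col (\<beta> i) = q"
      using \<alpha>[OF i] \<beta>[OF i] by auto
    have e: "(\<alpha> i * mk \<phi> (l i)) $$ (0, b) = (\<Sum>a<m. \<alpha> i $$ (0, a) * \<phi> (l i, a, b))" if "b < q" for b
      using that by (subst mult_index) (auto simp: d mk mk_def)
    show ?thesis
    proof
      assume "\<phi> \<in> C i"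
      then show "\<alpha> i * mk \<phi> (l i) = \<beta> i"
        by (intro eq_matI) (auto simp: d mk e C_def simp del: index_mult_mat(1))
    next
      assume h: "\<alpha> i * mk \<phi> (l i) = \<beta> i"
      show "\<phi> \<in> C i" unfolding C_def using e[unfolded h] by simp
    qed
  qed
  have closedC: "closed (C i)" for i
    unfolding C_def by (intro closed_Collect_all closed_Collect_imp closed_Collect_eq continuous_intros) auto
  define D where "D = {(n :: nat, pt, x :: nat \<Rightarrow> complex mat). \<forall>i<n. pt i \<in> unit_ball N \<and> x i \<in> carrier_mat m 1}"
  define w where "w l k = 1 / (1 - row_inner l k)" for l k
  define g where "g = (\<lambda>(n :: nat, pt, x) \<phi>. \<Sum>i<n. \<Sum>j<n. w (pt i) (pt j) *
    (scalar_of (mat_adjoint (x i) * x j) -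
      (\<Sum>b<q. (\<Sum>a<m. cnj (x i $$ (a, 0)) * \<phi> (pt i, a, b)) * cnj (\<Sum>a<m. cnj (x j $$ (a, 0)) * \<phi> (pt j, a, b)))))"
  have "{\<phi>. schur_multiplier N m q (mk \<phi>)} = (\<Inter>t\<in>D. {\<phi>. 0 \<le> g t \<phi>})"
  proof -
    have "g (n, pt, x) \<phi> = (\<Sum>i<n. \<Sum>j<n. scalar_of (mat_adjoint (x i) * ((1 / (1 - row_inner (pt i) (pt j))) \<cdot>\<^sub>m
        (1\<^sub>m m - mk \<phi> (pt i) * mat_adjoint (mk \<phi> (pt j)))) * x j))"
      if "\<forall>i<n. pt i \<in> unit_ball N \<and> x i \<in> carrier_mat m 1" for n pt x \<phi>
      unfolding g_def prod.case using that
      by (intro sum.cong refl) (subst schur_kernel_expand[OF _ _ mk(1) mk(1)], simp_all add: mk_def w_def)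
    then show ?thesis
      unfolding schur_multiplier_def positive_kernel_def D_def using mk(1) by auto
  qed
  also have "closed \<dots>"
    unfolding g_def by (auto intro!: closed_INT closed_nonneg_complex continuous_intros)
  finally have "compact S"
    unfolding S_def by (intro compact_Int_closed compact_unit_polydisc)
  then have "S \<inter> (\<Inter>i\<in>I. C i) \<noteq> {}"
  proof (rule compact_imp_fip_image[OF _ closedC])
    fix J assume J: "finite J" "J \<subseteq> I"
    obtain f where f: "bij_betw f {..<card J} J" using ex_bij_betw_nat_finite[OF J(1)] by (metis atLeast0LessThan)
    then have fI: "f k \<in> I" if "k < card J" for k using J(2) that by (auto simp: bij_betw_def)
    obtain \<sigma> where \<sigma>: "schur_multiplier N m q \<sigma>" "\<And>k. k < card J \<Longrightarrow> \<alpha> (f k) * \<sigma> (l (f k)) = \<beta> (f k)"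
    proof (rule tangential_interpolation_finite[of "card J" "\<lambda>k. l (f k)" N "\<lambda>k. \<alpha> (f k)" m "\<lambda>k. \<beta> (f k)" q])
      show "l (f k) \<in> unit_ball N" "\<alpha> (f k) \<in> carrier_mat 1 m" "\<beta> (f k) \<in> carrier_mat 1 q" if "k < card J" for k
        using l \<alpha> \<beta> fI[OF that] by blast+
      show "0 \<le> (\<Sum>i<card J. \<Sum>j<card J. z i * cnj (z j) *
        ((scalar_of (\<alpha> (f i) * mat_adjoint (\<alpha> (f j))) - scalar_of (\<beta> (f i) * mat_adjoint (\<beta> (f j)))) /
          (1 - row_inner (l (f i)) (l (f j)))))" for z
        by (rule pos[OF fI])
    qed (rule that)
    define \<phi> where "\<phi> = (\<lambda>(l, a, b). if l \<in> unit_ball N \<and> a < m \<and> b < q then \<sigma> l $$ (a, b) else 0)"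
    have mk_eq: "mk \<phi> l = \<sigma> l" if "l \<in> unit_ball N" for l
      using \<sigma>(1) that by (intro eq_matI) (auto simp: mk_def \<phi>_def schur_multiplier_def)
    have "\<phi> \<in> S"
      unfolding S_def using schur_multiplier_cong[of N "mk \<phi>" \<sigma> m q] mk_eq \<sigma>(1) schur_multiplier_entry_bound[OF \<sigma>(1)]
      by (auto simp: \<phi>_def)
    moreover have "\<phi> \<in> C i" if "i \<in> J" for i
    proof -
      obtain k where "k < card J" "i = f k" using f \<open>i \<in> J\<close> by (auto simp: bij_betw_def)
      then show ?thesis using C[of i \<phi>] \<sigma>(2)[of k] mk_eq l that J by auto
    qed
    ultimately show "S \<inter> (\<Inter>i\<in>J. C i) \<noteq> {}" by blast
  qed
  then obtain \<phi> where "\<phi> \<in> S" "\<And>i. i \<in> I \<Longrightarrow> \<phi> \<in> C i" by blast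
  then show ?thesis using that[of "mk \<phi>"] C by (auto simp: S_def)
qed

section \<open>Blaschke factors\<close>

text \<open>The Gram kernel of the Blaschke factor, from \<open>(I - \<nu>\<^sup>*\<nu>)\<^sup>-\<^sup>1 = I + \<nu>\<^sup>*\<nu> / (1 - \<nu>\<nu>\<^sup>*)\<close>.\<close>

lemma blaschke_facts:
  assumes \<nu>: "\<nu> \<in> unit_ball N" and l: "l \<in> carrier_mat 1 N"
  shows "blaschke N \<nu> l \<in> carrier_mat 1 N"
    and "blaschke N \<nu> \<nu> = 0\<^sub>m 1 N"
    and "m \<in> carrier_mat 1 N \<Longrightarrow> row_inner (blaschke N \<nu> l) (blaschke N \<nu> m) =
      csqrt (1 - row_inner \<nu> \<nu>) * cnj (csqrt (1 - row_inner \<nu> \<nu>)) / ((1 - row_inner l \<nu>) * (1 - row_inner \<nu> m)) *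
      (row_inner l m - row_inner l \<nu> - row_inner \<nu> m + row_inner \<nu> \<nu> +
        (row_inner l \<nu> - row_inner \<nu> \<nu>) * (row_inner \<nu> m - row_inner \<nu> \<nu>) / (1 - row_inner \<nu> \<nu>))"
proof -
  have d: "dim_row \<nu> = 1" "dim_col \<nu> = N" "dim_row l = 1" "dim_col l = N" using unit_ballD[OF \<nu>] l by auto
  define v where "v = mat_adjoint \<nu>"
  have v: "v \<in> carrier_mat N 1" "mat_adjoint v = \<nu>" using unit_ballD[OF \<nu>] by (auto simp: v_def)
  define n where "n = Re (scalar_of (mat_adjoint v * v))"
  have n: "row_inner \<nu> \<nu> = complex_of_real n"
    using scalar_gram_nonneg[of \<nu>] d unfolding n_def v(2) unfolding v_def row_inner_def
    by (auto simp: less_eq_complex_def complex_eq_iff)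
  have n1: "n < 1" using \<nu> n by (auto simp: unit_ball_def less_complex_def)
  let ?A = "1\<^sub>m N - mat_adjoint \<nu> * \<nu>"
  have A: "?A = 1\<^sub>m N + complex_of_real (- 1) \<cdot>\<^sub>m (v * mat_adjoint v)"
    unfolding v(2) unfolding v_def by (rule eq_matI) (auto simp: d)
  have pos: "1 + (- 1) * n > 0" using n1 by simp
  note R = mat_sqrt_rank_one[OF v(1) n_def pos _ A] mat_inv_sqrt_rank_one_square[OF v(1) n_def pos _ A]
  define Ri where "Ri = mat_inv (mat_sqrt ?A)"
  have Ri: "Ri \<in> carrier_mat N N" "mat_adjoint Ri = Ri" "Ri * Ri = 1\<^sub>m N + (1 / (1 - row_inner \<nu> \<nu>)) \<cdot>\<^sub>m (mat_adjoint \<nu> * \<nu>)"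
    using R(4,5,8) unfolding Ri_def v(2) unfolding v_def n by simp_all
  have dRi: "dim_row Ri = N" "dim_col Ri = N" using Ri(1) by auto
  define \<gamma> where "\<gamma> l = csqrt (1 - row_inner \<nu> \<nu>) / (1 - row_inner l \<nu>)" for l
  have b: "blaschke N \<nu> l = \<gamma> l \<cdot>\<^sub>m ((l - \<nu>) * Ri)" for l
    by (simp add: blaschke_def \<gamma>_def Ri_def)
  show "blaschke N \<nu> l \<in> carrier_mat 1 N" unfolding b by (rule carrier_matI) (simp_all add: d dRi)
  show "blaschke N \<nu> \<nu> = 0\<^sub>m 1 N"
  proof -
    have "\<nu> - \<nu> = 0\<^sub>m 1 N" by (rule eq_matI) (auto simp: d)
    then show ?thesis unfolding b by (intro eq_matI) (auto simp: dRi mat_ring)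
  qed
  assume m: "m \<in> carrier_mat 1 N"
  then have dm: "dim_row m = 1" "dim_col m = N" by auto
  have "row_inner (blaschke N \<nu> l) (blaschke N \<nu> m) = \<gamma> l * cnj (\<gamma> m) * scalar_of ((l - \<nu>) * (Ri * Ri) * mat_adjoint (m - \<nu>))"
    unfolding b row_inner_def by (simp add: mat_ring d dm dRi Ri(2) right_diff_distrib)
  also have "(l - \<nu>) * (Ri * Ri) * mat_adjoint (m - \<nu>) = (l - \<nu>) * mat_adjoint (m - \<nu>) +
      (1 / (1 - row_inner \<nu> \<nu>)) \<cdot>\<^sub>m (((l - \<nu>) * mat_adjoint \<nu>) * (\<nu> * mat_adjoint (m - \<nu>)))"
  proof -
    define X where "X = l - \<nu>"
    define Y where "Y = mat_adjoint (m - \<nu>)"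
    have "dim_row X = 1" "dim_col X = N" "dim_row Y = N" "dim_col Y = 1" by (auto simp: X_def Y_def d dm)
    then show ?thesis unfolding X_def[symmetric] Y_def[symmetric] Ri(3) by (simp add: mat_ring d)
  qed
  also have "scalar_of \<dots> = scalar_of ((l - \<nu>) * mat_adjoint (m - \<nu>)) + 1 / (1 - row_inner \<nu> \<nu>) *
      (scalar_of ((l - \<nu>) * mat_adjoint \<nu>) * scalar_of (\<nu> * mat_adjoint (m - \<nu>)))"
    by (simp add: scalar_of_mult d dm del: adjoint_minus)
  also have "scalar_of ((l - \<nu>) * mat_adjoint (m - \<nu>)) = row_inner l m - row_inner l \<nu> - row_inner \<nu> m + row_inner \<nu> \<nu>"
    by (simp add: mat_ring d dm row_inner_def)
  also have "scalar_of ((l - \<nu>) * mat_adjoint \<nu>) = row_inner l \<nu> - row_inner \<nu> \<nu>"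
    by (simp add: mat_ring d dm row_inner_def)
  also have "scalar_of (\<nu> * mat_adjoint (m - \<nu>)) = row_inner \<nu> m - row_inner \<nu> \<nu>"
    by (simp add: mat_ring d dm row_inner_def)
  also have "\<gamma> l * cnj (\<gamma> m) = csqrt (1 - row_inner \<nu> \<nu>) * cnj (csqrt (1 - row_inner \<nu> \<nu>)) /
      ((1 - row_inner l \<nu>) * (1 - row_inner \<nu> m))"
    using row_inner_cnj[OF m unit_ballD(1)[OF \<nu>]] by (simp add: \<gamma>_def)
  finally show "row_inner (blaschke N \<nu> l) (blaschke N \<nu> m) =
      csqrt (1 - row_inner \<nu> \<nu>) * cnj (csqrt (1 - row_inner \<nu> \<nu>)) / ((1 - row_inner l \<nu>) * (1 - row_inner \<nu> m)) *
      (row_inner l m - row_inner l \<nu> - row_inner \<nu> m + row_inner \<nu> \<nu> +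
        (row_inner l \<nu> - row_inner \<nu> \<nu>) * (row_inner \<nu> m - row_inner \<nu> \<nu>) / (1 - row_inner \<nu> \<nu>))"
    by simp
qed

lemma blaschke_kernel:
  assumes \<nu>: "\<nu> \<in> unit_ball N" and l: "l \<in> unit_ball N" and m: "m \<in> unit_ball N"
  shows "1 - row_inner (blaschke N \<nu> l) (blaschke N \<nu> m) =
    (1 - row_inner \<nu> \<nu>) * (1 - row_inner l m) / ((1 - row_inner l \<nu>) * (1 - row_inner \<nu> m))"
proof -
  obtain n where n: "row_inner \<nu> \<nu> = complex_of_real n" "n < 1" by (rule row_inner_self[OF \<nu>])
  have c: "csqrt (1 - row_inner \<nu> \<nu>) * cnj (csqrt (1 - row_inner \<nu> \<nu>)) = 1 - row_inner \<nu> \<nu>"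
  proof -
    have "1 - row_inner \<nu> \<nu> = complex_of_real (1 - n)" by (simp add: n)
    moreover have "csqrt (complex_of_real (1 - n)) = complex_of_real (sqrt (1 - n))"
      using n(2) by simp
    ultimately show ?thesis using n(2) by (simp flip: of_real_mult)
  qed
  have algebra: "1 - (1 - n) / ((1 - x) * (1 - y)) * (g - x - y + n + (x - n) * (y - n) / (1 - n)) =
      (1 - n) * (1 - g) / ((1 - x) * (1 - y))"
    if "1 - n \<noteq> 0" "1 - x \<noteq> 0" "1 - y \<noteq> 0" for n x y g :: complex
  proof -
    have "(1 - n) * (g - x - y + n + (x - n) * (y - n) / (1 - n)) = (1 - n) * (g - x - y + n) + (x - n) * (y - n)"
      using that(1) by (simp add: distrib_left)
    then have "(1 - n) / ((1 - x) * (1 - y)) * (g - x - y + n + (x - n) * (y - n) / (1 - n)) =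
        ((1 - n) * (g - x - y + n) + (x - n) * (y - n)) / ((1 - x) * (1 - y))" by simp
    moreover have "1 = ((1 - x) * (1 - y)) / ((1 - x) * (1 - y))" using that by simp
    ultimately have "1 - (1 - n) / ((1 - x) * (1 - y)) * (g - x - y + n + (x - n) * (y - n) / (1 - n)) =
        ((1 - x) * (1 - y) - ((1 - n) * (g - x - y + n) + (x - n) * (y - n))) / ((1 - x) * (1 - y))"
      by (simp only: diff_divide_distrib)
    also have "(1 - x) * (1 - y) - ((1 - n) * (g - x - y + n) + (x - n) * (y - n)) = (1 - n) * (1 - g)"
      by (simp add: algebra_simps)
    finally show ?thesis .
  qed
  show ?thesis
    unfolding blaschke_facts(3)[OF \<nu> unit_ballD(1)[OF l] unit_ballD(1)[OF m]] c
    by (rule algebra) (use one_minus_row_inner[OF \<nu> \<nu>] one_minus_row_inner[OF l \<nu>] one_minus_row_inner[OF \<nu> m] in auto)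
qed

section \<open>The linear fractional transformation\<close>

text \<open>The constant matrices of the transformation: \<open>U U\<^sup>*\<close> is the orthogonal projection onto the
  complement of \<open>\<xi>\<close>, and \<open>R\<close> is the square root of \<open>I + \<eta> \<eta>\<^sup>* / k\<close> with inverse \<open>Q\<close>.\<close>

locale interpolation_data =
  fixes p q r :: nat and \<xi> \<eta> U R Q :: "complex mat" and x e k :: real
  assumes \<xi>: "\<xi> \<in> carrier_mat p 1" and \<eta>: "\<eta> \<in> carrier_mat q 1"
    and \<xi>_norm: "scalar_of (mat_adjoint \<xi> * \<xi>) = complex_of_real x"
    and \<eta>_norm: "scalar_of (mat_adjoint \<eta> * \<eta>) = complex_of_real e"
    and k_eq: "k = x - e" and k_pos: "0 < k"
    and U: "U \<in> carrier_mat p r" and U_gram: "U * mat_adjoint U = 1\<^sub>m p - (1 / complex_of_real x) \<cdot>\<^sub>m (\<xi> * mat_adjoint \<xi>)"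
    and R: "R \<in> carrier_mat q q" "mat_adjoint R = R"
    and Q: "Q \<in> carrier_mat q q" "mat_adjoint Q = Q"
    and RQ: "R * Q = 1\<^sub>m q" "Q * R = 1\<^sub>m q"
    and RR: "R * R = 1\<^sub>m q + (1 / complex_of_real k) \<cdot>\<^sub>m (\<eta> * mat_adjoint \<eta>)"
    and QQ: "Q * Q = 1\<^sub>m q + (- 1 / complex_of_real x) \<cdot>\<^sub>m (\<eta> * mat_adjoint \<eta>)"
begin

lemma dims: "dim_row \<xi> = p" "dim_col \<xi> = 1" "dim_row \<eta> = q" "dim_col \<eta> = 1" "dim_row U = p" "dim_col U = r"
  "dim_row R = q" "dim_col R = q" "dim_row Q = q" "dim_col Q = q"
  using \<xi> \<eta> U R Q by auto

lemma e_nonneg: "0 \<le> e"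
  using scalar_gram_col_nonneg[of \<eta>] \<eta>_norm by (simp add: dims less_eq_complex_def)

lemma x_pos: "0 < x" using e_nonneg k_eq k_pos by simp

lemma adjoint_U_\<xi>: "mat_adjoint U * \<xi> = 0\<^sub>m r 1"
proof -
  have "U * (mat_adjoint U * \<xi>) = (U * mat_adjoint U) * \<xi>" by (simp add: mat_ring dims)
  also have "\<dots> = \<xi> - (1 / complex_of_real x) \<cdot>\<^sub>m (\<xi> * (mat_adjoint \<xi> * \<xi>))"
    unfolding U_gram by (simp add: mat_ring dims)
  also have "\<xi> * (mat_adjoint \<xi> * \<xi>) = complex_of_real x \<cdot>\<^sub>m \<xi>"
    using mult_scalar_right[of "mat_adjoint \<xi> * \<xi>" \<xi>] by (simp add: dims \<xi>_norm)
  also have "\<xi> - (1 / complex_of_real x) \<cdot>\<^sub>m (complex_of_real x \<cdot>\<^sub>m \<xi>) = 0\<^sub>m p 1"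
    by (rule eq_matI) (use x_pos in \<open>auto simp: dims\<close>)
  finally have "mat_adjoint \<xi> * (U * (mat_adjoint U * \<xi>)) = mat_adjoint \<xi> * 0\<^sub>m p 1" by simp
  then have "scalar_of (mat_adjoint (mat_adjoint U * \<xi>) * (mat_adjoint U * \<xi>)) = 0"
    by (simp add: mat_ring dims)
  then show ?thesis using scalar_gram_col_eq_0[of "mat_adjoint U * \<xi>"] by (simp add: dims)
qed

lemma adjoint_\<xi>_U: "mat_adjoint \<xi> * U = 0\<^sub>m 1 r"
proof -
  have "mat_adjoint (mat_adjoint U * \<xi>) = 0\<^sub>m 1 r" by (simp only: adjoint_U_\<xi> adjoint_zero)
  then show ?thesis by (simp add: dims)
qed

text \<open>The coefficients of the equation \<open>A \<sigma> = B\<close> that expresses, with the denominator cleared, that the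
  transformation takes \<open>\<sigma>\<close> to \<open>S\<close>; here \<open>b\<close> is the value of the Blaschke factor.\<close>

definition coeff_A :: "complex mat \<Rightarrow> complex mat \<Rightarrow> complex mat" where
  "coeff_A S b = append_cols ((1 / complex_of_real (sqrt k)) \<cdot>\<^sub>m ((\<xi> - S * \<eta>) * b)) U"

definition coeff_B :: "complex mat \<Rightarrow> complex mat" where
  "coeff_B S = S * R - ((1 / complex_of_real k) \<cdot>\<^sub>m (\<xi> * mat_adjoint \<eta>)) * Q"

lemma gram_A:
  assumes "S \<in> carrier_mat p q" "T \<in> carrier_mat p q" "b \<in> carrier_mat 1 N" "c \<in> carrier_mat 1 N"
    "y \<in> carrier_mat 1 p" "z \<in> carrier_mat 1 p"
  shows "scalar_of ((y * coeff_A S b) * mat_adjoint (z * coeff_A T c)) =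
    scalar_of (y * (\<xi> - S * \<eta>)) * cnj (scalar_of (z * (\<xi> - T * \<eta>))) * row_inner b c / complex_of_real k +
    scalar_of (y * mat_adjoint z) - scalar_of (y * \<xi>) * cnj (scalar_of (z * \<xi>)) / complex_of_real x"
proof -
  have d: "dim_row S = p" "dim_col S = q" "dim_row T = p" "dim_col T = q" "dim_row b = 1" "dim_col b = N"
    "dim_row c = 1" "dim_col c = N" "dim_row y = 1" "dim_col y = p" "dim_row z = 1" "dim_col z = p"
    using assms by auto
  define D where "D = \<xi> - S * \<eta>"
  define E where "E = \<xi> - T * \<eta>"
  have dD: "dim_row D = p" "dim_col D = 1" "dim_row E = p" "dim_col E = 1" by (auto simp: D_def E_def d dims)
  let ?s = "1 / complex_of_real (sqrt k)"
  have row: "y * append_cols (?s \<cdot>\<^sub>m (D * b)) U = append_cols ((?s * scalar_of (y * D)) \<cdot>\<^sub>m b) (y * U)"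
    if "dim_row D = p" "dim_col D = 1" "dim_row b = 1" "dim_row y = 1" "dim_col y = p" for y D b
  proof -
    have "y * (D * b) = (y * D) * b" using that by (simp add: mat_ring)
    also have "\<dots> = scalar_of (y * D) \<cdot>\<^sub>m b" by (rule mult_scalar_left) (use that in auto)
    finally show ?thesis using that by (simp add: mult_append_cols dims mat_ring mat_smult_smult)
  qed
  have s2: "?s * ?s = 1 / complex_of_real k"
    using k_pos by (simp flip: of_real_mult)
  have UU: "(y * U) * mat_adjoint (z * U) = y * mat_adjoint z - (1 / complex_of_real x) \<cdot>\<^sub>m ((y * \<xi>) * mat_adjoint (z * \<xi>))"
  proof -
    have "(y * U) * mat_adjoint (z * U) = y * (U * mat_adjoint U) * mat_adjoint z" by (simp add: mat_ring dims d)
    then show ?thesis unfolding U_gram by (simp add: mat_ring dims d)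
  qed
  have yx: "scalar_of ((y * \<xi>) * mat_adjoint (z * \<xi>)) = scalar_of (y * \<xi>) * cnj (scalar_of (z * \<xi>))"
  proof -
    have "scalar_of ((y * \<xi>) * mat_adjoint (z * \<xi>)) = scalar_of (y * \<xi>) * scalar_of (mat_adjoint (z * \<xi>))"
      by (rule scalar_of_mult) (simp_all add: d dims)
    then show ?thesis by (simp add: d dims del: adjoint_mult)
  qed
  have "(y * coeff_A S b) * mat_adjoint (z * coeff_A T c) =
      append_cols ((?s * scalar_of (y * D)) \<cdot>\<^sub>m b) (y * U) * mat_adjoint (append_cols ((?s * scalar_of (z * E)) \<cdot>\<^sub>m c) (z * U))"
    unfolding coeff_A_def D_def[symmetric] E_def[symmetric] by (simp add: row dD d del: adjoint_mult)
  also have "\<dots> = ((?s * scalar_of (y * D)) \<cdot>\<^sub>m b) * mat_adjoint ((?s * scalar_of (z * E)) \<cdot>\<^sub>m c) + (y * U) * mat_adjoint (z * U)"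
    by (rule append_cols_gram[where r = 1 and t = 1]; rule carrier_matI; simp add: d dims)
  also have "\<dots> = (?s * scalar_of (y * D) * cnj (?s * scalar_of (z * E))) \<cdot>\<^sub>m (b * mat_adjoint c) + (y * U) * mat_adjoint (z * U)"
    by (simp add: mat_ring mat_smult_smult d mult_ac)
  also have "?s * scalar_of (y * D) * cnj (?s * scalar_of (z * E)) = (?s * ?s) * scalar_of (y * D) * cnj (scalar_of (z * E))"
    by simp
  finally have *: "(y * coeff_A S b) * mat_adjoint (z * coeff_A T c) =
      (1 / complex_of_real k * scalar_of (y * D) * cnj (scalar_of (z * E))) \<cdot>\<^sub>m (b * mat_adjoint c) +
      (y * mat_adjoint z - (1 / complex_of_real x) \<cdot>\<^sub>m ((y * \<xi>) * mat_adjoint (z * \<xi>)))"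
    unfolding s2 UU .
  show ?thesis
    unfolding * D_def[symmetric] E_def[symmetric] row_inner_def by (simp add: d dims yx del: adjoint_mult)
qed

lemma gram_B:
  assumes "S \<in> carrier_mat p q" "T \<in> carrier_mat p q" "y \<in> carrier_mat 1 p" "z \<in> carrier_mat 1 p"
  defines "a \<equiv> scalar_of (y * \<xi>)" and "a' \<equiv> cnj (scalar_of (z * \<xi>))"
    and "h \<equiv> scalar_of (y * S * \<eta>)" and "h' \<equiv> cnj (scalar_of (z * T * \<eta>))"
  shows "scalar_of ((y * coeff_B S) * mat_adjoint (z * coeff_B T)) =
    scalar_of ((y * S) * mat_adjoint (z * T)) + (h * h' - h * a' - a * h') / complex_of_real k +
    a * a' * complex_of_real e / (complex_of_real x * complex_of_real k)"
proof -
  have d: "dim_row S = p" "dim_col S = q" "dim_row T = p" "dim_col T = q"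
    "dim_row y = 1" "dim_col y = p" "dim_row z = 1" "dim_col z = p"
    using assms by auto
  define Y where "Y = y * S"
  define Z where "Z = z * T"
  define n where "n = mat_adjoint \<eta> * Q"
  define \<kappa> where "\<kappa> = 1 / complex_of_real k"
  have dY: "dim_row Y = 1" "dim_col Y = q" "dim_row Z = 1" "dim_col Z = q" "dim_row n = 1" "dim_col n = q"
    by (auto simp: Y_def Z_def n_def d dims)
  have row: "y * coeff_B S = y * S * R - (\<kappa> * scalar_of (y * \<xi>)) \<cdot>\<^sub>m n"
    if "dim_row y = 1" "dim_col y = p" "dim_row S = p" "dim_col S = q" for y S
  proof -
    have "y * (\<xi> * n) = (y * \<xi>) * n" using that by (simp add: mat_ring dims dY)
    also have "\<dots> = scalar_of (y * \<xi>) \<cdot>\<^sub>m n" by (rule mult_scalar_left) (use that in \<open>auto simp: dims dY\<close>)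
    finally have "y * (\<xi> * n) = scalar_of (y * \<xi>) \<cdot>\<^sub>m n" .
    then show ?thesis using that by (simp add: coeff_B_def mat_ring mat_smult_smult dims n_def \<kappa>_def)
  qed
  have nR: "n * R = mat_adjoint \<eta>" unfolding n_def using RQ by (simp add: mat_ring dims)
  have "mat_adjoint (n * R) = \<eta>" by (simp only: nR adjoint_adjoint)
  then have Rn: "R * mat_adjoint n = \<eta>" using R by (simp add: dY dims)
  have nn: "scalar_of (n * mat_adjoint n) = complex_of_real (e * k / x)"
  proof -
    have "n * mat_adjoint n = mat_adjoint \<eta> * (Q * Q) * \<eta>"
      by (simp add: n_def mat_ring dims Q)
    also have "\<dots> = mat_adjoint \<eta> * \<eta> + (- 1 / complex_of_real x) \<cdot>\<^sub>m ((mat_adjoint \<eta> * \<eta>) * (mat_adjoint \<eta> * \<eta>))"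
      unfolding QQ by (simp add: mat_ring dims)
    finally have "scalar_of (n * mat_adjoint n) = complex_of_real (e + (- 1 / x) * (e * e))"
      by (simp add: dims scalar_of_mult \<eta>_norm)
    also have "e + (- 1 / x) * (e * e) = e * k / x" using x_pos unfolding k_eq by (simp add: field_simps)
    finally show ?thesis .
  qed
  have ZB: "mat_adjoint (z * coeff_B T) = R * mat_adjoint Z - cnj (\<kappa> * scalar_of (z * \<xi>)) \<cdot>\<^sub>m mat_adjoint n"
    unfolding row[OF d(7,8,3,4)] Z_def[symmetric] by (simp add: dY dims R)
  have "(y * coeff_B S) * mat_adjoint (z * coeff_B T) =
      Y * (R * R) * mat_adjoint Z - cnj (\<kappa> * scalar_of (z * \<xi>)) \<cdot>\<^sub>m (Y * (R * mat_adjoint n))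
      - ((\<kappa> * scalar_of (y * \<xi>)) \<cdot>\<^sub>m (n * R * mat_adjoint Z)
        - (\<kappa> * scalar_of (y * \<xi>) * cnj (\<kappa> * scalar_of (z * \<xi>))) \<cdot>\<^sub>m (n * mat_adjoint n))"
    unfolding row[OF d(5,6,1,2)] ZB Y_def[symmetric]
    by (rule eq_matI) (simp_all add: mat_ring dY dims algebra_simps del: index_mult_mat(1))
  also have "Y * (R * R) * mat_adjoint Z = Y * mat_adjoint Z + \<kappa> \<cdot>\<^sub>m ((Y * \<eta>) * mat_adjoint (Z * \<eta>))"
    unfolding RR \<kappa>_def by (simp add: mat_ring dY dims)
  also have "n * R * mat_adjoint Z = mat_adjoint (Z * \<eta>)" unfolding nR by (simp add: dY dims)
  finally have *: "(y * coeff_B S) * mat_adjoint (z * coeff_B T) =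
      Y * mat_adjoint Z + \<kappa> \<cdot>\<^sub>m ((Y * \<eta>) * mat_adjoint (Z * \<eta>))
      - cnj (\<kappa> * scalar_of (z * \<xi>)) \<cdot>\<^sub>m (Y * \<eta>)
      - ((\<kappa> * scalar_of (y * \<xi>)) \<cdot>\<^sub>m mat_adjoint (Z * \<eta>)
        - (\<kappa> * scalar_of (y * \<xi>) * cnj (\<kappa> * scalar_of (z * \<xi>))) \<cdot>\<^sub>m (n * mat_adjoint n))"
    unfolding Rn .
  have YZ: "scalar_of ((Y * \<eta>) * mat_adjoint (Z * \<eta>)) = h * h'"
  proof -
    have "scalar_of ((Y * \<eta>) * mat_adjoint (Z * \<eta>)) = scalar_of (Y * \<eta>) * scalar_of (mat_adjoint (Z * \<eta>))"
      by (rule scalar_of_mult) (simp_all add: dY dims)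
    also have "scalar_of (mat_adjoint (Z * \<eta>)) = cnj (scalar_of (Z * \<eta>))"
      by (rule scalar_of_simps(4)) (simp_all add: dY dims)
    finally show ?thesis by (simp only: h_def h'_def Y_def Z_def)
  qed
  have "scalar_of ((y * coeff_B S) * mat_adjoint (z * coeff_B T)) =
      scalar_of (Y * mat_adjoint Z) + \<kappa> * (h * h') - \<kappa> * a' * h - (\<kappa> * a * h' - \<kappa> * a * (\<kappa> * a') * complex_of_real (e * k / x))"
    unfolding * by (simp add: dY dims YZ nn a_def a'_def \<kappa>_def del: adjoint_mult)
      (simp add: h_def h'_def Y_def Z_def dims d del: adjoint_mult)
  also have "\<dots> = scalar_of (Y * mat_adjoint Z) + (h * h' - h * a' - a * h') / complex_of_real k +
      a * a' * complex_of_real e / (complex_of_real x * complex_of_real k)"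
  proof -
    have s: "\<kappa> * a * (\<kappa> * a') * complex_of_real (e * k / x) = a * a' * complex_of_real e / (complex_of_real x * complex_of_real k)"
      unfolding \<kappa>_def using k_pos by (simp add: mult_ac)
    have "w + \<kappa> * (h * h') - \<kappa> * a' * h - (\<kappa> * a * h' - W) = w + (h * h' - h * a' - a * h') / complex_of_real k + W" for w W
      by (simp add: \<kappa>_def diff_divide_distrib mult_ac)
    then show ?thesis unfolding s .
  qed
  finally show ?thesis by (simp only: Y_def Z_def)
qed

text \<open>The \<open>J\<close>-unitarity of the coefficient matrix: \<open>A A\<^sup>* - B B\<^sup>* = I - S S\<^sup>* - D D\<^sup>* (1 - b b\<^sup>*) / k\<close>
  with \<open>D = \<xi> - S \<eta>\<close>.\<close>

lemma gram_identity:
  assumes "S \<in> carrier_mat p q" "T \<in> carrier_mat p q" "b \<in> carrier_mat 1 N" "c \<in> carrier_mat 1 N"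
    "y \<in> carrier_mat 1 p" "z \<in> carrier_mat 1 p"
  shows "scalar_of ((y * coeff_A S b) * mat_adjoint (z * coeff_A T c)) -
      scalar_of ((y * coeff_B S) * mat_adjoint (z * coeff_B T)) =
    scalar_of (y * mat_adjoint z) - scalar_of ((y * S) * mat_adjoint (z * T)) -
    scalar_of (y * (\<xi> - S * \<eta>)) * cnj (scalar_of (z * (\<xi> - T * \<eta>))) * (1 - row_inner b c) / complex_of_real k"
proof -
  have d: "dim_row S = p" "dim_col S = q" "dim_row T = p" "dim_col T = q"
    "dim_row y = 1" "dim_col y = p" "dim_row z = 1" "dim_col z = p"
    using assms by auto
  define a where "a = scalar_of (y * \<xi>)"
  define a' where "a' = cnj (scalar_of (z * \<xi>))"
  define h where "h = scalar_of (y * S * \<eta>)"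
  define h' where "h' = cnj (scalar_of (z * T * \<eta>))"
  have D: "scalar_of (y * (\<xi> - S * \<eta>)) = a - h" "cnj (scalar_of (z * (\<xi> - T * \<eta>))) = a' - h'"
    by (simp_all add: a_def h_def a'_def h'_def mat_ring d dims)
  have x: "complex_of_real x = complex_of_real k + complex_of_real e" using k_eq by simp
  have nz: "complex_of_real k \<noteq> 0" "complex_of_real k + complex_of_real e \<noteq> 0"
    using k_pos x_pos x by (auto simp flip: of_real_add)
  have "v / (K + E) = v / K - v * E / ((K + E) * K)" if "K \<noteq> 0" "K + E \<noteq> 0" for v K E :: complex
  proof -
    have "v / K = v * (K + E) / ((K + E) * K)" using that by simp
    then have "v / K - v * E / ((K + E) * K) = (v * (K + E) - v * E) / ((K + E) * K)"
      by (simp only: diff_divide_distrib)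
    also have "v * (K + E) - v * E = v * K" by (simp add: algebra_simps)
    finally show ?thesis using that by simp
  qed
  then have aa: "a * a' / (complex_of_real k + complex_of_real e) =
      a * a' / complex_of_real k - a * a' * complex_of_real e / ((complex_of_real k + complex_of_real e) * complex_of_real k)"
    using nz by blast
  have "(a - h) * (a' - h') * g / K + w - (a * a' / K - W) - (v + (h * h' - h * a' - a * h') / K + W) =
      w - v - (a - h) * (a' - h') * (1 - g) / K" for g K w v W
    by (simp add: diff_divide_distrib add_divide_distrib algebra_simps)
  then show ?thesis
    unfolding gram_A[OF assms] gram_B[OF assms(1,2,5,6)] D a_def[symmetric] a'_def[symmetric]
      h_def[symmetric] h'_def[symmetric] x aa .
qed

end

context interpolation_data
begin

text \<open>Numerator and denominator of the transformation, as functions of the value \<open>b\<close> of the Blaschke factor and the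
  value \<open>\<sigma>\<close> of the parameter.\<close>

definition num :: "complex mat \<Rightarrow> complex mat \<Rightarrow> complex mat" where
  "num b \<sigma> = append_cols ((1 / complex_of_real (sqrt k)) \<cdot>\<^sub>m (\<xi> * b)) U * \<sigma>
    + ((1 / complex_of_real k) \<cdot>\<^sub>m (\<xi> * mat_adjoint \<eta>)) * Q"

definition den :: "complex mat \<Rightarrow> complex mat \<Rightarrow> complex mat" where
  "den b \<sigma> = append_cols ((1 / complex_of_real (sqrt k)) \<cdot>\<^sub>m (\<eta> * b)) (0\<^sub>m q r) * \<sigma> + R"

text \<open>The parameter consists of a block \<open>\<sigma>\<^sub>1\<close> that \<open>b\<close> multiplies and a block \<open>\<sigma>\<^sub>2\<close> that \<open>U\<close> multiplies.\<close>

lemma split_rows: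
  assumes "\<sigma> \<in> carrier_mat (N + r) q"
  obtains \<sigma>1 \<sigma>2 where "\<sigma>1 \<in> carrier_mat N q" "\<sigma>2 \<in> carrier_mat r q" "\<sigma> = \<sigma>1 @\<^sub>r \<sigma>2"
proof
  show "mat N q (\<lambda>(i, j). \<sigma> $$ (i, j)) \<in> carrier_mat N q" "mat r q (\<lambda>(i, j). \<sigma> $$ (i + N, j)) \<in> carrier_mat r q"
    by simp_all
  show "\<sigma> = mat N q (\<lambda>(i, j). \<sigma> $$ (i, j)) @\<^sub>r mat r q (\<lambda>(i, j). \<sigma> $$ (i + N, j))"
    using assms by (intro eq_matI) (auto simp: append_rows_def)
qed

lemma num_den_rows:
  assumes b: "b \<in> carrier_mat 1 N" and \<sigma>: "\<sigma>1 \<in> carrier_mat N q" "\<sigma>2 \<in> carrier_mat r q"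
  shows "num b (\<sigma>1 @\<^sub>r \<sigma>2) = (1 / complex_of_real (sqrt k)) \<cdot>\<^sub>m (\<xi> * (b * \<sigma>1)) + U * \<sigma>2
      + (1 / complex_of_real k) \<cdot>\<^sub>m (\<xi> * (mat_adjoint \<eta> * Q))"
    and "den b (\<sigma>1 @\<^sub>r \<sigma>2) = (1 / complex_of_real (sqrt k)) \<cdot>\<^sub>m (\<eta> * (b * \<sigma>1)) + R"
    and "S \<in> carrier_mat p q \<Longrightarrow> coeff_A S b * (\<sigma>1 @\<^sub>r \<sigma>2) =
      (1 / complex_of_real (sqrt k)) \<cdot>\<^sub>m (\<xi> * (b * \<sigma>1)) - (1 / complex_of_real (sqrt k)) \<cdot>\<^sub>m (S * (\<eta> * (b * \<sigma>1))) + U * \<sigma>2"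
proof -
  have d: "dim_row b = 1" "dim_col b = N" "dim_row \<sigma>1 = N" "dim_col \<sigma>1 = q" "dim_row \<sigma>2 = r" "dim_col \<sigma>2 = q"
    using assms by auto
  have split: "append_cols (c \<cdot>\<^sub>m (v * b)) W * (\<sigma>1 @\<^sub>r \<sigma>2) = c \<cdot>\<^sub>m (v * (b * \<sigma>1)) + W * \<sigma>2"
    if "dim_row W = dim_row v" "dim_col v = 1" "dim_col W = r" for c v W
  proof -
    have "append_cols (c \<cdot>\<^sub>m (v * b)) W * (\<sigma>1 @\<^sub>r \<sigma>2) = (c \<cdot>\<^sub>m (v * b)) * \<sigma>1 + W * \<sigma>2"
      by (rule append_cols_mult_rows[where r = "dim_row v", OF _ _ \<sigma>]; rule carrier_matI; simp add: that d)
    then show ?thesis using that by (simp add: mat_ring d)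
  qed
  show "num b (\<sigma>1 @\<^sub>r \<sigma>2) = (1 / complex_of_real (sqrt k)) \<cdot>\<^sub>m (\<xi> * (b * \<sigma>1)) + U * \<sigma>2
      + (1 / complex_of_real k) \<cdot>\<^sub>m (\<xi> * (mat_adjoint \<eta> * Q))"
    unfolding num_def by (subst split) (simp_all add: dims mat_ring)
  show "den b (\<sigma>1 @\<^sub>r \<sigma>2) = (1 / complex_of_real (sqrt k)) \<cdot>\<^sub>m (\<eta> * (b * \<sigma>1)) + R"
    unfolding den_def by (subst split) (simp_all add: dims mat_ring d)
  assume "S \<in> carrier_mat p q"
  then have dS: "dim_row S = p" "dim_col S = q" by auto
  have "coeff_A S b * (\<sigma>1 @\<^sub>r \<sigma>2) = (1 / complex_of_real (sqrt k)) \<cdot>\<^sub>m ((\<xi> - S * \<eta>) * (b * \<sigma>1)) + U * \<sigma>2"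
    unfolding coeff_A_def by (subst split) (simp_all add: dims dS)
  also have "(\<xi> - S * \<eta>) * (b * \<sigma>1) = \<xi> * (b * \<sigma>1) - S * (\<eta> * (b * \<sigma>1))" by (simp add: mat_ring dims dS d)
  also have "(1 / complex_of_real (sqrt k)) \<cdot>\<^sub>m \<dots> =
      (1 / complex_of_real (sqrt k)) \<cdot>\<^sub>m (\<xi> * (b * \<sigma>1)) - (1 / complex_of_real (sqrt k)) \<cdot>\<^sub>m (S * (\<eta> * (b * \<sigma>1)))"
    by (rule eq_matI) (auto simp: dims dS d right_diff_distrib simp del: index_mult_mat(1))
  finally show "coeff_A S b * (\<sigma>1 @\<^sub>r \<sigma>2) =
      (1 / complex_of_real (sqrt k)) \<cdot>\<^sub>m (\<xi> * (b * \<sigma>1)) - (1 / complex_of_real (sqrt k)) \<cdot>\<^sub>m (S * (\<eta> * (b * \<sigma>1))) + U * \<sigma>2" .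
qed

lemma num_den_carrier:
  assumes "b \<in> carrier_mat 1 N" "\<sigma> \<in> carrier_mat (N + r) q"
  shows "num b \<sigma> \<in> carrier_mat p q" "den b \<sigma> \<in> carrier_mat q q"
  unfolding num_def den_def using assms by (auto simp: dims intro!: carrier_matI)

lemma clear_denominator:
  assumes b: "b \<in> carrier_mat 1 N" and \<sigma>: "\<sigma> \<in> carrier_mat (N + r) q" and S: "S \<in> carrier_mat p q"
    and eq: "coeff_A S b * \<sigma> = coeff_B S"
  shows "num b \<sigma> = S * den b \<sigma>"
proof -
  obtain \<sigma>1 \<sigma>2 where s: "\<sigma>1 \<in> carrier_mat N q" "\<sigma>2 \<in> carrier_mat r q" "\<sigma> = \<sigma>1 @\<^sub>r \<sigma>2"
    by (rule split_rows[OF \<sigma>])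
  have d: "dim_row b = 1" "dim_col b = N" "dim_row \<sigma>1 = N" "dim_col \<sigma>1 = q" "dim_row \<sigma>2 = r" "dim_col \<sigma>2 = q"
    "dim_row S = p" "dim_col S = q"
    using b s S by auto
  let ?c = "1 / complex_of_real (sqrt k)" and ?\<kappa> = "1 / complex_of_real k"
  define X where "X = \<xi> * (b * \<sigma>1)"
  define Y where "Y = S * (\<eta> * (b * \<sigma>1))"
  define Z where "Z = U * \<sigma>2"
  define W where "W = \<xi> * (mat_adjoint \<eta> * Q)"
  define T where "T = S * R"
  have dX: "dim_row X = p" "dim_col X = q" "dim_row Y = p" "dim_col Y = q" "dim_row Z = p" "dim_col Z = q"
    "dim_row W = p" "dim_col W = q" "dim_row T = p" "dim_col T = q"
    by (simp_all add: X_def Y_def Z_def W_def T_def d dims)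
  have "?c \<cdot>\<^sub>m X - ?c \<cdot>\<^sub>m Y + Z = T - ?\<kappa> \<cdot>\<^sub>m W"
    using eq unfolding s(3) num_den_rows(3)[OF b s(1,2) S] coeff_B_def X_def Y_def Z_def W_def T_def
    by (simp add: mat_ring dims)
  then have e: "(?c \<cdot>\<^sub>m X - ?c \<cdot>\<^sub>m Y + Z) $$ (i, j) = (T - ?\<kappa> \<cdot>\<^sub>m W) $$ (i, j)" for i j by simp
  have "?c \<cdot>\<^sub>m X + Z + ?\<kappa> \<cdot>\<^sub>m W = ?c \<cdot>\<^sub>m Y + T"
  proof (rule eq_matI)
    fix i j assume "i < dim_row (?c \<cdot>\<^sub>m Y + T)" "j < dim_col (?c \<cdot>\<^sub>m Y + T)"
    then have "i < p" "j < q" by (auto simp: dX)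
    with e[of i j] show "(?c \<cdot>\<^sub>m X + Z + ?\<kappa> \<cdot>\<^sub>m W) $$ (i, j) = (?c \<cdot>\<^sub>m Y + T) $$ (i, j)"
      by (simp add: dX algebra_simps)
  qed (simp_all add: dX)
  moreover have "S * den b \<sigma> = ?c \<cdot>\<^sub>m Y + T"
    unfolding s(3) num_den_rows(2)[OF b s(1,2)] Y_def T_def by (simp add: mat_ring dims d)
  ultimately show ?thesis
    unfolding s(3) num_den_rows(1)[OF b s(1,2)] X_def Z_def W_def by simp
qed

lemma \<eta>_Q_Q: "mat_adjoint \<eta> * (Q * Q) = complex_of_real (k / x) \<cdot>\<^sub>m mat_adjoint \<eta>"
proof -
  have "mat_adjoint \<eta> * (Q * Q) = mat_adjoint \<eta> + (- 1 / complex_of_real x) \<cdot>\<^sub>m ((mat_adjoint \<eta> * \<eta>) * mat_adjoint \<eta>)"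
    unfolding QQ by (simp add: mat_ring dims)
  also have "(mat_adjoint \<eta> * \<eta>) * mat_adjoint \<eta> = complex_of_real e \<cdot>\<^sub>m mat_adjoint \<eta>"
    using mult_scalar_left[of "mat_adjoint \<eta> * \<eta>" "mat_adjoint \<eta>"] by (simp add: dims \<eta>_norm)
  also have "mat_adjoint \<eta> + (- 1 / complex_of_real x) \<cdot>\<^sub>m (complex_of_real e \<cdot>\<^sub>m mat_adjoint \<eta>) =
      complex_of_real (k / x) \<cdot>\<^sub>m mat_adjoint \<eta>"
    by (rule eq_matI) (use x_pos in \<open>auto simp: dims k_eq field_simps\<close>)
  finally show ?thesis .
qed

text \<open>If \<open>den y = 0\<close>, then also \<open>num y = S den y = 0\<close>. With \<open>\<beta> = b \<sigma>\<^sub>1 y / \<surd>k\<close> and \<open>h = \<eta>\<^sup>* Q y\<close>, multiplying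
  \<open>num y\<close> by \<open>\<xi>\<^sup>*\<close> and \<open>den y\<close> by \<open>\<eta>\<^sup>* Q\<^sup>2\<close> gives \<open>k \<beta> + h = 0\<close> and \<open>(k e / x) \<beta> + h = 0\<close>. As \<open>e < x\<close>, \<open>\<beta> = 0\<close>
  and hence \<open>R y = 0\<close>.\<close>

lemma invertible_den:
  assumes b: "b \<in> carrier_mat 1 N" and \<sigma>: "\<sigma> \<in> carrier_mat (N + r) q" and S: "S \<in> carrier_mat p q"
    and eq: "num b \<sigma> = S * den b \<sigma>"
  obtains D where "D \<in> carrier_mat q q" "den b \<sigma> * D = 1\<^sub>m q" "D * den b \<sigma> = 1\<^sub>m q"
proof (rule injective_imp_inverse[OF num_den_carrier(2)[OF b \<sigma>]])
  fix y assume y: "y \<in> carrier_mat q 1" and dy: "den b \<sigma> * y = 0\<^sub>m q 1"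
  obtain \<sigma>1 \<sigma>2 where s: "\<sigma>1 \<in> carrier_mat N q" "\<sigma>2 \<in> carrier_mat r q" "\<sigma> = \<sigma>1 @\<^sub>r \<sigma>2"
    by (rule split_rows[OF \<sigma>])
  have d: "dim_row b = 1" "dim_col b = N" "dim_row \<sigma>1 = N" "dim_col \<sigma>1 = q" "dim_row \<sigma>2 = r" "dim_col \<sigma>2 = q"
    "dim_row S = p" "dim_col S = q" "dim_row y = q" "dim_col y = 1"
    using b s S y by auto
  let ?c = "1 / complex_of_real (sqrt k)" and ?\<kappa> = "1 / complex_of_real k"
  define \<beta> where "\<beta> = ?c * scalar_of (b * \<sigma>1 * y)"
  define h where "h = scalar_of (mat_adjoint \<eta> * Q * y)"
  have "num b \<sigma> * y = S * (den b \<sigma> * y)"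
    unfolding eq by (rule mat_mult_assoc) (use num_den_carrier(2)[OF b \<sigma>] in \<open>auto simp: d\<close>)
  then have "num b \<sigma> * y = 0\<^sub>m p 1" unfolding dy by (simp add: mat_ring d)
  then have "scalar_of (mat_adjoint \<xi> * (num b \<sigma> * y)) = 0" by (simp add: mat_ring dims)
  moreover have "mat_adjoint \<xi> * (num b \<sigma> * y) = ?c \<cdot>\<^sub>m ((mat_adjoint \<xi> * \<xi>) * (b * \<sigma>1 * y)) +
      (mat_adjoint \<xi> * U) * (\<sigma>2 * y) + ?\<kappa> \<cdot>\<^sub>m ((mat_adjoint \<xi> * \<xi>) * (mat_adjoint \<eta> * Q * y))"
    unfolding s(3) num_den_rows(1)[OF b s(1,2)] by (simp add: mat_ring dims d)
  moreover have "(mat_adjoint \<xi> * \<xi>) * M = complex_of_real x \<cdot>\<^sub>m M" if "dim_row M = 1" for M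
    using mult_scalar_left[of "mat_adjoint \<xi> * \<xi>" M] that by (simp add: dims \<xi>_norm)
  ultimately have "scalar_of (?c \<cdot>\<^sub>m (complex_of_real x \<cdot>\<^sub>m (b * \<sigma>1 * y)) + 0\<^sub>m 1 r * (\<sigma>2 * y) +
      ?\<kappa> \<cdot>\<^sub>m (complex_of_real x \<cdot>\<^sub>m (mat_adjoint \<eta> * Q * y))) = 0"
    unfolding adjoint_\<xi>_U by (simp add: d dims del: scalar_of_simps)
  then have 1: "complex_of_real x * (\<beta> + ?\<kappa> * h) = 0"
    by (simp add: d dims \<beta>_def h_def mat_zero_mult algebra_simps)
  have "den b \<sigma> * y = ?c \<cdot>\<^sub>m (\<eta> * (b * \<sigma>1 * y)) + R * y"
    unfolding s(3) num_den_rows(2)[OF b s(1,2)] by (simp add: mat_ring dims d)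
  also have "\<eta> * (b * \<sigma>1 * y) = scalar_of (b * \<sigma>1 * y) \<cdot>\<^sub>m \<eta>"
    by (rule mult_scalar_right) (simp_all add: d dims)
  finally have den_y: "\<beta> \<cdot>\<^sub>m \<eta> + R * y = 0\<^sub>m q 1" unfolding dy by (simp add: mat_smult_smult \<beta>_def)
  have "mat_adjoint \<eta> * (Q * Q) * (\<beta> \<cdot>\<^sub>m \<eta> + R * y) = \<beta> \<cdot>\<^sub>m (mat_adjoint \<eta> * (Q * Q) * \<eta>) + mat_adjoint \<eta> * Q * ((Q * R) * y)"
    by (simp add: mat_ring dims d)
  also have "\<dots> = \<beta> \<cdot>\<^sub>m (complex_of_real (k / x) \<cdot>\<^sub>m (mat_adjoint \<eta> * \<eta>)) + mat_adjoint \<eta> * Q * y"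
    unfolding RQ \<eta>_Q_Q by (simp add: mat_ring dims d)
  finally have "scalar_of (mat_adjoint \<eta> * (Q * Q) * (\<beta> \<cdot>\<^sub>m \<eta> + R * y)) = \<beta> * complex_of_real (k / x) * complex_of_real e + h"
    by (simp add: d dims \<eta>_norm h_def)
  then have 2: "\<beta> * complex_of_real (k / x) * complex_of_real e + h = 0"
    unfolding den_y by (simp add: mat_ring dims)
  have "\<beta> + ?\<kappa> * h = 0" using 1 x_pos by simp
  moreover have "complex_of_real k * \<beta> + h = complex_of_real k * (\<beta> + ?\<kappa> * h)"
    using k_pos by (simp add: distrib_left)
  ultimately have "complex_of_real k * \<beta> + h = 0" by simp
  with 2 have "\<beta> * complex_of_real (k / x) * complex_of_real e = complex_of_real k * \<beta>"
    by (metis add_right_imp_eq)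
  then have "\<beta> * complex_of_real (k / x * e - k) = 0"
    by (simp add: right_diff_distrib mult_ac)
  moreover have "k / x * e - k = - (k * k) / x" using x_pos unfolding k_eq by (simp add: field_simps)
  ultimately have "\<beta> * complex_of_real (- (k * k) / x) = 0" by (simp only:)
  then have "\<beta> = 0" using k_pos x_pos by simp
  have "Q * (\<beta> \<cdot>\<^sub>m \<eta> + R * y) = \<beta> \<cdot>\<^sub>m (Q * \<eta>) + (Q * R) * y" by (simp add: mat_ring dims d)
  also have "\<dots> = y" unfolding RQ \<open>\<beta> = 0\<close> by (rule eq_matI) (auto simp: mat_ring dims d)
  finally show "y = 0\<^sub>m q 1" unfolding den_y by (simp add: mat_ring dims)
qed (rule that)

lemma value_at_zero:
  assumes \<sigma>: "\<sigma> \<in> carrier_mat (N + r) q" and D: "D \<in> carrier_mat q q" "den (0\<^sub>m 1 N) \<sigma> * D = 1\<^sub>m q"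
  shows "mat_adjoint \<xi> * (num (0\<^sub>m 1 N) \<sigma> * D) = mat_adjoint \<eta>"
proof -
  obtain \<sigma>1 \<sigma>2 where s: "\<sigma>1 \<in> carrier_mat N q" "\<sigma>2 \<in> carrier_mat r q" "\<sigma> = \<sigma>1 @\<^sub>r \<sigma>2"
    by (rule split_rows[OF \<sigma>])
  have d: "dim_row \<sigma>1 = N" "dim_col \<sigma>1 = q" "dim_row \<sigma>2 = r" "dim_col \<sigma>2 = q" "dim_row D = q" "dim_col D = q"
    using s D by auto
  let ?c = "1 / complex_of_real (sqrt k)" and ?\<kappa> = "1 / complex_of_real k"
  have "den (0\<^sub>m 1 N) \<sigma> = R"
    unfolding s(3) num_den_rows(2)[OF zero_carrier_mat s(1,2)]
    by (rule eq_matI) (auto simp: mat_ring dims d)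
  then have "R * D = 1\<^sub>m q" using D by simp
  then have "Q * (R * D) = Q" by (simp add: mat_ring dims)
  moreover have "Q * (R * D) = (Q * R) * D" by (simp add: mat_ring dims d)
  ultimately have DQ: "D = Q" unfolding RQ by (simp add: mat_ring d)
  have "num (0\<^sub>m 1 N) \<sigma> = U * \<sigma>2 + ?\<kappa> \<cdot>\<^sub>m (\<xi> * (mat_adjoint \<eta> * Q))"
    unfolding s(3) num_den_rows(1)[OF zero_carrier_mat s(1,2)]
    by (rule eq_matI) (auto simp: mat_ring dims d simp del: index_mult_mat(1))
  then have "mat_adjoint \<xi> * (num (0\<^sub>m 1 N) \<sigma> * D) =
      (mat_adjoint \<xi> * U) * (\<sigma>2 * Q) + ?\<kappa> \<cdot>\<^sub>m ((mat_adjoint \<xi> * \<xi>) * (mat_adjoint \<eta> * (Q * Q)))"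
    unfolding DQ by (simp add: mat_ring dims d)
  also have "(mat_adjoint \<xi> * \<xi>) * (mat_adjoint \<eta> * (Q * Q)) = complex_of_real x \<cdot>\<^sub>m (mat_adjoint \<eta> * (Q * Q))"
    using mult_scalar_left[of "mat_adjoint \<xi> * \<xi>" "mat_adjoint \<eta> * (Q * Q)"] by (simp add: dims \<xi>_norm)
  finally show ?thesis
    unfolding adjoint_\<xi>_U \<eta>_Q_Q
    by (intro eq_matI) (use x_pos k_pos in \<open>auto simp: mat_ring dims d\<close>)
qed

end

section \<open>The Schur complement of the interpolation condition\<close>

context interpolation_data
begin

text \<open>If \<open>\<xi>\<^sup>* s(\<nu>) = \<eta>\<^sup>*\<close>, the kernel \<open>K\<close> of \<open>s\<close> satisfies
  \<open>K(\<lambda>, \<nu>) \<xi> = (\<xi> - s(\<lambda>) \<eta>) / (1 - \<langle>\<lambda>, \<nu>\<rangle>)\<close> and \<open>\<xi>\<^sup>* K(\<nu>, \<nu>) \<xi> = k / (1 - \<langle>\<nu>, \<nu>\<rangle>)\<close>. Adding the point \<open>\<nu>\<close> with the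
  vector \<open>\<tau> \<xi>\<close> and minimising over \<open>\<tau>\<close> shows that the Schur complement is positive.\<close>

lemma schur_complement_positive:
  fixes l y :: "nat \<Rightarrow> complex mat" and z :: "nat \<Rightarrow> complex"
  assumes s: "schur_multiplier N p q s" and \<nu>: "\<nu> \<in> unit_ball N"
    and interp: "mat_adjoint \<xi> * s \<nu> = mat_adjoint \<eta>"
    and l: "\<And>i. i < n \<Longrightarrow> l i \<in> unit_ball N" and y: "\<And>i. i < n \<Longrightarrow> y i \<in> carrier_mat 1 p"
  defines "f \<equiv> \<lambda>i. scalar_of (y i * (\<xi> - s (l i) * \<eta>)) / (1 - row_inner (l i) \<nu>)"
  shows "0 \<le> (\<Sum>i<n. \<Sum>j<n. z i * cnj (z j) *
    ((scalar_of (y i * mat_adjoint (y j)) - scalar_of ((y i * s (l i)) * mat_adjoint (y j * s (l j)))) / (1 - row_inner (l i) (l j))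
      - f i * cnj (f j) * (1 - row_inner \<nu> \<nu>) / complex_of_real k))"
proof -
  obtain m where m: "row_inner \<nu> \<nu> = complex_of_real m" "m < 1" by (rule row_inner_self[OF \<nu>])
  have sc: "s u \<in> carrier_mat p q" if "u \<in> unit_ball N" for u
    using s that by (auto simp: schur_multiplier_def)
  have ds: "dim_row (s u) = p" "dim_col (s u) = q" if "u \<in> unit_ball N" for u using sc[OF that] by auto
  have dy: "dim_row (y i) = 1" "dim_col (y i) = p" if "i < n" for i using y[OF that] by auto
  have "mat_adjoint (mat_adjoint \<xi> * s \<nu>) = \<eta>" by (simp only: interp adjoint_adjoint)
  then have s\<xi>: "mat_adjoint (s \<nu>) * \<xi> = \<eta>" by (simp add: dims ds[OF \<nu>])
  define K where "K u v = (1 / (1 - row_inner u v)) \<cdot>\<^sub>m (1\<^sub>m p - s u * mat_adjoint (s v))" for u v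
  define \<Phi> where "\<Phi> = (\<Sum>i<n. z i * f i)"
  \<comment> \<open>The minimiser of the sum below, a quadratic function of \<open>\<tau>\<close> with leading coefficient \<open>k / (1 - m)\<close>.\<close>
  define \<tau> where "\<tau> = - cnj \<Phi> * complex_of_real ((1 - m) / k)"
  define pt where "pt i = (if i < n then l i else \<nu>)" for i
  define v where "v i = (if i < n then cnj (z i) \<cdot>\<^sub>m mat_adjoint (y i) else \<tau> \<cdot>\<^sub>m \<xi>)" for i
  define G where "G i j = scalar_of (mat_adjoint (v i) * K (pt i) (pt j) * v j)" for i j
  have pt: "pt i \<in> unit_ball N" for i using l \<nu> by (simp add: pt_def)
  have v: "v i \<in> carrier_mat p 1" for i using \<xi> by (auto simp: v_def dy dims intro!: carrier_matI)
  have "0 \<le> (\<Sum>i<Suc n. \<Sum>j<Suc n. G i j)"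
    unfolding G_def K_def
    by (rule s[unfolded schur_multiplier_def positive_kernel_def, THEN conjunct2, rule_format]) (use pt v in blast)
  also have "\<dots> = (\<Sum>i<n. \<Sum>j<n. G i j) + (\<Sum>i<n. G i n) + (\<Sum>j<n. G n j) + G n n"
    by (simp add: sum.distrib)
  also have "(\<Sum>i<n. G i n) = \<tau> * \<Phi>"
  proof -
    have "G i n = \<tau> * (z i * f i)" if i: "i < n" for i
    proof -
      have "mat_adjoint (v i) * K (l i) \<nu> * (\<tau> \<cdot>\<^sub>m \<xi>) =
          (\<tau> * (1 / (1 - row_inner (l i) \<nu>)) * z i) \<cdot>\<^sub>m (y i * (\<xi> - s (l i) * (mat_adjoint (s \<nu>) * \<xi>)))"
        using i by (simp add: v_def K_def mat_ring mat_smult_smult mat_smult_minus dims dy ds[OF \<nu>] ds[OF l[OF i]] mult_ac)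
      then show ?thesis using i unfolding s\<xi>
        by (simp add: G_def pt_def v_def f_def dims dy ds[OF l[OF i]] mult_ac)
    qed
    then show ?thesis by (simp add: \<Phi>_def sum_distrib_left)
  qed
  also have "(\<Sum>j<n. G n j) = cnj \<tau> * cnj \<Phi>"
  proof -
    have "G n j = cnj \<tau> * cnj (z j * f j)" if j: "j < n" for j
    proof -
      have c: "cnj (row_inner (l j) \<nu>) = row_inner \<nu> (l j)"
        by (rule row_inner_cnj[OF unit_ballD(1)[OF l[OF j]] unit_ballD(1)[OF \<nu>]])
      have "mat_adjoint (\<tau> \<cdot>\<^sub>m \<xi>) * K \<nu> (l j) * v j =
          (cnj \<tau> * (1 / (1 - row_inner \<nu> (l j))) * cnj (z j)) \<cdot>\<^sub>m
            ((mat_adjoint \<xi> - mat_adjoint \<xi> * s \<nu> * mat_adjoint (s (l j))) * mat_adjoint (y j))"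
        using j by (simp add: v_def K_def mat_ring mat_smult_smult mat_smult_minus dims dy ds[OF \<nu>] ds[OF l[OF j]] mult_ac)
      also have "(mat_adjoint \<xi> - mat_adjoint \<xi> * s \<nu> * mat_adjoint (s (l j))) * mat_adjoint (y j) =
          mat_adjoint (y j * (\<xi> - s (l j) * \<eta>))"
        unfolding interp using j by (simp add: dims dy ds[OF l[OF j]] mat_ring)
      finally have "mat_adjoint (\<tau> \<cdot>\<^sub>m \<xi>) * K \<nu> (l j) * v j =
          (cnj \<tau> * (1 / (1 - row_inner \<nu> (l j))) * cnj (z j)) \<cdot>\<^sub>m mat_adjoint (y j * (\<xi> - s (l j) * \<eta>))" .
      moreover have "scalar_of (mat_adjoint (y j * (\<xi> - s (l j) * \<eta>))) = cnj (scalar_of (y j * (\<xi> - s (l j) * \<eta>)))"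
        by (rule scalar_of_simps(4)) (use j in \<open>simp_all add: dims dy ds[OF l[OF j]]\<close>)
      ultimately have "scalar_of (mat_adjoint (\<tau> \<cdot>\<^sub>m \<xi>) * K \<nu> (l j) * v j) =
          cnj \<tau> * (1 / (1 - row_inner \<nu> (l j))) * cnj (z j) * cnj (scalar_of (y j * (\<xi> - s (l j) * \<eta>)))"
        using j by (simp add: dims dy ds[OF l[OF j]] del: adjoint_mult)
      moreover have "G n j = scalar_of (mat_adjoint (\<tau> \<cdot>\<^sub>m \<xi>) * K \<nu> (l j) * v j)"
        using j by (simp add: G_def pt_def v_def)
      ultimately show ?thesis by (simp add: f_def c mult_ac)
    qed
    then show ?thesis by (simp add: \<Phi>_def sum_distrib_left)
  qed
  also have "G n n = \<tau> * cnj \<tau> * complex_of_real (k / (1 - m))"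
  proof -
    have "mat_adjoint (\<tau> \<cdot>\<^sub>m \<xi>) * K \<nu> \<nu> * (\<tau> \<cdot>\<^sub>m \<xi>) = (\<tau> * cnj \<tau> * (1 / (1 - row_inner \<nu> \<nu>))) \<cdot>\<^sub>m
        (mat_adjoint \<xi> * \<xi> - (mat_adjoint \<xi> * s \<nu>) * (mat_adjoint (s \<nu>) * \<xi>))"
      by (simp add: K_def mat_ring mat_smult_smult mat_smult_minus dims ds[OF \<nu>] mult_ac)
    then have "scalar_of (mat_adjoint (\<tau> \<cdot>\<^sub>m \<xi>) * K \<nu> \<nu> * (\<tau> \<cdot>\<^sub>m \<xi>)) =
        \<tau> * cnj \<tau> * (1 / (1 - row_inner \<nu> \<nu>)) * (complex_of_real x - complex_of_real e)"
      unfolding s\<xi> interp by (simp add: dims \<xi>_norm \<eta>_norm)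
    then show ?thesis by (simp add: G_def pt_def v_def m k_eq)
  qed
  also have "(\<Sum>i<n. \<Sum>j<n. G i j) + \<tau> * \<Phi> + cnj \<tau> * cnj \<Phi> + \<tau> * cnj \<tau> * complex_of_real (k / (1 - m)) =
      (\<Sum>i<n. \<Sum>j<n. G i j) - \<Phi> * cnj \<Phi> * ((1 - row_inner \<nu> \<nu>) / complex_of_real k)"
    unfolding \<tau>_def m(1) using m(2) k_pos by (simp add: field_simps)
  also have "\<Phi> * cnj \<Phi> * ((1 - row_inner \<nu> \<nu>) / complex_of_real k) =
      (\<Sum>i<n. \<Sum>j<n. z i * cnj (z j) * (f i * cnj (f j) * (1 - row_inner \<nu> \<nu>) / complex_of_real k))"
  proof -
    have "\<Phi> * cnj \<Phi> = (\<Sum>i<n. \<Sum>j<n. (z i * f i) * cnj (z j * f j))"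
      unfolding \<Phi>_def cnj_sum by (rule sum_product)
    then show ?thesis by (simp only: sum_distrib_right) (intro sum.cong refl, simp add: mult_ac)
  qed
  also have "(\<Sum>i<n. \<Sum>j<n. G i j) = (\<Sum>i<n. \<Sum>j<n. z i * cnj (z j) *
      ((scalar_of (y i * mat_adjoint (y j)) - scalar_of ((y i * s (l i)) * mat_adjoint (y j * s (l j)))) / (1 - row_inner (l i) (l j))))"
    by (intro sum.cong refl)
      (simp add: G_def pt_def v_def K_def mat_ring dims dy ds[OF l] mult_ac right_diff_distrib diff_divide_distrib)
  finally show ?thesis by (simp add: sum_subtractf right_diff_distrib)
qed

text \<open>Solving \<open>A \<sigma> = B\<close> by a Schur multiplier: the kernel of the tangential interpolation problem is the
  Schur complement, by the kernel identity for Blaschke factors.\<close>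

lemma exists_parameter:
  assumes s: "schur_multiplier N p q s" and \<nu>: "\<nu> \<in> unit_ball N"
    and interp: "mat_adjoint \<xi> * s \<nu> = mat_adjoint \<eta>"
  obtains \<sigma> where "schur_multiplier N (N + r) q \<sigma>"
    "\<And>l. l \<in> unit_ball N \<Longrightarrow> coeff_A (s l) (blaschke N \<nu> l) * \<sigma> l = coeff_B (s l)"
proof -
  have sc: "s l \<in> carrier_mat p q" if "l \<in> unit_ball N" for l
    using s that by (auto simp: schur_multiplier_def)
  have ds: "dim_row (s l) = p" "dim_col (s l) = q" if "l \<in> unit_ball N" for l using sc[OF that] by auto
  have bc: "blaschke N \<nu> l \<in> carrier_mat 1 N" if "l \<in> unit_ball N" for l
    by (rule blaschke_facts(1)[OF \<nu> unit_ballD(1)[OF that]])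
  \<comment> \<open>A row \<open>y\<close> at a point \<open>l\<close> stands for the condition \<open>y A(l) \<sigma>(l) = y B(l)\<close>.\<close>
  define I where "I = unit_ball N \<times> (carrier_mat 1 p :: complex mat set)"
  define \<alpha> where "\<alpha> = (\<lambda>(l, y). y * coeff_A (s l) (blaschke N \<nu> l))"
  define \<beta> where "\<beta> = (\<lambda>(l, y). y * coeff_B (s l))"
  have cA: "coeff_A (s l) (blaschke N \<nu> l) \<in> carrier_mat p (N + r)" and cB: "coeff_B (s l) \<in> carrier_mat p q"
    if "l \<in> unit_ball N" for l
    using bc[OF that] by (auto simp: coeff_A_def coeff_B_def dims ds[OF that] intro!: carrier_matI)
  obtain \<sigma> where \<sigma>: "schur_multiplier N (N + r) q \<sigma>" "\<And>i. i \<in> I \<Longrightarrow> \<alpha> i * \<sigma> (fst i) = \<beta> i"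
  proof (rule tangential_interpolation[of I fst N \<alpha> "N + r" \<beta> q])
    show "fst i \<in> unit_ball N" if "i \<in> I" for i using that by (auto simp: I_def)
    show "\<alpha> i \<in> carrier_mat 1 (N + r)" if "i \<in> I" for i
      using that cA by (auto simp: I_def \<alpha>_def intro!: mult_carrier_mat)
    show "\<beta> i \<in> carrier_mat 1 q" if "i \<in> I" for i
      using that cB by (auto simp: I_def \<beta>_def intro!: mult_carrier_mat)
    fix n :: nat and g :: "nat \<Rightarrow> complex mat \<times> complex mat" and z :: "nat \<Rightarrow> complex"
    assume g: "\<And>i. i < n \<Longrightarrow> g i \<in> I"
    define l where "l i = fst (g i)" for i
    define y where "y i = snd (g i)" for i
    have l: "l i \<in> unit_ball N" and y: "y i \<in> carrier_mat 1 p" if "i < n" for i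
      using g[OF that] by (auto simp: I_def l_def y_def)
    define f where "f i = scalar_of (y i * (\<xi> - s (l i) * \<eta>)) / (1 - row_inner (l i) \<nu>)" for i
    have "(scalar_of (\<alpha> (g i) * mat_adjoint (\<alpha> (g j))) - scalar_of (\<beta> (g i) * mat_adjoint (\<beta> (g j)))) / (1 - row_inner (l i) (l j)) =
        (scalar_of (y i * mat_adjoint (y j)) - scalar_of ((y i * s (l i)) * mat_adjoint (y j * s (l j)))) / (1 - row_inner (l i) (l j))
          - f i * cnj (f j) * (1 - row_inner \<nu> \<nu>) / complex_of_real k"
      if i: "i < n" and j: "j < n" for i j
    proof -
      have ab: "\<alpha> (g i) = y i * coeff_A (s (l i)) (blaschke N \<nu> (l i))" "\<beta> (g i) = y i * coeff_B (s (l i))" for i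
        by (simp_all add: \<alpha>_def \<beta>_def l_def y_def case_prod_unfold)
      have c: "cnj (row_inner (l j) \<nu>) = row_inner \<nu> (l j)"
        by (rule row_inner_cnj[OF unit_ballD(1)[OF l[OF j]] unit_ballD(1)[OF \<nu>]])
      have "a * b * ((1 - m) * (1 - u) / ((1 - v) * (1 - w))) / k / (1 - u) = (a / (1 - v)) * (b / (1 - w)) * (1 - m) / k"
        if "1 - u \<noteq> 0" for a b m u v w k :: complex
        using that by (simp add: mult.assoc)
      from this[OF one_minus_row_inner[OF l[OF i] l[OF j]]] show ?thesis
        unfolding ab gram_identity[OF sc[OF l[OF i]] sc[OF l[OF j]] bc[OF l[OF i]] bc[OF l[OF j]] y[OF i] y[OF j]]
          blaschke_kernel[OF \<nu> l[OF i] l[OF j]] f_def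
        by (simp add: c diff_divide_distrib)
    qed
    then have "(\<Sum>i<n. \<Sum>j<n. z i * cnj (z j) * ((scalar_of (\<alpha> (g i) * mat_adjoint (\<alpha> (g j))) -
        scalar_of (\<beta> (g i) * mat_adjoint (\<beta> (g j)))) / (1 - row_inner (l i) (l j)))) =
      (\<Sum>i<n. \<Sum>j<n. z i * cnj (z j) *
        ((scalar_of (y i * mat_adjoint (y j)) - scalar_of ((y i * s (l i)) * mat_adjoint (y j * s (l j)))) / (1 - row_inner (l i) (l j))
          - f i * cnj (f j) * (1 - row_inner \<nu> \<nu>) / complex_of_real k))"
      by (intro sum.cong refl) simp
    also have "0 \<le> \<dots>"
      unfolding f_def by (rule schur_complement_positive[OF s \<nu> interp l y])
    finally show "0 \<le> (\<Sum>i<n. \<Sum>j<n. z i * cnj (z j) * ((scalar_of (\<alpha> (g i) * mat_adjoint (\<alpha> (g j))) -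
        scalar_of (\<beta> (g i) * mat_adjoint (\<beta> (g j)))) / (1 - row_inner (fst (g i)) (fst (g j)))))"
      unfolding l_def .
  qed (rule that)
  have "coeff_A (s l) (blaschke N \<nu> l) * \<sigma> l = coeff_B (s l)" if l: "l \<in> unit_ball N" for l
  proof (rule unit_row_eqI[where n = p and m = q])
    have \<sigma>l: "\<sigma> l \<in> carrier_mat (N + r) q" using \<sigma>(1) l by (auto simp: schur_multiplier_def)
    show "coeff_A (s l) (blaschke N \<nu> l) * \<sigma> l \<in> carrier_mat p q" using cA[OF l] \<sigma>l by (rule mult_carrier_mat)
    show "coeff_B (s l) \<in> carrier_mat p q" by (rule cB[OF l])
    fix i assume "i < p"
    have "unit_row p i * coeff_A (s l) (blaschke N \<nu> l) * \<sigma> l = unit_row p i * coeff_B (s l)"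
      using \<sigma>(2)[of "(l, unit_row p i)"] l unit_row_dim(3)[of p i] by (simp add: I_def \<alpha>_def \<beta>_def del: One_nat_def)
    then show "unit_row p i * (coeff_A (s l) (blaschke N \<nu> l) * \<sigma> l) = unit_row p i * coeff_B (s l)"
      using cA[OF l] \<sigma>l by (subst mat_mult_assoc[symmetric]) auto
  qed
  then show ?thesis by (rule that[OF \<sigma>(1)])
qed

end

section \<open>The interpolation theorem\<close>

theorem theorem2:
  fixes N p q :: nat
    and s :: "complex mat \<Rightarrow> complex mat"
    and \<nu> \<xi> \<eta> c U1 U2 U3 U4 G :: "complex mat"
    and \<kappa> :: complex
  assumes "N \<ge> 1" and "p \<ge> 1" and "q \<ge> 1"
    and "schur_multiplier N p q s"
    and "\<nu> \<in> unit_ball N"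
    and "\<xi> \<in> carrier_mat p 1" and "\<eta> \<in> carrier_mat q 1"
    and "scalar_of (mat_adjoint \<eta> * \<eta>) < scalar_of (mat_adjoint \<xi> * \<xi>)"
    and "c = \<xi> @\<^sub>r \<eta>"
    and "\<kappa> = scalar_of (mat_adjoint c * signature_mat p q * c)"
    and "U1 \<in> carrier_mat (p - 1) (p - 1)" and "U2 \<in> carrier_mat (p - 1) 1"
    and "U3 \<in> carrier_mat 1 (p - 1)" and "U4 \<in> carrier_mat 1 1"
    and "unitary_mat p (four_block_mat U1 U2 U3 U4)"
    and "U2 @\<^sub>r U4 = (1 / csqrt (scalar_of (mat_adjoint \<xi> * \<xi>))) \<cdot>\<^sub>m \<xi>"
    and "G = 1\<^sub>m q + (1 / \<kappa>) \<cdot>\<^sub>m (\<eta> * mat_adjoint \<eta>)"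
  shows "mat_adjoint \<xi> * s \<nu> = mat_adjoint \<eta> \<longleftrightarrow>
    (\<exists>s\<^sub>\<nu>. schur_multiplier N (p - 1 + N) q s\<^sub>\<nu> \<and>
      (\<forall>l \<in> unit_ball N.
        let num = append_cols ((1 / csqrt \<kappa>) \<cdot>\<^sub>m (\<xi> * blaschke N \<nu> l)) (U1 @\<^sub>r U3) * s\<^sub>\<nu> l
              + ((1 / \<kappa>) \<cdot>\<^sub>m (\<xi> * mat_adjoint \<eta>)) * mat_inv (mat_sqrt G);
            den = append_cols ((1 / csqrt \<kappa>) \<cdot>\<^sub>m (\<eta> * blaschke N \<nu> l)) (0\<^sub>m q (p - 1)) * s\<^sub>\<nu> l
              + mat_sqrt G
        in invertible_mat den \<and> s l = num * mat_inv den))"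
proof -
  have d: "dim_row \<xi> = p" "dim_col \<xi> = 1" "dim_row \<eta> = q" "dim_col \<eta> = 1"
    using assms(6,7) by auto
  define x where "x = Re (scalar_of (mat_adjoint \<xi> * \<xi>))"
  define e where "e = Re (scalar_of (mat_adjoint \<eta> * \<eta>))"
  define k where "k = x - e"
  have x: "scalar_of (mat_adjoint \<xi> * \<xi>) = complex_of_real x" and e: "scalar_of (mat_adjoint \<eta> * \<eta>) = complex_of_real e"
    and e0: "0 \<le> e"
    using scalar_gram_col_nonneg[of \<xi>] scalar_gram_col_nonneg[of \<eta>] d
    by (auto simp: x_def e_def less_eq_complex_def complex_eq_iff)
  have k: "0 < k" using assms(8) unfolding x e by (simp add: k_def less_complex_def)
  have x0: "0 < x" using k e0 by (simp add: k_def)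
  have \<kappa>: "\<kappa> = complex_of_real k"
  proof -
    have "mat_adjoint c = append_cols (mat_adjoint \<xi>) (mat_adjoint \<eta>)"
      unfolding assms(9) append_rows_def append_cols_def
      by (subst adjoint_four_block[OF assms(6) _ assms(7), of _ 0]) (simp_all add: d)
    moreover have "append_cols (mat_adjoint \<xi>) (mat_adjoint \<eta>) * signature_mat p q =
        append_cols (mat_adjoint \<xi> * 1\<^sub>m p + mat_adjoint \<eta> * 0\<^sub>m q p) (mat_adjoint \<xi> * 0\<^sub>m p q + mat_adjoint \<eta> * (- 1\<^sub>m q))"
      unfolding signature_mat_def
      by (rule append_cols_mult_block[where r = 1]) (auto simp: d intro!: carrier_matI)
    moreover have "mat_adjoint \<eta> * (- 1\<^sub>m q) = - mat_adjoint \<eta>"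
      using d by (subst uminus_mult_right_mat) (simp_all add: mat_one_mult)
    ultimately have "mat_adjoint c * signature_mat p q = append_cols (mat_adjoint \<xi>) (- mat_adjoint \<eta>)"
      by (simp add: mat_ring d)
    then have "mat_adjoint c * signature_mat p q * c = mat_adjoint \<xi> * \<xi> + (- mat_adjoint \<eta>) * \<eta>"
      unfolding assms(9)
      by (simp only:) (rule append_cols_mult_rows[where r = 1, OF _ _ assms(6,7)], auto simp: d intro!: carrier_matI)
    also have "(- mat_adjoint \<eta>) * \<eta> = - (mat_adjoint \<eta> * \<eta>)"
      by (subst uminus_mult_left_mat) (simp_all add: d)
    finally have "\<kappa> = scalar_of (mat_adjoint \<xi> * \<xi>) - scalar_of (mat_adjoint \<eta> * \<eta>)"
      unfolding assms(10) by (simp add: scalar_of_def d del: index_mult_mat(1))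
    then show ?thesis by (simp add: x e k_def)
  qed
  define r where "r = p - 1"
  define U where "U = U1 @\<^sub>r U3"
  have p: "r + 1 = p" using assms(2) by (simp add: r_def)
  have U: "U \<in> carrier_mat p r"
    unfolding U_def using carrier_append_rows[OF assms(11,13)] p by (simp add: r_def)
  have u: "U2 @\<^sub>r U4 \<in> carrier_mat p 1"
    using carrier_append_rows[OF assms(12,14)] p by (simp add: r_def)
  have dU: "dim_row U1 = r" "dim_col U1 = r" "dim_row U2 = r" "dim_col U2 = 1"
    "dim_row U3 = 1" "dim_col U3 = r" "dim_row U4 = 1" "dim_col U4 = 1"
    using assms(11-14) by (auto simp: r_def)
  have U_gram: "U * mat_adjoint U = 1\<^sub>m p - (1 / complex_of_real x) \<cdot>\<^sub>m (\<xi> * mat_adjoint \<xi>)"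
  proof -
    have four: "four_block_mat U1 U2 U3 U4 = append_cols U (U2 @\<^sub>r U4)"
      by (rule eq_matI) (auto simp: append_cols_def append_rows_def U_def dU)
    have "U * mat_adjoint U + (U2 @\<^sub>r U4) * mat_adjoint (U2 @\<^sub>r U4) = 1\<^sub>m p"
      using assms(15) append_cols_gram[OF U u U u] unfolding unitary_mat_def four by simp
    moreover have "(U2 @\<^sub>r U4) * mat_adjoint (U2 @\<^sub>r U4) = (1 / complex_of_real x) \<cdot>\<^sub>m (\<xi> * mat_adjoint \<xi>)"
    proof -
      have "csqrt (complex_of_real x) = complex_of_real (sqrt x)" using x0 by simp
      moreover have "1 / complex_of_real (sqrt x) * (1 / complex_of_real (sqrt x)) = 1 / complex_of_real x"
        using x0 by (simp flip: of_real_mult)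
      ultimately show ?thesis unfolding assms(16) x by (simp add: mat_ring mat_smult_smult d)
    qed
    ultimately have sum: "U * mat_adjoint U + (1 / complex_of_real x) \<cdot>\<^sub>m (\<xi> * mat_adjoint \<xi>) = 1\<^sub>m p"
      by simp
    show ?thesis by (rule mat_eq_diffI[OF sum]) (use U d in auto)
  qed
  have t: "1 + 1 / k * e > 0" "1 / k \<noteq> 0" "- (1 / k) / (1 + 1 / k * e) = - 1 / x"
    using k e0 x0 by (auto simp: k_def field_simps add_pos_nonneg)
  have G: "G = 1\<^sub>m q + complex_of_real (1 / k) \<cdot>\<^sub>m (\<eta> * mat_adjoint \<eta>)" by (simp add: assms(17) \<kappa>)
  note R = mat_sqrt_rank_one[OF assms(7) e_def t(1,2) G]
    and Q = mat_inv_sqrt_rank_one_square[OF assms(7) e_def t(1,2) G, unfolded t(3)]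
  interpret interpolation_data p q r \<xi> \<eta> U "mat_sqrt G" "mat_inv (mat_sqrt G)" x e k
    by unfold_locales (use assms(6,7) x e k k_def U U_gram R Q G in simp_all)
  have root: "csqrt \<kappa> = complex_of_real (sqrt k)" unfolding \<kappa> using k by simp
  have comm: "p - 1 + N = N + r" by (simp add: r_def)
  have num_eq: "append_cols ((1 / csqrt \<kappa>) \<cdot>\<^sub>m (\<xi> * b)) (U1 @\<^sub>r U3) * \<sigma>
        + ((1 / \<kappa>) \<cdot>\<^sub>m (\<xi> * mat_adjoint \<eta>)) * mat_inv (mat_sqrt G) = num b \<sigma>"
    and den_eq: "append_cols ((1 / csqrt \<kappa>) \<cdot>\<^sub>m (\<eta> * b)) (0\<^sub>m q (p - 1)) * \<sigma> + mat_sqrt G = den b \<sigma>" for b \<sigma>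
    unfolding num_def den_def root unfolding \<kappa> U_def r_def by (rule refl)+
  have sc: "s l \<in> carrier_mat p q" if "l \<in> unit_ball N" for l
    using assms(4) that by (auto simp: schur_multiplier_def)
  have bc: "blaschke N \<nu> l \<in> carrier_mat 1 N" if "l \<in> unit_ball N" for l
    by (rule blaschke_facts(1)[OF assms(5) unit_ballD(1)[OF that]])
  show ?thesis
    unfolding Let_def num_eq den_eq comm
  proof
    assume interp: "mat_adjoint \<xi> * s \<nu> = mat_adjoint \<eta>"
    obtain \<sigma> where \<sigma>: "schur_multiplier N (N + r) q \<sigma>"
      "\<And>l. l \<in> unit_ball N \<Longrightarrow> coeff_A (s l) (blaschke N \<nu> l) * \<sigma> l = coeff_B (s l)"
      using exists_parameter[OF assms(4,5) interp] by blast
    have "invertible_mat (den (blaschke N \<nu> l) (\<sigma> l)) \<and>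
        s l = num (blaschke N \<nu> l) (\<sigma> l) * mat_inv (den (blaschke N \<nu> l) (\<sigma> l))" if l: "l \<in> unit_ball N" for l
    proof -
      have \<sigma>l: "\<sigma> l \<in> carrier_mat (N + r) q" using \<sigma>(1) l by (auto simp: schur_multiplier_def)
      have eq: "num (blaschke N \<nu> l) (\<sigma> l) = s l * den (blaschke N \<nu> l) (\<sigma> l)"
        by (rule clear_denominator[OF bc[OF l] \<sigma>l sc[OF l] \<sigma>(2)[OF l]])
      note den = num_den_carrier(2)[OF bc[OF l] \<sigma>l]
      obtain D where D: "D \<in> carrier_mat q q" "den (blaschke N \<nu> l) (\<sigma> l) * D = 1\<^sub>m q"
        "D * den (blaschke N \<nu> l) (\<sigma> l) = 1\<^sub>m q"
        by (rule invertible_den[OF bc[OF l] \<sigma>l sc[OF l] eq])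
      have "invertible_mat (den (blaschke N \<nu> l) (\<sigma> l))"
        unfolding invertible_mat_def inverts_mat_def using D den by (intro conjI exI[of _ D]) auto
      moreover have "mat_inv (den (blaschke N \<nu> l) (\<sigma> l)) = D" by (rule mat_inv_eqI[OF den D(1,2)])
      moreover have "num (blaschke N \<nu> l) (\<sigma> l) * D = s l * (den (blaschke N \<nu> l) (\<sigma> l) * D)"
        unfolding eq by (rule mat_mult_assoc) (use D(1) den sc[OF l] in auto)
      ultimately show ?thesis unfolding D(2) using sc[OF l] by simp
    qed
    with \<sigma>(1) show "\<exists>\<sigma>. schur_multiplier N (N + r) q \<sigma> \<and> (\<forall>l \<in> unit_ball N.
        invertible_mat (den (blaschke N \<nu> l) (\<sigma> l)) \<and>
        s l = num (blaschke N \<nu> l) (\<sigma> l) * mat_inv (den (blaschke N \<nu> l) (\<sigma> l)))" by blast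
  next
    assume "\<exists>\<sigma>. schur_multiplier N (N + r) q \<sigma> \<and> (\<forall>l \<in> unit_ball N.
        invertible_mat (den (blaschke N \<nu> l) (\<sigma> l)) \<and>
        s l = num (blaschke N \<nu> l) (\<sigma> l) * mat_inv (den (blaschke N \<nu> l) (\<sigma> l)))"
    then obtain \<sigma> where \<sigma>: "schur_multiplier N (N + r) q \<sigma>"
      "invertible_mat (den (blaschke N \<nu> \<nu>) (\<sigma> \<nu>))"
      "s \<nu> = num (blaschke N \<nu> \<nu>) (\<sigma> \<nu>) * mat_inv (den (blaschke N \<nu> \<nu>) (\<sigma> \<nu>))"
      using assms(5) by blast
    have \<sigma>\<nu>: "\<sigma> \<nu> \<in> carrier_mat (N + r) q" using \<sigma>(1) assms(5) by (auto simp: schur_multiplier_def)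
    have b0: "blaschke N \<nu> \<nu> = 0\<^sub>m 1 N" by (rule blaschke_facts(2)[OF assms(5) unit_ballD(1)[OF assms(5)]])
    note den = num_den_carrier(2)[OF zero_carrier_mat \<sigma>\<nu>]
    obtain D where "den (0\<^sub>m 1 N) (\<sigma> \<nu>) * D = 1\<^sub>m q" "D * den (0\<^sub>m 1 N) (\<sigma> \<nu>) = 1\<^sub>m (dim_row D)"
      using \<sigma>(2) den unfolding b0 invertible_mat_def inverts_mat_def by auto
    note D = this
    have "dim_col D = q" using arg_cong[OF D(1), of dim_col] by simp
    moreover have "dim_row D = q" using arg_cong[OF D(2), of dim_col] den by simp
    ultimately have Dc: "D \<in> carrier_mat q q" by (intro carrier_matI)
    have "mat_inv (den (0\<^sub>m 1 N) (\<sigma> \<nu>)) = D" by (rule mat_inv_eqI[OF den Dc D(1)])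
    then show "mat_adjoint \<xi> * s \<nu> = mat_adjoint \<eta>"
      unfolding \<sigma>(3) b0 using value_at_zero[OF \<sigma>\<nu> Dc D(1)] by simp
  qed
qed

end
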